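(* Let $J=(\tilde J(\phi))_{\phi\in H_+}$ be a Jacobi field in the Fock space $\mathcal F(H)$ with spectral measure $\rho$ on $H_-$ and Fourier transform $I:\mathcal F(H)\to L^2(H_-,d\rho)$, let $K:T_+\to H_+$ be a continuous linear operator with $\operatorname{Ker}(K)=\{0\}$ and with $\operatorname{Ran}(K)$ dense in $H_+$, let $\rho_K$ be the image of $\rho$ under $K^+:H_-\to T_-$, and let $I_K=U^{-1}I\mathcal K:\mathcal F(T)\to L^2(T_-,d\rho_K)$ (all as defined in the context). Then the unitary $I_K$ takes the set $\bigoplus_{j=0}^n\mathcal F_j(T)\subset\mathcal F(T)$, $n\in\mathbb Z_+$, to the set $\tilde{\mathcal Q}_n(T_-)\subset L^2(T_-,d\rho_K)$ of ordinary polynomials on $T_-$, i.e. $$I_K\left(\bigoplus_{j=0}^n\mathcal F_j(T)\right)=\tilde{\mathcal Q}_n(T_-),\qquad n\in\mathbb Z_+.$$ Moreover, the set $\mathcal Q(T_-)=\bigcup_{n=0}^\infty\mathcal Q_n(T_-)$ of all continuous polynomials on $T_-$ is dense in $L^2(T_-,d\rho_K)$.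
   Context: **Fock spaces.** For a real Hilbert space $X$ let $X_c$ be its complexification, $\mathcal F_n(X)=X_c^{\hat\otimes n}$ the $n$-th symmetric (Hilbert) tensor power, $\mathcal F_0(X)=\mathbb C$, and $\mathcal F(X)=\bigoplus_{n=0}^\infty\mathcal F_n(X)$ the symmetric Fock space. $\mathcal F_{\mathrm{fin}}(X)\subset\mathcal F(X)$ is the space of finite sequences $(\Phi_0,\dots,\Phi_n,0,0,\dots)$, with convergence meaning uniform finiteness together with coordinatewise convergence. $\Omega=(1,0,0,\dots)$ is the vacuum. $\mathbb Z_+=\{0,1,2,\dots\}$. **Riggings and pairings.** $H$ is a real separable Hilbert space and $H_-\supset H\supset H_+$ is a rigging with real Hilbert spaces: $H_+$ is densely and continuously embedded in $H$, $H_-=(H_+)'$ is the dual of $H_+$ with respect to the zero space $H$, $\|\cdot\|_{H_+}\ge\|\cdot\|_H$, and the embedding $H_+\hookrightarrow H$ is quasinuclear (Hilbert–Schmidt). The pairing between $H_-$ and $H_+$ given by the rigging is extended to pairings between $\mathcal F_n(H_-)$ and $\mathcal F_n(H_+)$ and between $(\mathcal F_{\mathrm{fin}}(H_+))'$ and $\mathcal F_{\mathrm{fin}}(H_+)$; all are denoted $\langle\cdot,\cdot\rangle_H$. On complex spaces they extend the scalar product: linear in the first argument, antilinear in the second, and $\langle P,\Phi\rangle_H=\overline{\langle\Phi,P\rangle_H}$. The space $(\mathcal F_{\mathrm{fin}}(H_+))'$ is identified with the direct product of the spaces $\mathcal F_n(H_-)$, $n\in\mathbb Z_+$. Likewise,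 $T_+$ is a real separable Hilbert space, $T_-\supset T_0\supset T_+$ is a rigging of real Hilbert spaces ($T_-=(T_+)'$ with respect to $T_0$), and $\langle\cdot,\cdot\rangle_T$ denotes the analogous pairings. **Jacobi field.** For each $\phi\in H_+$ and $n\in\mathbb Z_+$ let operators $a_n(\phi):\operatorname{Dom}(a_n(\phi))\subset\mathcal F_n(H)\to\mathcal F_{n+1}(H)$, $b_n(\phi)=(b_n(\phi))^*:\operatorname{Dom}(b_n(\phi))\subset\mathcal F_n(H)\to\mathcal F_n(H)$, and $a_n^*(\phi)=(a_n(\phi))^*:\operatorname{Dom}(a_n^*(\phi))\subset\mathcal F_{n+1}(H)\to\mathcal F_n(H)$ be given, where $\operatorname{Dom}(a_n(\phi))$ and $\operatorname{Dom}(b_n(\phi))$ contain $\mathcal F_n(H_+)$ and $\operatorname{Dom}(a_n^*(\phi))$ contains $\mathcal F_{n+1}(H_+)$. Define the Hermitian operator $J(\phi)$ in $\mathcal F(H)$ with domain $\mathcal F_{\mathrm{fin}}(H_+)$ by $(J(\phi)\Phi)_n=a_{n-1}(\phi)\Phi_{n-1}+b_n(\phi)\Phi_n+a_n^*(\phi)\Phi_{n+1}$, $n\in\mathbb Z_+$, $a_{-1}(\phi)=0$. Let $\tilde J(\phi)$ be its closure. The family $J=(\tilde J(\phi))_{\phi\in H_+}$ is called a (commutative) Jacobi field if: (a) $a_n(\phi)$ and $b_n(\phi)$ take real spaces into real ones; (b) the restrictions of $a_n(\phi)$ and $b_n(\phi)$ to $\mathcal F_n(H_+)$ act continuously from $\mathcal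 F_n(H_+)$ to $\mathcal F_{n+1}(H_+)$ and $\mathcal F_n(H_+)$, respectively, and the restriction of $a_n^*(\phi)$ to $\mathcal F_{n+1}(H_+)$ acts continuously from $\mathcal F_{n+1}(H_+)$ to $\mathcal F_n(H_+)$; (c) the operators $J(\phi)$, $\phi\in H_+$, are essentially selfadjoint and their closures $\tilde J(\phi)$ are strongly commuting (their spectral measures commute); (d) for all $n\in\mathbb Z_+$, $\Phi_n\in\mathcal F_n(H_+)$, $\Phi_{n+1}\in\mathcal F_{n+1}(H_+)$, the functions $\phi\mapsto a_n(\phi)\Phi_n\in\mathcal F_{n+1}(H_+)$, $\phi\mapsto b_n(\phi)\Phi_n\in\mathcal F_n(H_+)$, $\phi\mapsto a_n^*(\phi)\Phi_{n+1}\in\mathcal F_n(H_+)$ are linear and continuous on $H_+$; (e) the real linear operators $V_n:\mathcal F_n(H_+)\to\bigoplus_{j=0}^n\mathcal F_j(H_+)$ defined by $V_0=\operatorname{Id}_{\mathbb C}$ and $V_n(\phi_1\hat\otimes\cdots\hat\otimes\phi_n)=J(\phi_1)\cdots J(\phi_n)\Omega$ ($\phi_i\in H_+$, $n\in\mathbb N$) are continuous, and the operators $\mathcal F_n(H_+)\ni F_n\mapsto V_{n,n}F_n=(V_nF_n)_n\in\mathcal F_n(H_+)$, $n\in\mathbb N$, are invertible. **Spectral measure of $J$.** By the known projection spectral theorem, for a Jacobi field $J$ there exist a Borel probability measure $\rho$ on $H_-$ (the spectral measure) and a function $H_-\ni\xi\mapsto P(\xi)=(P_n(\xi))_{n=0}^\infty\in(\mathcal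 F_{\mathrm{fin}}(H_+))'$ such that: (1) $\langle P(\xi),\tilde J(\phi)\Phi\rangle_H=\langle\xi,\phi\rangle_H\langle P(\xi),\Phi\rangle_H$ for all $\xi\in H_-$, $\phi\in H_+$, $\Phi\in\mathcal F_{\mathrm{fin}}(H_+)$; (2) the map $\mathcal F_{\mathrm{fin}}(H_+)\ni\Phi\mapsto(I\Phi)(\xi)=\langle\Phi,P(\xi)\rangle_H=\sum_n\langle\Phi_n,P_n(\xi)\rangle_H$ extends by continuity to a unitary operator $I:\mathcal F(H)\to L^2(H_-,d\rho)$ (the Fourier transform); (3) $I$ takes $\tilde J(\phi)$ to the operator of multiplication by $\xi\mapsto\langle\xi,\phi\rangle_H$. The normalization is $I\Omega=1$. Such $\rho$ and $P$ are fixed. **Image measure.** $K^+:H_-\to T_-$ is the continuous linear operator defined by $\langle K^+\xi,f\rangle_T=\langle\xi,Kf\rangle_H$, $\xi\in H_-$, $f\in T_+$. $\rho_K$ is the image of $\rho$ under $K^+$: $\rho_K(\Delta)=\rho((K^+)^{-1}(\Delta))$ on the $\sigma$-algebra $\mathcal C=\{\Delta\subset T_-:(K^+)^{-1}(\Delta)\in\mathcal B(H_-)\}$, where $\mathcal B(H_-)$ is the Borel $\sigma$-algebra of $H_-$. **The unitary $I_K$.** $T$ is the completion of $T_+$ with respect to the scalar product $(f_1,f_2)_T=(Kf_1,Kf_2)_H$; $K$ induces a unitary $\bar K:T\to H$ (same symbol for the complexification). $\mathcal K=\bigoplus_{n=0}^\infty\bar K^{\otimes n}:\mathcal F(T)\to\mathcal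 F(H)$ is the induced unitary. $U:L^2(T_-,d\rho_K)\to L^2(H_-,d\rho)$ is the unitary operator induced by $G\mapsto G(K^+\,\cdot)$, i.e. $(UG)(\xi)=G(K^+\xi)$, $\xi\in H_-$. The unitary $I_K$ is defined by $I_K=U^{-1}I\mathcal K$. **Polynomials.** $\mathcal Q_n(T_-)$ is the set of all continuous polynomials on $T_-$ of degree $\le n$, i.e. functions $T_-\ni\omega\mapsto q_n(\omega)=\sum_{j=0}^n\langle\omega^{\otimes j},c_j\rangle_T\in\mathbb C$ with $c_j\in\mathcal F_j(T_+)$, $n\in\mathbb Z_+$. One has $\mathcal Q_n(T_-)\subset L^2(T_-,d\rho_K)$; $\tilde{\mathcal Q}_n(T_-)$ denotes the closure of $\mathcal Q_n(T_-)$ in $L^2(T_-,d\rho_K)$, and its elements are called ordinary polynomials on $T_-$. *)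

theory Defs
  imports "HOL-Probability.Probability" "HOL-Combinatorics.Permutations"
begin

section \<open>Orthonormal bases\<close>

definition orthonormal_basis :: "'a::real_inner set \<Rightarrow> bool" where
  "orthonormal_basis B \<longleftrightarrow>
     (\<forall>x\<in>B. norm x = 1) \<and> pairwise orthogonal B \<and> closure (span B) = UNIV"

definition onb :: "'a::{real_inner, complete_space} set" where
  "onb = (SOME B. orthonormal_basis B)"

lemma closed_subspace_orthogonal_exists:
  fixes C :: "'a::{real_inner, complete_space} set"
  assumes "subspace C" "closed C" "C \<noteq> UNIV"
  obtains z where "z \<noteq> 0" "\<And>c. c \<in> C \<Longrightarrow> orthogonal z c"
proof -
  obtain x where x: "x \<notin> C" using assms(3) by auto
  have C0: "0 \<in> C" using assms(1) by (simp add: subspace_0)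
  define d where "d = infdist x C"
  have d0: "0 \<le> d" by (simp add: d_def infdist_nonneg)
  have dle: "d \<le> dist x c" if "c \<in> C" for c using that by (simp add: d_def infdist_le)
  have "\<exists>y\<in>C. dist x y < d + e" if "e > 0" for e
  proof -
    have "(INF a\<in>C. dist x a) < d + e" using C0 that by (metis d_def empty_iff infdist_notempty less_add_same_cancel1)
    then obtain a where "a \<in> C" "dist x a < d + e" using C0 by (force dest!: cInf_lessD[rotated])
    then show ?thesis by blast
  qed
  then have "\<exists>y. y \<in> C \<and> dist x y < d + 1 / real (Suc n)" for n by (meson of_nat_0_less_iff zero_less_Suc zero_less_divide_1_iff)
  then obtain y where yC: "\<And>n. y n \<in> C" and yd: "\<And>n. dist x (y n) < d + 1 / real (Suc n)"
    by metis
  have par: "(dist u v)^2 \<le> 2 * (dist x u)^2 + 2 * (dist x v)^2 - 4 * d^2" if "u \<in> C" "v \<in> C" for u v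
  proof -
    have "(1/2) *\<^sub>R (u + v) \<in> C" using assms(1) that by (simp add: subspace_add subspace_scale)
    then have "d^2 \<le> (norm (x - (1/2) *\<^sub>R (u + v)))^2"
      using dle d0 by (metis dist_norm power_mono)
    moreover have "(norm (u - v))^2 + 4 * (norm (x - (1/2) *\<^sub>R (u + v)))^2
       = 2 * (norm (x - u))^2 + 2 * (norm (x - v))^2"
      unfolding power2_norm_eq_inner by (simp add: algebra_simps inner_commute)
    ultimately show ?thesis unfolding dist_norm by linarith
  qed
  have "Cauchy y"
  proof (rule metric_CauchyI)
    fix e :: real assume e: "e > 0"
    define g where "g = (\<lambda>n. 4 * (d + 1 / real (Suc n))^2 - 4 * d^2)"
    have "g \<longlonglongrightarrow> 4 * (d + 0)^2 - 4 * d^2"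
      unfolding g_def by (intro tendsto_intros LIMSEQ_Suc[OF lim_1_over_n])
    then have "g \<longlonglongrightarrow> 0" by simp
    then have "\<forall>\<^sub>F n in sequentially. g n < e^2" using e by (intro order_tendstoD) auto
    then obtain N where N: "g N < e^2" by (auto simp: eventually_sequentially)
    have b: "(dist x (y n))^2 \<le> (d + 1 / real (Suc N))^2" if "n \<ge> N" for n
    proof (rule power_mono)
      have "1 / real (Suc n) \<le> 1 / real (Suc N)" using that by (simp add: frac_le)
      then show "dist x (y n) \<le> d + 1 / real (Suc N)" using yd[of n] by simp
    qed simp
    have "dist (y m) (y n) < e" if "m \<ge> N" "n \<ge> N" for m n
    proof -
      have "(dist (y m) (y n))^2 \<le> g N" using par[OF yC yC, of m n] b[OF that(1)] b[OF that(2)] by (simp add: g_def)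
      then have "(dist (y m) (y n))^2 < e^2" using N by simp
      then show ?thesis using e by (simp add: power2_less_imp_less)
    qed
    then show "\<exists>M. \<forall>m\<ge>M. \<forall>n\<ge>M. dist (y m) (y n) < e" by blast
  qed
  then obtain l where l: "y \<longlonglongrightarrow> l" by (auto simp: Cauchy_convergent_iff convergent_def)
  then have lC: "l \<in> C" using yC assms(2) closed_sequentially by blast
  have ld: "dist x l \<le> d"
  proof (rule LIMSEQ_le)
    show "(\<lambda>n. dist x (y n)) \<longlonglongrightarrow> dist x l" by (intro tendsto_intros l)
    show "(\<lambda>n. d + 1 / real (Suc n)) \<longlonglongrightarrow> d"
      using tendsto_add[OF tendsto_const[of d] LIMSEQ_Suc[OF lim_1_over_n]] by simp
    show "\<exists>N. \<forall>n\<ge>N. dist x (y n) \<le> d + 1 / real (Suc n)" using yd less_imp_le by blast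
  qed
  define z where "z = x - l"
  have "z \<noteq> 0" using x lC by (auto simp: z_def)
  moreover have "orthogonal z c" if c: "c \<in> C" for c
  proof (cases "c = 0")
    case False
    define t where "t = inner z c / (norm c)^2"
    have nc: "(norm c)^2 > 0" using False by simp
    have "l + t *\<^sub>R c \<in> C" using assms(1) lC c by (simp add: subspace_add subspace_scale)
    then have "norm z \<le> norm (x - (l + t *\<^sub>R c))" using dle ld by (fastforce simp: dist_norm z_def)
    then have "(norm z)^2 \<le> (norm (z - t *\<^sub>R c))^2" by (simp add: z_def algebra_simps power_mono)
    also have "\<dots> = (norm z)^2 - 2 * t * inner z c + t^2 * (norm c)^2"
      unfolding power2_norm_eq_inner by (simp add: algebra_simps inner_commute power2_eq_square)
    also have "\<dots> = (norm z)^2 - (inner z c)^2 / (norm c)^2"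
      using nc by (simp add: t_def power2_eq_square field_simps)
    finally have "(inner z c)^2 / (norm c)^2 \<le> 0" by simp
    then have "inner z c = 0" using nc by (simp add: divide_le_0_iff)
    then show ?thesis by (simp add: orthogonal_def)
  qed (simp add: orthogonal_def)
  ultimately show ?thesis by (rule that)
qed

lemma subspace_closure:
  fixes S :: "'a::real_normed_vector set"
  assumes "subspace S"
  shows "subspace (closure S)"
  unfolding subspace_def
proof (intro conjI ballI allI)
  show "0 \<in> closure S" using assms closure_subset subspace_0 by blast
next
  fix x y assume xy: "x \<in> closure S" "y \<in> closure S"
  from xy(1) obtain f where f: "\<forall>n. f n \<in> S" "f \<longlonglongrightarrow> x" by (auto simp: closure_sequential)
  from xy(2) obtain g where g: "\<forall>n. g n \<in> S" "g \<longlonglongrightarrow> y" by (auto simp: closure_sequential)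
  have "(\<lambda>n. f n + g n) \<longlonglongrightarrow> x + y" by (intro tendsto_add f g)
  moreover have "\<forall>n. f n + g n \<in> S" using f g subspace_add[OF assms] by simp
  ultimately show "x + y \<in> closure S" unfolding closure_sequential by (intro exI conjI)
next
  fix c x assume "x \<in> closure S"
  then obtain f where f: "\<forall>n. f n \<in> S" "f \<longlonglongrightarrow> x" by (auto simp: closure_sequential)
  have "(\<lambda>n. c *\<^sub>R f n) \<longlonglongrightarrow> c *\<^sub>R x" by (intro tendsto_intros f)
  moreover have "\<forall>n. c *\<^sub>R f n \<in> S" using f subspace_scale[OF assms] by simp
  ultimately show "c *\<^sub>R x \<in> closure S" unfolding closure_sequential by (intro exI conjI)
qed

lemma orthonormal_basis_exists: "\<exists>B :: 'a::{real_inner, complete_space} set. orthonormal_basis B"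
proof -
  define A where "A = {B :: 'a set. (\<forall>x\<in>B. norm x = 1) \<and> pairwise orthogonal B}"
  have "\<exists>M\<in>A. \<forall>X\<in>A. M \<subseteq> X \<longrightarrow> X = M"
  proof (rule subset_Zorn')
    fix C assume C: "subset.chain A C"
    then have sub0: "C \<subseteq> A" and "\<And>X Y. X \<in> C \<Longrightarrow> Y \<in> C \<Longrightarrow> X \<subseteq> Y \<or> Y \<subseteq> X"
      by (auto simp: subset_chain_def)
    then have ch: "\<exists>Z\<in>C. x \<in> Z \<and> y \<in> Z" if "x \<in> \<Union>C" "y \<in> \<Union>C" for x y
      using that by (meson UnionE subsetD)
    show "\<Union>C \<in> A"
      unfolding A_def pairwise_def
    proof (intro CollectI conjI ballI impI)
      fix x y assume "x \<in> \<Union>C" "y \<in> \<Union>C" "x \<noteq> y"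
      moreover obtain Z where "Z \<in> C" "x \<in> Z" "y \<in> Z" using ch calculation by blast
      ultimately show "orthogonal x y" using sub0 by (force simp: A_def pairwise_def)
    next
      fix x assume "x \<in> \<Union>C"
      then show "norm x = 1" using sub0 by (auto simp: A_def)
    qed
  qed
  then obtain M where M: "M \<in> A" "\<And>X. X \<in> A \<Longrightarrow> M \<subseteq> X \<Longrightarrow> X = M" by blast
  have "closure (span M) = UNIV"
  proof (rule ccontr)
    assume "closure (span M) \<noteq> UNIV"
    then obtain z where z: "z \<noteq> 0" "\<And>c. c \<in> closure (span M) \<Longrightarrow> orthogonal z c"
      using closed_subspace_orthogonal_exists[of "closure (span M)"] subspace_closure[of "span M"] by auto
    have zM: "orthogonal z c" if "c \<in> M" for c
      using z(2) that closure_subset span_superset by blast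
    define u where "u = z /\<^sub>R norm z"
    have "insert u M \<in> A"
      using M(1) zM z(1) unfolding A_def u_def by (auto simp: pairwise_insert orthogonal_def inner_commute)
    then have "u \<in> M" using M(2) by blast
    then have "orthogonal z u" using zM by blast
    then show False using z(1) by (simp add: u_def orthogonal_def)
  qed
  then show ?thesis using M(1) unfolding A_def orthonormal_basis_def by blast
qed

lemma orthonormal_basis_onb: "orthonormal_basis (onb :: 'a::{real_inner, complete_space} set)"
  unfolding onb_def by (rule someI_ex[OF orthonormal_basis_exists])

section \<open>Symmetric Fock spaces\<close>

text \<open>
  The \<open>n\<close>-th symmetric Hilbert tensor power of the complexification of \<open>X\<close> is realised as the space of
  symmetric, real-multilinear, separately continuous forms \<open>X\<^sup>n \<rightarrow> \<complex>\<close> of Hilbert-Schmidt class, with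
  \<open>x\<^sub>1 \<otimes> \<dots> \<otimes> x\<^sub>n\<close> corresponding to the form \<open>(y\<^sub>1, \<dots>, y\<^sub>n) \<mapsto> \<langle>x\<^sub>1, y\<^sub>1\<rangle> \<cdots> \<langle>x\<^sub>n, y\<^sub>n\<rangle>\<close>. A vector of the Fock
  space is one function on lists: its \<open>n\<close>-th component is the restriction to lists of length \<open>n\<close>.
  The scalar product is that of the full tensor power, without factorials.
\<close>

definition fock_forms :: "('x::{real_inner, complete_space} list \<Rightarrow> complex) set" where
  "fock_forms = {F. (\<forall>xs ys. mset xs = mset ys \<longrightarrow> F xs = F ys) \<and>
                (\<forall>xs. bounded_linear (\<lambda>x. F (x # xs))) \<and>
                (\<lambda>xs. (cmod (F xs))\<^sup>2) summable_on lists onb}"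

lemma fock_formsI:
  assumes "\<And>xs ys. mset xs = mset ys \<Longrightarrow> F xs = F ys" "\<And>xs. bounded_linear (\<lambda>x. F (x # xs))"
    "(\<lambda>xs. (cmod (F xs))\<^sup>2) summable_on lists onb"
  shows "F \<in> fock_forms"
  using assms unfolding fock_forms_def by blast

lemma fock_formsD:
  assumes "F \<in> fock_forms"
  shows "mset xs = mset ys \<Longrightarrow> F xs = F ys" "bounded_linear (\<lambda>x. F (x # xs))"
    "(\<lambda>xs. (cmod (F xs))\<^sup>2) summable_on lists onb"
  using assms unfolding fock_forms_def by blast+

lemma fock_forms_add:
  assumes "F \<in> fock_forms" "G \<in> fock_forms"
  shows "(\<lambda>xs. F xs + G xs) \<in> fock_forms"
proof (rule fock_formsI)
  show "(\<lambda>xs. (cmod (F xs + G xs))\<^sup>2) summable_on lists onb"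
  proof (rule summable_on_comparison_test)
    show "(\<lambda>xs. 2 * (cmod (F xs))\<^sup>2 + 2 * (cmod (G xs))\<^sup>2) summable_on lists onb"
      by (intro summable_on_add summable_on_cmult_right fock_formsD(3) assms)
    fix xs :: "'a list"
    have "(cmod (F xs + G xs))\<^sup>2 \<le> (cmod (F xs) + cmod (G xs))\<^sup>2"
      by (simp add: norm_triangle_ineq power_mono)
    also have "\<dots> \<le> 2 * (cmod (F xs))\<^sup>2 + 2 * (cmod (G xs))\<^sup>2"
      using sum_squares_bound[of "cmod (F xs)" "cmod (G xs)"] by (simp add: power2_sum)
    finally show "(cmod (F xs + G xs))\<^sup>2 \<le> 2 * (cmod (F xs))\<^sup>2 + 2 * (cmod (G xs))\<^sup>2" .
  qed auto
  show "bounded_linear (\<lambda>x. F (x # xs) + G (x # xs))" for xs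
    by (rule bounded_linear_add[OF fock_formsD(2)[OF assms(1)] fock_formsD(2)[OF assms(2)]])
  show "F xs + G xs = F ys + G ys" if "mset xs = mset ys" for xs ys
    using fock_formsD(1)[OF assms(1) that] fock_formsD(1)[OF assms(2) that] by simp
qed

lemma fock_forms_scale:
  assumes "F \<in> fock_forms"
  shows "(\<lambda>xs. c * F xs) \<in> fock_forms"
proof (rule fock_formsI)
  show "(\<lambda>xs. (cmod (c * F xs))\<^sup>2) summable_on lists onb"
    by (simp only: norm_mult power_mult_distrib) (intro summable_on_cmult_right fock_formsD(3) assms)
  show "bounded_linear (\<lambda>x. c * F (x # xs))" for xs
    by (rule bounded_linear_const_mult[OF fock_formsD(2)[OF assms]])
  show "c * F xs = c * F ys" if "mset xs = mset ys" for xs ys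
    using fock_formsD(1)[OF assms that] by simp
qed

lemma fock_forms_zero: "(\<lambda>xs. 0) \<in> fock_forms"
  by (simp add: fock_forms_def)

lemma fock_forms_vanish:
  assumes F: "F \<in> fock_forms" and z: "\<And>xs. xs \<in> lists onb \<Longrightarrow> F xs = 0"
  shows "F xs = 0"
proof -
  have "F (xs @ bs) = 0" if "bs \<in> lists onb" for bs using that
  proof (induction xs arbitrary: bs)
    case (Cons x xs)
    have lin: "bounded_linear (\<lambda>x. F (x # xs @ bs))" by (rule fock_formsD(2)[OF F])
    have "F (b # xs @ bs) = 0" if "b \<in> onb" for b
    proof -
      have "F (b # xs @ bs) = F (xs @ b # bs)" by (rule fock_formsD(1)[OF F]) simp
      then show ?thesis using Cons that by simp
    qed
    then have "F (y # xs @ bs) = 0" if "y \<in> span onb" for y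
      using linear_eq_on_span[OF bounded_linear.linear[OF lin] linear_zero _ that] by blast
    moreover have "closed {y. F (y # xs @ bs) = 0}"
      by (intro closed_Collect_eq continuous_intros linear_continuous_on lin)
    ultimately have "closure (span onb) \<subseteq> {y. F (y # xs @ bs) = 0}"
      by (intro closure_minimal) auto
    then show ?case using orthonormal_basis_onb[where 'a='a] by (auto simp: orthonormal_basis_def)
  qed (simp add: z)
  from this[of "[]"] show ?thesis by simp
qed

typedef (overloaded) 'x fock = "fock_forms :: ('x::{real_inner, complete_space} list \<Rightarrow> complex) set"
  morphisms form_of Abs_fock
  by (rule exI[of _ "\<lambda>xs. 0"]) (rule fock_forms_zero)

setup_lifting type_definition_fock

definition cinner :: "'x::{real_inner, complete_space} fock \<Rightarrow> 'x fock \<Rightarrow> complex" where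
  "cinner \<Phi> \<Psi> = (\<Sum>\<^sub>\<infinity>xs\<in>lists onb. form_of \<Phi> xs * cnj (form_of \<Psi> xs))"

lift_definition cscale :: "complex \<Rightarrow> 'x::{real_inner, complete_space} fock \<Rightarrow> 'x fock"
  is "\<lambda>c F xs. c * F xs" by (rule fock_forms_scale)

instantiation fock :: ("{real_inner, complete_space}") real_vector
begin

lift_definition zero_fock :: "'a fock" is "\<lambda>xs. 0" by (rule fock_forms_zero)
lift_definition plus_fock :: "'a fock \<Rightarrow> 'a fock \<Rightarrow> 'a fock" is "\<lambda>F G xs. F xs + G xs"
  by (rule fock_forms_add)
lift_definition uminus_fock :: "'a fock \<Rightarrow> 'a fock" is "\<lambda>F xs. - F xs"
  using fock_forms_scale[of _ "-1"] by simp
lift_definition minus_fock :: "'a fock \<Rightarrow> 'a fock \<Rightarrow> 'a fock" is "\<lambda>F G xs. F xs - G xs"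
  using fock_forms_add[OF _ fock_forms_scale[of _ "-1"]] by fastforce
lift_definition scaleR_fock :: "real \<Rightarrow> 'a fock \<Rightarrow> 'a fock" is "\<lambda>r F xs. complex_of_real r * F xs"
  by (rule fock_forms_scale)

instance
  by (intro_classes; transfer) (auto simp: algebra_simps)

end

lemma form_of_summable: "(\<lambda>xs. (cmod (form_of \<Phi> xs))\<^sup>2) summable_on lists onb"
  by (rule fock_formsD(3)[OF form_of])

lemma cinner_summable: "(\<lambda>xs. form_of \<Phi> xs * cnj (form_of \<Psi> xs)) summable_on lists onb"
proof -
  have "(\<lambda>xs. norm (form_of \<Phi> xs * cnj (form_of \<Psi> xs))) summable_on lists onb"
  proof (rule abs_summable_product)
    show "(\<lambda>xs. norm (form_of \<Phi> xs * form_of \<Phi> xs)) summable_on lists onb"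
      using form_of_summable[of \<Phi>] by (simp only: norm_mult power2_eq_square)
    show "(\<lambda>xs. norm (cnj (form_of \<Psi> xs) * cnj (form_of \<Psi> xs))) summable_on lists onb"
      using form_of_summable[of \<Psi>] by (simp only: norm_mult power2_eq_square complex_mod_cnj)
  qed
  then show ?thesis by (rule abs_summable_summable)
qed

lemma cinner_add_left: "cinner (\<Phi> + \<Phi>') \<Psi> = cinner \<Phi> \<Psi> + cinner \<Phi>' \<Psi>"
  unfolding cinner_def by (simp add: plus_fock.rep_eq distrib_right infsum_add cinner_summable)

lemma cinner_cscale_left: "cinner (cscale c \<Phi>) \<Psi> = c * cinner \<Phi> \<Psi>"
  unfolding cinner_def by (simp add: cscale.rep_eq mult.assoc infsum_cmult_right')

lemma cinner_commute: "cinner \<Phi> \<Psi> = cnj (cinner \<Psi> \<Phi>)"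
  unfolding cinner_def by (simp add: mult.commute flip: infsum_cnj)

lemma scaleR_fock_eq: "r *\<^sub>R \<Phi> = cscale (complex_of_real r) \<Phi>"
  by transfer simp

lemma cinner_self: "cinner \<Phi> \<Phi> = complex_of_real (\<Sum>\<^sub>\<infinity>xs\<in>lists onb. (cmod (form_of \<Phi> xs))\<^sup>2)"
proof -
  have "((\<lambda>xs. (cmod (form_of \<Phi> xs))\<^sup>2) has_sum (\<Sum>\<^sub>\<infinity>xs\<in>lists onb. (cmod (form_of \<Phi> xs))\<^sup>2)) (lists onb)"
    by (rule has_sum_infsum[OF form_of_summable])
  from infsumI[OF has_sum_of_real[OF this]] show ?thesis
    unfolding cinner_def complex_norm_square[symmetric] by simp
qed

lemma cinner_self_eq_0: "cinner \<Phi> \<Phi> = 0 \<longleftrightarrow> \<Phi> = 0"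
proof
  assume "cinner \<Phi> \<Phi> = 0"
  then have "(\<Sum>\<^sub>\<infinity>xs\<in>lists onb. (cmod (form_of \<Phi> xs))\<^sup>2) = 0" by (simp add: cinner_self)
  then have "(cmod (form_of \<Phi> xs))\<^sup>2 = 0" if "xs \<in> lists onb" for xs
    by (intro nonneg_infsum_le_0D[OF _ form_of_summable _ that]) auto
  then have "form_of \<Phi> xs = 0" if "xs \<in> lists onb" for xs using that by simp
  then have "form_of \<Phi> xs = 0" for xs using fock_forms_vanish[OF form_of] by blast
  then show "\<Phi> = 0" by transfer auto
qed (simp add: cinner_def zero_fock.rep_eq)

instantiation fock :: ("{real_inner, complete_space}") real_inner
begin

definition inner_fock :: "'a fock \<Rightarrow> 'a fock \<Rightarrow> real" where "inner_fock \<Phi> \<Psi> = Re (cinner \<Phi> \<Psi>)"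
definition norm_fock :: "'a fock \<Rightarrow> real" where "norm_fock \<Phi> = sqrt (inner \<Phi> \<Phi>)"
definition sgn_fock :: "'a fock \<Rightarrow> 'a fock" where "sgn_fock \<Phi> = \<Phi> /\<^sub>R norm \<Phi>"
definition dist_fock :: "'a fock \<Rightarrow> 'a fock \<Rightarrow> real" where "dist_fock \<Phi> \<Psi> = norm (\<Phi> - \<Psi>)"
definition uniformity_fock :: "('a fock \<times> 'a fock) filter" where
  "uniformity_fock = (INF e\<in>{0<..}. principal {(x, y). dist x y < e})"
definition open_fock :: "'a fock set \<Rightarrow> bool" where
  "open_fock S \<longleftrightarrow> (\<forall>x\<in>S. \<forall>\<^sub>F (x', y) in uniformity. x' = x \<longrightarrow> y \<in> S)"

instance
proof
  fix r :: real and \<Phi> \<Psi> \<Psi>' :: "'a fock"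
  show "inner \<Phi> \<Psi> = inner \<Psi> \<Phi>" unfolding inner_fock_def by (subst cinner_commute) simp
  show "inner (\<Phi> + \<Psi>) \<Psi>' = inner \<Phi> \<Psi>' + inner \<Psi> \<Psi>'" by (simp add: inner_fock_def cinner_add_left)
  show "inner (r *\<^sub>R \<Phi>) \<Psi> = r * inner \<Phi> \<Psi>" by (simp add: inner_fock_def scaleR_fock_eq cinner_cscale_left)
  show "0 \<le> inner \<Phi> \<Phi>" by (simp add: inner_fock_def cinner_self infsum_nonneg)
  have "cinner \<Phi> \<Phi> = complex_of_real (inner \<Phi> \<Phi>)" by (simp add: inner_fock_def cinner_self)
  then show "inner \<Phi> \<Phi> = 0 \<longleftrightarrow> \<Phi> = 0" using cinner_self_eq_0[of \<Phi>] by simp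
qed (simp_all add: norm_fock_def sgn_fock_def dist_fock_def uniformity_fock_def open_fock_def)

end


section \<open>Adjoints, Parseval's identity and the functor \<open>\<F>\<close>\<close>

lemma riesz_representation:
  fixes f :: "'a::{real_inner, complete_space} \<Rightarrow> real"
  assumes "bounded_linear f"
  obtains v where "\<And>x. f x = inner v x"
proof -
  interpret f: bounded_linear f by fact
  define C where "C = {x. f x = 0}"
  have C: "subspace C" by (auto simp: C_def subspace_def f.add f.scaleR f.zero)
  have cl: "closed C" unfolding C_def by (intro closed_Collect_eq continuous_intros f.continuous_on)
  show ?thesis
  proof (cases "C = UNIV")
    case True
    then have "f x = inner 0 x" for x by (auto simp: C_def)
    then show ?thesis by (rule that)
  next
    case False
    from closed_subspace_orthogonal_exists[OF C cl False]
    obtain z where z: "z \<noteq> 0" "\<And>c. c \<in> C \<Longrightarrow> orthogonal z c" by blast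
    have "f x = inner ((f z / (norm z)\<^sup>2) *\<^sub>R z) x" for x
    proof -
      have "f z *\<^sub>R x - f x *\<^sub>R z \<in> C" by (simp add: C_def f.diff f.scaleR)
      then have "inner z (f z *\<^sub>R x - f x *\<^sub>R z) = 0" using z(2) by (simp add: orthogonal_def)
      then have "f z * inner z x = f x * (norm z)\<^sup>2" by (simp add: inner_diff_right power2_norm_eq_inner)
      then show ?thesis using z(1) by (simp add: field_simps)
    qed
    then show ?thesis by (rule that)
  qed
qed

lemma inner_adjoint:
  fixes A :: "'a::{real_inner, complete_space} \<Rightarrow> 'b::real_inner"
  assumes "bounded_linear A"
  shows "inner (A x) y = inner x (adjoint A y)"
proof -
  have "\<exists>w. \<forall>x. inner (A x) y = inner x w" for y
  proof -
    have "bounded_linear (\<lambda>x. inner (A x) y)"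
      by (rule bounded_linear_compose[OF bounded_linear_inner_left assms])
    then obtain v where "\<And>x. inner (A x) y = inner v x" using riesz_representation by blast
    then show ?thesis by (metis inner_commute)
  qed
  then have "\<exists>A'. \<forall>x y. inner (A x) y = inner x (A' y)" by metis
  then show ?thesis unfolding adjoint_def by (rule someI2_ex) simp
qed

lemma bounded_linear_adjoint:
  fixes A :: "'a::{real_inner, complete_space} \<Rightarrow> 'b::real_inner"
  assumes "bounded_linear A"
  shows "bounded_linear (adjoint A)"
proof -
  note adj = inner_adjoint[OF assms]
  obtain K where K: "0 \<le> K" "\<And>x. norm (A x) \<le> norm x * K"
    using bounded_linear.nonneg_bounded[OF assms] by blast
  show ?thesis
  proof (rule bounded_linear_intro)
    show "adjoint A (x + y) = adjoint A x + adjoint A y" for x y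
      by (rule vector_eq_ldot[THEN iffD1]) (simp add: inner_add_right flip: adj)
    show "adjoint A (r *\<^sub>R x) = r *\<^sub>R adjoint A x" for r x
      by (rule vector_eq_ldot[THEN iffD1]) (simp flip: adj)
    show "norm (adjoint A y) \<le> norm y * K" for y
    proof -
      have "(norm (adjoint A y))\<^sup>2 = inner (A (adjoint A y)) y" by (simp add: adj power2_norm_eq_inner)
      also have "\<dots> \<le> norm (A (adjoint A y)) * norm y" by (rule norm_cauchy_schwarz)
      also have "\<dots> \<le> norm (adjoint A y) * K * norm y" using K by (intro mult_right_mono) auto
      finally have "norm (adjoint A y) * norm (adjoint A y) \<le> norm (adjoint A y) * (norm y * K)"
        by (simp add: power2_eq_square mult_ac)
      then show ?thesis using K(1) by (cases "norm (adjoint A y) = 0") (auto simp: mult_le_cancel_left)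
    qed
  qed
qed

lemma orthonormal_sum_diff:
  fixes v :: "'a::real_inner"
  assumes "finite F" "pairwise orthogonal F" "\<And>b. b \<in> F \<Longrightarrow> norm b = 1"
  shows "(norm (v - (\<Sum>b\<in>F. c b *\<^sub>R b)))\<^sup>2 =
    (norm v)\<^sup>2 - (\<Sum>b\<in>F. (inner v b)\<^sup>2) + (\<Sum>b\<in>F. (inner v b - c b)\<^sup>2)"
proof -
  have d: "inner b b' = (if b = b' then 1 else 0)" if "b \<in> F" "b' \<in> F" for b b'
    using that assms(2,3) by (auto simp: pairwise_def orthogonal_def norm_eq_1)
  have s: "inner (\<Sum>b\<in>F. c b *\<^sub>R b) (\<Sum>b\<in>F. c b *\<^sub>R b) = (\<Sum>b\<in>F. (c b)\<^sup>2)"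
  proof -
    have "inner (\<Sum>b\<in>F. c b *\<^sub>R b) (\<Sum>b\<in>F. c b *\<^sub>R b) = (\<Sum>b\<in>F. \<Sum>b'\<in>F. c b * (c b' * inner b b'))"
      by (simp add: inner_sum_left inner_sum_right sum_distrib_left inner_commute mult.left_commute)
    also have "\<dots> = (\<Sum>b\<in>F. \<Sum>b'\<in>F. if b = b' then c b * c b' else 0)"
      by (intro sum.cong refl) (simp add: d)
    also have "\<dots> = (\<Sum>b\<in>F. (c b)\<^sup>2)" using assms(1) by (simp add: power2_eq_square)
    finally show ?thesis .
  qed
  have i: "inner v (\<Sum>b\<in>F. c b *\<^sub>R b) = (\<Sum>b\<in>F. c b * inner v b)"
    by (simp add: inner_sum_right)
  have "(norm (v - (\<Sum>b\<in>F. c b *\<^sub>R b)))\<^sup>2 = (norm v)\<^sup>2 - 2 * (\<Sum>b\<in>F. c b * inner v b) + (\<Sum>b\<in>F. (c b)\<^sup>2)"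
    unfolding power2_norm_eq_inner s[symmetric] i[symmetric]
    by (simp only: inner_diff_left inner_diff_right inner_commute[of "sum _ _" v])
  moreover have "(\<Sum>b\<in>F. (inner v b - c b)\<^sup>2) =
      (\<Sum>b\<in>F. (inner v b)\<^sup>2) - 2 * (\<Sum>b\<in>F. c b * inner v b) + (\<Sum>b\<in>F. (c b)\<^sup>2)"
    by (simp add: power2_diff sum.distrib sum_subtractf sum_distrib_left mult_ac)
  ultimately show ?thesis by simp
qed

lemma parseval:
  fixes v :: "'a::{real_inner, complete_space}"
  shows "((\<lambda>b. (inner v b)\<^sup>2) has_sum (norm v)\<^sup>2) onb"
proof -
  have B: "norm b = 1" if "b \<in> onb" for b :: 'a
    using orthonormal_basis_onb[where 'a='a] that by (simp add: orthonormal_basis_def)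
  have po: "pairwise orthogonal F" if "F \<subseteq> onb" for F :: "'a set"
    using orthonormal_basis_onb[where 'a='a] that by (auto simp: orthonormal_basis_def intro: pairwise_subset)
  have bessel: "(\<Sum>b\<in>F. (inner v b)\<^sup>2) \<le> (norm v)\<^sup>2" if "finite F" "F \<subseteq> onb" for F
  proof -
    have "0 \<le> (norm (v - (\<Sum>b\<in>F. inner v b *\<^sub>R b)))\<^sup>2" by simp
    also have "\<dots> = (norm v)\<^sup>2 - (\<Sum>b\<in>F. (inner v b)\<^sup>2)"
      using orthonormal_sum_diff[OF that(1) po[OF that(2)], of v "inner v"] B that(2) by force
    finally show ?thesis by simp
  qed
  have bdd: "bdd_above (sum (\<lambda>b. (inner v b)\<^sup>2) ` {F. F \<subseteq> onb \<and> finite F})"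
    using bessel by (intro bdd_aboveI2[where M = "(norm v)\<^sup>2"]) auto
  have summ: "(\<lambda>b. (inner v b)\<^sup>2) summable_on onb"
    by (rule nonneg_bdd_above_summable_on) (use bdd in auto)
  have le: "(\<Sum>\<^sub>\<infinity>b\<in>onb. (inner v b)\<^sup>2) \<le> (norm v)\<^sup>2"
    by (rule infsum_le_finite_sums[OF summ]) (use bessel in auto)
  have ge: "(norm v)\<^sup>2 \<le> (\<Sum>\<^sub>\<infinity>b\<in>onb. (inner v b)\<^sup>2)"
  proof (rule field_le_epsilon)
    fix e :: real assume e: "e > 0"
    have "v \<in> closure (span onb)"
      using orthonormal_basis_onb[where 'a='a] by (simp add: orthonormal_basis_def)
    then obtain w where w: "w \<in> span onb" "dist w v < sqrt e"
      using e unfolding closure_approachable by (meson real_sqrt_gt_zero)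
    from w(1) obtain F c where F: "finite F" "F \<subseteq> onb" "w = (\<Sum>b\<in>F. c b *\<^sub>R b)"
      unfolding span_explicit by blast
    have "(norm (v - w))\<^sup>2 \<le> (sqrt e)\<^sup>2"
      using w(2) by (intro power_mono) (auto simp: dist_norm norm_minus_commute)
    then have n: "(norm (v - w))\<^sup>2 \<le> e" using e by simp
    have "(norm v)\<^sup>2 - (\<Sum>b\<in>F. (inner v b)\<^sup>2) \<le> (norm (v - w))\<^sup>2"
      unfolding F(3) using orthonormal_sum_diff[OF F(1) po[OF F(2)], of v c] B F(2)
      by (auto simp: sum_nonneg subset_iff)
    also note n
    finally have "(norm v)\<^sup>2 \<le> (\<Sum>b\<in>F. (inner v b)\<^sup>2) + e" by simp
    also have "(\<Sum>b\<in>F. (inner v b)\<^sup>2) \<le> (\<Sum>\<^sub>\<infinity>b\<in>onb. (inner v b)\<^sup>2)"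
      by (rule finite_sum_le_infsum[OF summ F(1,2)]) simp
    finally show "(norm v)\<^sup>2 \<le> (\<Sum>\<^sub>\<infinity>b\<in>onb. (inner v b)\<^sup>2) + e" by simp
  qed
  show ?thesis using has_sum_infsum[OF summ] le ge by simp
qed

lemma nn_integral_count_space_has_sum:
  assumes "(f has_sum s) A" "\<And>x. x \<in> A \<Longrightarrow> f x \<ge> (0::real)"
  shows "(\<integral>\<^sup>+x. ennreal (f x) \<partial>count_space A) = ennreal s"
proof -
  have s: "f summable_on A" "infsum f A = s" using assms(1) by (auto simp: has_sum_iff)
  then have "(\<lambda>x. norm (f x)) summable_on A" using summable_on_iff_abs_summable_on_real[of f A] by simp
  then have a: "Infinite_Set_Sum.abs_summable_on f A" by (simp only: abs_summable_equivalent)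
  have "(\<integral>\<^sup>+x. ennreal (f x) \<partial>count_space A) = ennreal (infsetsum f A)"
    by (rule nn_integral_conv_infsetsum[OF a assms(2)])
  then show ?thesis by (simp add: infsetsum_infsum[OF a] s)
qed

lemma summable_on_iff_nn_integral:
  fixes f :: "'a \<Rightarrow> real"
  assumes "\<And>x. f x \<ge> 0"
  shows "f summable_on A \<longleftrightarrow> (\<integral>\<^sup>+x. ennreal (f x) \<partial>count_space A) < \<infinity>"
proof
  assume "f summable_on A"
  then show "(\<integral>\<^sup>+x. ennreal (f x) \<partial>count_space A) < \<infinity>"
    using nn_integral_count_space_has_sum[OF has_sum_infsum] assms by fastforce
next
  assume "(\<integral>\<^sup>+x. ennreal (f x) \<partial>count_space A) < \<infinity>"
  then have "integrable (count_space A) f" using assms by (intro integrableI_nonneg) auto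
  then have "Infinite_Set_Sum.abs_summable_on f A" by (simp add: Infinite_Set_Sum.abs_summable_on_def)
  then have "(\<lambda>x. norm (f x)) summable_on A" by (simp only: abs_summable_equivalent)
  then show "f summable_on A" by (rule abs_summable_summable)
qed

text \<open>The squared Hilbert-Schmidt norm of the \<open>n\<close>-th component.\<close>

definition sq_sum :: "nat \<Rightarrow> ('a::{real_inner, complete_space} list \<Rightarrow> complex) \<Rightarrow> ennreal" where
  "sq_sum n F = (\<integral>\<^sup>+xs. ennreal ((cmod (F xs))\<^sup>2) * indicator {xs \<in> lists onb. length xs = n} xs \<partial>count_space UNIV)"

lemma sq_sum_0:
  fixes F :: "'a::{real_inner, complete_space} list \<Rightarrow> complex"
  shows "sq_sum 0 F = ennreal ((cmod (F []))\<^sup>2)"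
proof -
  have "sq_sum 0 F = (\<integral>\<^sup>+xs. ennreal ((cmod (F []))\<^sup>2) * indicator {[]} xs \<partial>count_space (UNIV :: 'a list set))"
    unfolding sq_sum_def by (intro nn_integral_cong) (auto split: split_indicator)
  then show ?thesis by (simp add: nn_integral_cmult_indicator)
qed

lemma sq_sum_Suc:
  fixes F :: "'a::{real_inner, complete_space} list \<Rightarrow> complex"
  shows "sq_sum (Suc n) F = (\<integral>\<^sup>+b. sq_sum n (\<lambda>xs. F (b # xs)) \<partial>count_space onb)"
  "sq_sum (Suc n) F = (\<integral>\<^sup>+xs. (\<integral>\<^sup>+b. ennreal ((cmod (F (b # xs)))\<^sup>2) \<partial>count_space onb)
     * indicator {xs \<in> lists onb. length xs = n} xs \<partial>count_space UNIV)"
proof -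
  let ?S = "\<lambda>n. {xs \<in> lists (onb :: 'a set). length xs = n}"
  let ?h = "\<lambda>p. ennreal ((cmod (F (fst p # snd p)))\<^sup>2) * indicator onb (fst p) * indicator (?S n) (snd p)"
  have "sq_sum (Suc n) F = (\<integral>\<^sup>+xs. ennreal ((cmod (F xs))\<^sup>2) * indicator (?S (Suc n)) xs \<partial>count_space {xs. xs \<noteq> []})"
    unfolding sq_sum_def
    by (rule nn_integral_count_space_eq) (auto split: split_indicator)
  also have "\<dots> = (\<integral>\<^sup>+p. ennreal ((cmod (F (case p of (b, xs) \<Rightarrow> b # xs)))\<^sup>2) *
      indicator (?S (Suc n)) (case p of (b, xs) \<Rightarrow> b # xs) \<partial>count_space UNIV)"
    by (rule nn_integral_bij_count_space[symmetric])
      (auto simp: bij_betw_def inj_on_def image_def neq_Nil_conv)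
  also have "\<dots> = (\<integral>\<^sup>+p. ?h p \<partial>count_space UNIV)"
    by (intro nn_integral_cong) (auto split: split_indicator)
  finally have eq: "sq_sum (Suc n) F = (\<integral>\<^sup>+p. ?h p \<partial>count_space UNIV)" .
  have "sq_sum (Suc n) F = (\<integral>\<^sup>+b. \<integral>\<^sup>+xs. ?h (b, xs) \<partial>count_space UNIV \<partial>count_space UNIV)"
    unfolding eq by (rule nn_integral_fst_count_space[symmetric])
  also have "\<dots> = (\<integral>\<^sup>+b. sq_sum n (\<lambda>xs. F (b # xs)) * indicator onb b \<partial>count_space UNIV)"
    unfolding sq_sum_def by (intro nn_integral_cong) (auto split: split_indicator)
  also have "\<dots> = (\<integral>\<^sup>+b. sq_sum n (\<lambda>xs. F (b # xs)) \<partial>count_space onb)"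
    by (simp add: nn_integral_count_space_indicator)
  finally show "sq_sum (Suc n) F = (\<integral>\<^sup>+b. sq_sum n (\<lambda>xs. F (b # xs)) \<partial>count_space onb)" .
  have "sq_sum (Suc n) F = (\<integral>\<^sup>+xs. \<integral>\<^sup>+b. ?h (b, xs) \<partial>count_space UNIV \<partial>count_space UNIV)"
    unfolding eq by (rule nn_integral_snd_count_space[symmetric])
  also have "\<dots> = (\<integral>\<^sup>+xs. (\<integral>\<^sup>+b. ennreal ((cmod (F (b # xs)))\<^sup>2) \<partial>count_space onb) * indicator (?S n) xs \<partial>count_space UNIV)"
    by (intro nn_integral_cong) (auto simp: nn_integral_count_space_indicator split: split_indicator)
  finally show "sq_sum (Suc n) F = (\<integral>\<^sup>+xs. (\<integral>\<^sup>+b. ennreal ((cmod (F (b # xs)))\<^sup>2) \<partial>count_space onb)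
     * indicator (?S n) xs \<partial>count_space UNIV)" .
qed

lemma nn_integral_lists_onb:
  fixes F :: "'a::{real_inner, complete_space} list \<Rightarrow> complex"
  shows "(\<integral>\<^sup>+xs. ennreal ((cmod (F xs))\<^sup>2) \<partial>count_space (lists onb)) = (\<Sum>n. sq_sum n F)"
proof -
  let ?S = "\<lambda>n. {xs \<in> lists (onb :: 'a set). length xs = n}"
  have *: "(\<Sum>n. ennreal ((cmod (F xs))\<^sup>2) * indicator (?S n) xs)
      = ennreal ((cmod (F xs))\<^sup>2) * indicator (lists onb) xs" for xs
  proof -
    have "(\<Sum>n. ennreal ((cmod (F xs))\<^sup>2) * indicator (?S n) xs) =
       (\<Sum>n\<in>{length xs}. ennreal ((cmod (F xs))\<^sup>2) * indicator (?S n) xs)"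
      by (rule suminf_finite) (auto simp: indicator_def)
    then show ?thesis by (auto simp: indicator_def)
  qed
  have "(\<Sum>n. sq_sum n F) = (\<integral>\<^sup>+xs. (\<Sum>n. ennreal ((cmod (F xs))\<^sup>2) * indicator (?S n) xs) \<partial>count_space UNIV)"
    unfolding sq_sum_def by (rule nn_integral_suminf[symmetric]) simp
  then show ?thesis by (simp only: *) (simp add: nn_integral_count_space_indicator)
qed

lemma parseval_complex:
  fixes g :: "'a::{real_inner, complete_space} \<Rightarrow> complex"
  assumes "bounded_linear g" "bounded_linear A" "\<And>x. norm (A x) \<le> norm x"
  shows "(\<integral>\<^sup>+y. ennreal ((cmod (g (adjoint A y)))\<^sup>2) \<partial>count_space (onb :: 'b::{real_inner, complete_space} set))
    \<le> (\<integral>\<^sup>+x. ennreal ((cmod (g x))\<^sup>2) \<partial>count_space onb)"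
proof -
  obtain v where v: "\<And>x. Re (g x) = inner v x"
    using riesz_representation[OF bounded_linear_compose[OF bounded_linear_Re assms(1)]] by blast
  obtain w where w: "\<And>x. Im (g x) = inner w x"
    using riesz_representation[OF bounded_linear_compose[OF bounded_linear_Im assms(1)]] by blast
  have "((\<lambda>x. (cmod (g x))\<^sup>2) has_sum ((norm v)\<^sup>2 + (norm w)\<^sup>2)) onb"
    unfolding cmod_power2 v w by (intro has_sum_add parseval)
  then have r: "(\<integral>\<^sup>+x. ennreal ((cmod (g x))\<^sup>2) \<partial>count_space onb) = ennreal ((norm v)\<^sup>2 + (norm w)\<^sup>2)"
    by (rule nn_integral_count_space_has_sum) simp
  have "((\<lambda>y. (cmod (g (adjoint A y)))\<^sup>2) has_sum ((norm (A v))\<^sup>2 + (norm (A w))\<^sup>2)) onb"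
    unfolding cmod_power2 v w inner_adjoint[OF assms(2), symmetric] by (intro has_sum_add parseval)
  then have l: "(\<integral>\<^sup>+y. ennreal ((cmod (g (adjoint A y)))\<^sup>2) \<partial>count_space onb)
      = ennreal ((norm (A v))\<^sup>2 + (norm (A w))\<^sup>2)"
    by (rule nn_integral_count_space_has_sum) simp
  show ?thesis unfolding l r by (intro ennreal_leI add_mono power_mono assms(3)) auto
qed

lemma sq_sum_map_adjoint:
  fixes A :: "'a::{real_inner, complete_space} \<Rightarrow> 'b::{real_inner, complete_space}"
  assumes A: "bounded_linear A" "\<And>x. norm (A x) \<le> norm x"
    and F: "\<And>xs ys. length xs + length ys < n \<Longrightarrow> bounded_linear (\<lambda>x. F (xs @ x # ys))"
  shows "sq_sum n (\<lambda>ys. F (map (adjoint A) ys)) \<le> sq_sum n F"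
  using F
proof (induction n arbitrary: F)
  case (Suc n)
  have "sq_sum (Suc n) (\<lambda>ys. F (map (adjoint A) ys))
     = (\<integral>\<^sup>+b. sq_sum n (\<lambda>ys. F (adjoint A b # map (adjoint A) ys)) \<partial>count_space onb)"
    by (simp add: sq_sum_Suc(1))
  also have "\<dots> \<le> (\<integral>\<^sup>+b. sq_sum n (\<lambda>xs. F (adjoint A b # xs)) \<partial>count_space onb)"
  proof (rule nn_integral_mono)
    fix b :: 'b
    show "sq_sum n (\<lambda>ys. F (adjoint A b # map (adjoint A) ys)) \<le> sq_sum n (\<lambda>xs. F (adjoint A b # xs))"
      using Suc.prems[of "adjoint A b # _"] by (intro Suc.IH[of "\<lambda>xs. F (adjoint A b # xs)"]) simp
  qed
  also have "\<dots> = (\<integral>\<^sup>+b. \<integral>\<^sup>+xs. ennreal ((cmod (F (adjoint A b # xs)))\<^sup>2) * indicator {xs \<in> lists onb. length xs = n} xs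
      * indicator onb b \<partial>count_space UNIV \<partial>count_space UNIV)"
    unfolding sq_sum_def
    by (subst nn_integral_count_space_indicator) (auto intro!: nn_integral_cong split: split_indicator)
  also have "\<dots> = (\<integral>\<^sup>+xs. \<integral>\<^sup>+b. ennreal ((cmod (F (adjoint A b # xs)))\<^sup>2) * indicator {xs \<in> lists onb. length xs = n} xs
      * indicator onb b \<partial>count_space UNIV \<partial>count_space UNIV)"
    using nn_integral_fst_count_space[of "\<lambda>(b, xs). ennreal ((cmod (F (adjoint A b # xs)))\<^sup>2) *
        indicator {xs \<in> lists onb. length xs = n} xs * indicator onb b"]
      nn_integral_snd_count_space[of "\<lambda>(b, xs). ennreal ((cmod (F (adjoint A b # xs)))\<^sup>2) *
        indicator {xs \<in> lists onb. length xs = n} xs * indicator onb b"]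
    by (simp only: prod.case)
  also have "\<dots> = (\<integral>\<^sup>+xs. (\<integral>\<^sup>+b. ennreal ((cmod (F (adjoint A b # xs)))\<^sup>2) \<partial>count_space onb)
      * indicator {xs \<in> lists onb. length xs = n} xs \<partial>count_space UNIV)"
    by (intro nn_integral_cong) (auto simp: nn_integral_count_space_indicator split: split_indicator)
  also have "\<dots> \<le> (\<integral>\<^sup>+xs. (\<integral>\<^sup>+b. ennreal ((cmod (F (b # xs)))\<^sup>2) \<partial>count_space onb)
      * indicator {xs \<in> lists onb. length xs = n} xs \<partial>count_space UNIV)"
  proof (rule nn_integral_mono)
    fix xs :: "'a list"
    show "(\<integral>\<^sup>+b. ennreal ((cmod (F (adjoint A b # xs)))\<^sup>2) \<partial>count_space onb) * indicator {xs \<in> lists onb. length xs = n} xs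
      \<le> (\<integral>\<^sup>+b. ennreal ((cmod (F (b # xs)))\<^sup>2) \<partial>count_space onb) * indicator {xs \<in> lists onb. length xs = n} xs"
    proof (cases "length xs = n")
      case True
      then have "bounded_linear (\<lambda>x. F (x # xs))" using Suc.prems[of "[]" xs] by simp
      from parseval_complex[OF this A] show ?thesis by (rule mult_right_mono) simp
    qed simp
  qed
  also have "\<dots> = sq_sum (Suc n) F" by (simp only: sq_sum_Suc(2))
  finally show ?case .
qed (simp add: sq_sum_0)

lemma fock_forms_map_adjoint:
  fixes A :: "'a::{real_inner, complete_space} \<Rightarrow> 'b::{real_inner, complete_space}"
  assumes A: "bounded_linear A" "\<And>x. norm (A x) \<le> norm x" and F: "F \<in> fock_forms"
  shows "(\<lambda>ys. F (map (adjoint A) ys)) \<in> fock_forms"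
proof (rule fock_formsI)
  show "F (map (adjoint A) xs) = F (map (adjoint A) ys)" if "mset xs = mset ys" for xs ys
    by (rule fock_formsD(1)[OF F]) (simp add: that)
  show "bounded_linear (\<lambda>y. F (map (adjoint A) (y # ys)))" for ys
    using bounded_linear_compose[OF fock_formsD(2)[OF F] bounded_linear_adjoint[OF A(1)]] by simp
  have "bounded_linear (\<lambda>x. F (xs @ x # ys))" for xs ys
  proof -
    have "F (xs @ x # ys) = F (x # xs @ ys)" for x by (rule fock_formsD(1)[OF F]) simp
    then show ?thesis using fock_formsD(2)[OF F, of "xs @ ys"] by presburger
  qed
  then have "sq_sum n (\<lambda>ys. F (map (adjoint A) ys)) \<le> sq_sum n F" for n
    by (intro sq_sum_map_adjoint[OF A])
  then have "(\<integral>\<^sup>+ys. ennreal ((cmod (F (map (adjoint A) ys)))\<^sup>2) \<partial>count_space (lists onb))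
     \<le> (\<integral>\<^sup>+xs. ennreal ((cmod (F xs))\<^sup>2) \<partial>count_space (lists onb))"
    unfolding nn_integral_lists_onb[of F] nn_integral_lists_onb[of "\<lambda>ys. F (map (adjoint A) ys)"]
    by (intro suminf_le) auto
  also have "\<dots> < \<infinity>" using fock_formsD(3)[OF F] by (subst (asm) summable_on_iff_nn_integral) auto
  finally show "(\<lambda>ys. (cmod (F (map (adjoint A) ys)))\<^sup>2) summable_on lists onb"
    by (subst summable_on_iff_nn_integral) auto
qed

definition tensor_form :: "'a::{real_inner, complete_space} list \<Rightarrow> 'a list \<Rightarrow> complex" where
  "tensor_form xs ys = (if length ys = length xs
     then (\<Sum>\<sigma> | \<sigma> permutes {..<length xs}. \<Prod>i<length xs. complex_of_real (inner (xs ! \<sigma> i) (ys ! i)))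
            / fact (length xs)
     else 0)"

lemma prod_inner_nn_integral:
  fixes u :: "nat \<Rightarrow> 'a::{real_inner, complete_space}"
  shows "sq_sum n (\<lambda>ys. \<Prod>i<n. complex_of_real (inner (u i) (ys ! i))) = ennreal ((\<Prod>i<n. norm (u i))\<^sup>2)"
proof (induction n arbitrary: u)
  case (Suc n)
  let ?P = "\<Prod>i<n. norm (u (Suc i))"
  have "sq_sum n (\<lambda>ys. \<Prod>i<Suc n. complex_of_real (inner (u i) ((b # ys) ! i)))
     = ennreal ((inner (u 0) b)\<^sup>2) * ennreal (?P\<^sup>2)" for b
    using Suc.IH[of "\<lambda>i. u (Suc i)"]
    by (simp add: sq_sum_def prod.lessThan_Suc_shift norm_mult power_mult_distrib ennreal_mult mult.assoc
        nn_integral_cmult del: prod.lessThan_Suc)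
  then have "sq_sum (Suc n) (\<lambda>ys. \<Prod>i<Suc n. complex_of_real (inner (u i) (ys ! i)))
     = (\<integral>\<^sup>+b. ennreal ((inner (u 0) b)\<^sup>2) \<partial>count_space onb) * ennreal (?P\<^sup>2)"
    unfolding sq_sum_Suc(1) by (simp add: nn_integral_multc)
  also have "(\<integral>\<^sup>+b. ennreal ((inner (u 0) b)\<^sup>2) \<partial>count_space onb) = ennreal ((norm (u 0))\<^sup>2)"
    by (rule nn_integral_count_space_has_sum[OF parseval]) simp
  finally show ?case
    by (simp add: prod.lessThan_Suc_shift power_mult_distrib ennreal_mult del: prod.lessThan_Suc)
qed (simp add: sq_sum_0)

lemma tensor_form_fock: "tensor_form xs \<in> fock_forms"
proof (rule fock_formsI)
  let ?n = "length xs" and ?P = "{\<sigma>. \<sigma> permutes {..<length xs}}"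
  have finP: "finite ?P" by (simp add: finite_permutations)
  show "tensor_form xs ys = tensor_form xs zs" if m: "mset ys = mset zs" for ys zs
  proof (cases "length ys = ?n")
    case True
    have lz: "length zs = ?n" using True m by (metis size_mset)
    from mset_eq_permutation[OF m] obtain q where q: "q permutes {..<?n}" "permute_list q zs = ys"
      using lz by metis
    let ?t = "\<lambda>w \<sigma>. \<Prod>i<?n. complex_of_real (inner (xs ! \<sigma> i) (w ! i))"
    have "?t ys (\<sigma> \<circ> q) = ?t zs \<sigma>" for \<sigma>
    proof -
      have "?t ys (\<sigma> \<circ> q) = (\<Prod>i<?n. complex_of_real (inner (xs ! \<sigma> (q i)) (zs ! q i)))"
        using q lz by (intro prod.cong refl) (auto simp: permute_list_nth simp flip: q(2))
      also have "\<dots> = ?t zs \<sigma>"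
        using prod.permute[OF q(1), of "\<lambda>i. complex_of_real (inner (xs ! \<sigma> i) (zs ! i))"] by (simp add: o_def)
      finally show ?thesis .
    qed
    then have "sum (?t ys) ?P = sum (?t zs) ?P"
      by (subst sum_permutations_compose_right[OF q(1)]) simp
    then show ?thesis using True lz by (simp add: tensor_form_def)
  qed (use m in \<open>auto simp: tensor_form_def dest: mset_eq_length\<close>)
  show "bounded_linear (\<lambda>y. tensor_form xs (y # ys))" for ys
  proof (cases "length xs = Suc (length ys)")
    case True
    let ?c = "\<lambda>\<sigma>. (\<Prod>i<length ys. complex_of_real (inner (xs ! \<sigma> (Suc i)) (ys ! i)))"
    have "tensor_form xs (y # ys) =
       (\<Sum>\<sigma>\<in>?P. complex_of_real (inner (xs ! \<sigma> 0) y) * ?c \<sigma>) * (1 / fact (length xs))" for y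
      using True by (simp add: tensor_form_def prod.lessThan_Suc_shift del: prod.lessThan_Suc fact_Suc)
    moreover have "bounded_linear (\<lambda>y. (\<Sum>\<sigma>\<in>?P. complex_of_real (inner (xs ! \<sigma> 0) y) * ?c \<sigma>) * (1 / fact (length xs)))"
      by (intro bounded_linear_mult_const bounded_linear_sum
          bounded_linear_compose[OF bounded_linear_of_real bounded_linear_inner_right])
    ultimately show ?thesis by presburger
  qed (simp add: tensor_form_def)
  show "(\<lambda>ys. (cmod (tensor_form xs ys))\<^sup>2) summable_on lists onb"
  proof -
    let ?g = "\<lambda>\<sigma> ys. \<Prod>i<?n. complex_of_real (inner (xs ! \<sigma> i) (ys ! i))"
    let ?I = "\<lambda>ys. indicator {ys \<in> lists (onb :: 'a set). length ys = ?n} ys :: ennreal"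
    have bound: "ennreal ((cmod (tensor_form xs ys))\<^sup>2) * ?I ys
        \<le> (\<Sum>\<sigma>\<in>?P. ennreal (card ?P) * (ennreal ((cmod (?g \<sigma> ys))\<^sup>2) * ?I ys))" for ys
    proof (cases "length ys = ?n")
      case True
      have "cmod (tensor_form xs ys) \<le> cmod (\<Sum>\<sigma>\<in>?P. ?g \<sigma> ys)"
        using True by (simp add: tensor_form_def norm_divide divide_le_eq mult_left_le_one_le
            mult_right_le_one_le fact_ge_1 mult_le_cancel_left1)
      also have "\<dots> \<le> (\<Sum>\<sigma>\<in>?P. cmod (?g \<sigma> ys))" by (rule norm_sum)
      finally have "(cmod (tensor_form xs ys))\<^sup>2 \<le> (\<Sum>\<sigma>\<in>?P. cmod (?g \<sigma> ys))\<^sup>2" by (rule power_mono) simp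
      also have "\<dots> \<le> card ?P * (\<Sum>\<sigma>\<in>?P. (cmod (?g \<sigma> ys))\<^sup>2)"
        using sum_squared_le_sum_of_squares[of "\<lambda>\<sigma>. cmod (?g \<sigma> ys)"] by (simp add: mult.commute)
      finally have "ennreal ((cmod (tensor_form xs ys))\<^sup>2) \<le> ennreal (card ?P * (\<Sum>\<sigma>\<in>?P. (cmod (?g \<sigma> ys))\<^sup>2))"
        by (rule ennreal_leI)
      also have "\<dots> = (\<Sum>\<sigma>\<in>?P. ennreal (card ?P) * ennreal ((cmod (?g \<sigma> ys))\<^sup>2))"
        by (simp add: ennreal_mult sum_nonneg sum_distrib_left flip: sum_ennreal)
      finally show ?thesis by (auto split: split_indicator)
    qed simp
    have "sq_sum ?n (tensor_form xs) \<le> (\<Sum>\<sigma>\<in>?P. ennreal (card ?P) * sq_sum ?n (?g \<sigma>))"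
    proof -
      have "sq_sum ?n (tensor_form xs) \<le> (\<integral>\<^sup>+ys. (\<Sum>\<sigma>\<in>?P. ennreal (card ?P) * (ennreal ((cmod (?g \<sigma> ys))\<^sup>2) * ?I ys)) \<partial>count_space UNIV)"
        unfolding sq_sum_def by (rule nn_integral_mono) (rule bound)
      also have "\<dots> = (\<Sum>\<sigma>\<in>?P. ennreal (card ?P) * sq_sum ?n (?g \<sigma>))"
        unfolding sq_sum_def by (subst nn_integral_sum) (simp_all add: nn_integral_cmult)
      finally show ?thesis .
    qed
    also have "\<dots> < \<infinity>" unfolding prod_inner_nn_integral
      using finP by (simp add: ennreal_mult_less_top flip: ennreal_mult)
    finally have fin: "sq_sum ?n (tensor_form xs) < \<infinity>" .
    have "sq_sum n (tensor_form xs) = (if n = ?n then sq_sum ?n (tensor_form xs) else 0)" for n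
    proof (cases "n = ?n")
      case False
      have "sq_sum n (tensor_form xs) = (\<integral>\<^sup>+ys. 0 \<partial>count_space (UNIV :: 'a list set))"
        unfolding sq_sum_def by (rule nn_integral_cong)
          (use False in \<open>auto simp: tensor_form_def split: split_indicator\<close>)
      then show ?thesis using False by simp
    qed simp
    then have "(\<Sum>n. sq_sum n (tensor_form xs)) = (\<Sum>n\<in>{?n}. sq_sum n (tensor_form xs))"
      by (intro suminf_finite) auto
    then show ?thesis using fin by (subst summable_on_iff_nn_integral) (auto simp: nn_integral_lists_onb)
  qed
qed

lift_definition sym_tensor :: "'x::{real_inner, complete_space} list \<Rightarrow> 'x fock" is tensor_form
  by (rule tensor_form_fock)

abbreviation vacuum :: "'x::{real_inner, complete_space} fock" where
  "vacuum \<equiv> sym_tensor []"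

lemma form_of_vacuum: "form_of vacuum xs = (if xs = [] then 1 else 0)"
  by (simp add: sym_tensor.rep_eq tensor_form_def)

text \<open>
  \<open>\<Oplus>\<^sub>n A\<^sup>\<otimes>\<^sup>n\<close>, which on forms is precomposition with the adjoint of \<open>A\<close>. It is everywhere defined on
  the Fock space only for contractions; it is used below for embeddings and isometries.
\<close>

lift_definition fock_map ::
  "('x::{real_inner, complete_space} \<Rightarrow> 'y::{real_inner, complete_space}) \<Rightarrow> 'x fock \<Rightarrow> 'y fock" is
  "\<lambda>A F. if bounded_linear A \<and> (\<forall>x. norm (A x) \<le> norm x) then (\<lambda>ys. F (map (adjoint A) ys)) else (\<lambda>ys. 0)"
  by (auto intro: fock_forms_map_adjoint fock_forms_zero)

lift_definition fock_comp :: "nat \<Rightarrow> 'x::{real_inner, complete_space} fock \<Rightarrow> 'x fock" is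
  "\<lambda>n F xs. if length xs = n then F xs else 0"
proof (rule fock_formsI)
  fix n and F :: "'x list \<Rightarrow> complex" assume F: "F \<in> fock_forms"
  show "(if length xs = n then F xs else 0) = (if length ys = n then F ys else 0)" if "mset xs = mset ys" for xs ys
    using mset_eq_length[OF that] fock_formsD(1)[OF F that] by simp
  show "bounded_linear (\<lambda>x. if length (x # xs) = n then F (x # xs) else 0)" for xs
    using fock_formsD(2)[OF F, of xs] by (cases "Suc (length xs) = n") auto
  show "(\<lambda>xs. (cmod (if length xs = n then F xs else 0))\<^sup>2) summable_on lists onb"
    by (rule summable_on_comparison_test[OF fock_formsD(3)[OF F]]) auto
qed

definition fock_level :: "nat \<Rightarrow> 'x::{real_inner, complete_space} fock set" where
  "fock_level n = {\<Phi>. \<forall>xs. length xs \<noteq> n \<longrightarrow> form_of \<Phi> xs = 0}"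

definition fock_upto :: "nat \<Rightarrow> 'x::{real_inner, complete_space} fock set" where
  "fock_upto n = {\<Phi>. \<forall>xs. n < length xs \<longrightarrow> form_of \<Phi> xs = 0}"

definition fock_fin :: "'x::{real_inner, complete_space} fock set" where
  "fock_fin = (\<Union>n. fock_upto n)"

definition fock_real :: "'x::{real_inner, complete_space} fock \<Rightarrow> bool" where
  "fock_real \<Phi> \<longleftrightarrow> (\<forall>xs. form_of \<Phi> xs \<in> \<real>)"

definition clinear_on ::
  "'x::{real_inner, complete_space} fock set \<Rightarrow> ('x fock \<Rightarrow> 'y::{real_inner, complete_space} fock) \<Rightarrow> bool" where
  "clinear_on S A \<longleftrightarrow>
     (\<forall>\<Phi>\<in>S. \<forall>\<Psi>\<in>S. A (\<Phi> + \<Psi>) = A \<Phi> + A \<Psi>) \<and> (\<forall>c. \<forall>\<Phi>\<in>S. A (cscale c \<Phi>) = cscale c (A \<Phi>))"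


section \<open>Unbounded operators\<close>

text \<open>
  An operator between closed subspaces \<open>X\<close>, \<open>Y\<close> of a Fock space is given by its graph, so the closure of
  an operator is the topological \<^const>\<open>closure\<close> of the graph.
\<close>

type_synonym 'x fock_op = "('x fock \<times> 'x fock) set"

definition is_operator ::
  "'x::{real_inner, complete_space} fock set \<Rightarrow> 'x fock set \<Rightarrow> 'x fock_op \<Rightarrow> bool" where
  "is_operator X Y A \<longleftrightarrow> A \<subseteq> X \<times> Y \<and> single_valued A \<and> (0, 0) \<in> A \<and>
     (\<forall>\<Phi> \<Psi> \<Phi>' \<Psi>'. (\<Phi>, \<Psi>) \<in> A \<longrightarrow> (\<Phi>', \<Psi>') \<in> A \<longrightarrow> (\<Phi> + \<Phi>', \<Psi> + \<Psi>') \<in> A) \<and>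
     (\<forall>c \<Phi> \<Psi>. (\<Phi>, \<Psi>) \<in> A \<longrightarrow> (cscale c \<Phi>, cscale c \<Psi>) \<in> A)"

definition op_app :: "'x::{real_inner, complete_space} fock_op \<Rightarrow> 'x fock \<Rightarrow> 'x fock" where
  "op_app A \<Phi> = (THE \<Psi>. (\<Phi>, \<Psi>) \<in> A)"

definition op_adjoint ::
  "'x::{real_inner, complete_space} fock set \<Rightarrow> 'x fock set \<Rightarrow> 'x fock_op \<Rightarrow> 'x fock_op" where
  "op_adjoint X Y A = {(\<Psi>, \<Phi>'). \<Psi> \<in> Y \<and> \<Phi>' \<in> X \<and> (\<forall>(\<Phi>, \<Psi>')\<in>A. cinner \<Psi>' \<Psi> = cinner \<Phi> \<Phi>')}"

definition selfadjoint :: "'x::{real_inner, complete_space} fock_op \<Rightarrow> bool" where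
  "selfadjoint A \<longleftrightarrow> closure (Domain A) = UNIV \<and> op_adjoint UNIV UNIV A = A"

definition projection_valued_measure ::
  "(real set \<Rightarrow> 'x::{real_inner, complete_space} fock \<Rightarrow> 'x fock) \<Rightarrow> bool" where
  "projection_valued_measure E \<longleftrightarrow>
     (\<forall>\<Delta>\<in>sets borel. clinear_on UNIV (E \<Delta>) \<and> E \<Delta> \<circ> E \<Delta> = E \<Delta> \<and>
        (\<forall>\<Phi> \<Psi>. cinner (E \<Delta> \<Phi>) \<Psi> = cinner \<Phi> (E \<Delta> \<Psi>))) \<and>
     E UNIV = id \<and>
     (\<forall>D :: nat \<Rightarrow> real set. range D \<subseteq> sets borel \<longrightarrow> disjoint_family D \<longrightarrow>
        (\<forall>\<Phi>. (\<lambda>n. E (D n) \<Phi>) sums E (\<Union>n. D n) \<Phi>))"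

text \<open>The scalar measure \<open>\<Delta> \<mapsto> \<langle>E(\<Delta>)\<Phi>, \<Phi>\<rangle> = \<parallel>E(\<Delta>)\<Phi>\<parallel>\<^sup>2\<close>.\<close>

definition scalar_measure ::
  "(real set \<Rightarrow> 'x::{real_inner, complete_space} fock \<Rightarrow> 'x fock) \<Rightarrow> 'x fock \<Rightarrow> real measure" where
  "scalar_measure E \<Phi> = measure_of UNIV (sets borel) (\<lambda>\<Delta>. ennreal ((norm (E \<Delta> \<Phi>))\<^sup>2))"

text \<open>
  \<open>A = \<integral> t dE(t)\<close>, with domain \<open>{\<Phi>. \<integral> t\<^sup>2 d\<langle>E(t)\<Phi>, \<Phi>\<rangle> < \<infinity>}\<close>; by polarization the quadratic form
  \<open>\<langle>A\<Phi>, \<Phi>\<rangle> = \<integral> t d\<langle>E(t)\<Phi>, \<Phi>\<rangle>\<close> on this domain determines \<open>A\<close>.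
\<close>

definition operator_spectral_measure ::
  "(real set \<Rightarrow> 'x::{real_inner, complete_space} fock \<Rightarrow> 'x fock) \<Rightarrow> 'x fock_op \<Rightarrow> bool" where
  "operator_spectral_measure E A \<longleftrightarrow> projection_valued_measure E \<and>
     Domain A = {\<Phi>. integrable (scalar_measure E \<Phi>) (\<lambda>t. t\<^sup>2)} \<and>
     (\<forall>(\<Phi>, \<Psi>)\<in>A. cinner \<Psi> \<Phi> = complex_of_real (\<integral>t. t \<partial>scalar_measure E \<Phi>))"

definition strongly_commute ::
  "'x::{real_inner, complete_space} fock_op \<Rightarrow> 'x fock_op \<Rightarrow> bool" where
  "strongly_commute A B \<longleftrightarrow>
     (\<exists>E F. operator_spectral_measure E A \<and> operator_spectral_measure F B \<and>
        (\<forall>\<Delta>\<in>sets borel. \<forall>\<Delta>'\<in>sets borel. E \<Delta> \<circ> F \<Delta>' = F \<Delta>' \<circ> E \<Delta>))"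


section \<open>Riggings and pairings\<close>

text \<open>
  A rigging \<open>X\<^sub>- \<supset> X\<^sub>0 \<supset> X\<^sub>+\<close> consists of the embeddings \<open>\<iota> : X\<^sub>+ \<rightarrow> X\<^sub>0\<close> and \<open>j : X\<^sub>0 \<rightarrow> X\<^sub>-\<close> and the real
  pairing \<open>p\<close> of \<open>X\<^sub>-\<close> with \<open>X\<^sub>+\<close>, by which \<open>X\<^sub>-\<close> is isometrically the dual of \<open>X\<^sub>+\<close>.
\<close>

definition rigging ::
  "('p::{real_inner, complete_space} \<Rightarrow> 'z::{real_inner, complete_space}) \<Rightarrow>
   ('z \<Rightarrow> 'm::{real_inner, complete_space}) \<Rightarrow> ('m \<Rightarrow> 'p \<Rightarrow> real) \<Rightarrow> bool" where
  "rigging \<iota> j p \<longleftrightarrow>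
     bounded_linear \<iota> \<and> inj \<iota> \<and> closure (range \<iota>) = UNIV \<and>
     (\<forall>x. linear (\<lambda>\<xi>. p \<xi> x)) \<and>
     (\<forall>\<xi>. bounded_linear (p \<xi>) \<and> onorm (p \<xi>) = norm \<xi>) \<and>
     (\<forall>f. bounded_linear f \<longrightarrow> (\<exists>\<xi>. p \<xi> = f)) \<and>
     bounded_linear j \<and> (\<forall>h x. p (j h) x = inner h (\<iota> x))"

definition hilbert_schmidt ::
  "('a::{real_inner, complete_space} \<Rightarrow> 'b::{real_inner, complete_space}) \<Rightarrow> bool" where
  "hilbert_schmidt A \<longleftrightarrow> bounded_linear A \<and>
     (\<exists>B. orthonormal_basis B \<and> (\<lambda>e. (norm (A e))\<^sup>2) summable_on B)"

text \<open>The canonical isometry of \<open>X\<^sub>-\<close> onto \<open>X\<^sub>+\<close>.\<close>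

definition riesz :: "('m \<Rightarrow> 'p \<Rightarrow> real) \<Rightarrow> 'm \<Rightarrow> 'p::{real_inner, complete_space}" where
  "riesz p \<xi> = (THE v. \<forall>x. p \<xi> x = inner v x)"

text \<open>
  The pairing of \<open>\<F>\<^sub>n(X\<^sub>-)\<close> with \<open>\<F>\<^sub>n(X\<^sub>+)\<close>: the sesquilinear continuous extension of
  \<open>\<langle>\<xi>\<^sub>1 \<otimes> \<dots> \<otimes> \<xi>\<^sub>n, x\<^sub>1 \<otimes> \<dots> \<otimes> x\<^sub>n\<rangle> = p \<xi>\<^sub>1 x\<^sub>1 \<cdots> p \<xi>\<^sub>n x\<^sub>n\<close>.
\<close>

definition fock_pairing ::
  "('m::{real_inner, complete_space} \<Rightarrow> 'p::{real_inner, complete_space} \<Rightarrow> real) \<Rightarrow> 'm fock \<Rightarrow> 'p fock \<Rightarrow> complex" where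
  "fock_pairing p P \<Phi> = cinner (fock_map (riesz p) P) \<Phi>"

text \<open>
  The pairing of the dual of \<open>\<F>\<^sub>f\<^sub>i\<^sub>n(X\<^sub>+)\<close> (sequences \<open>P\<close> with \<open>P n \<in> \<F>\<^sub>n(X\<^sub>-)\<close>) with \<open>\<F>\<^sub>f\<^sub>i\<^sub>n(X\<^sub>+)\<close>.
\<close>

definition dual_pairing ::
  "('m::{real_inner, complete_space} \<Rightarrow> 'p::{real_inner, complete_space} \<Rightarrow> real) \<Rightarrow>
   (nat \<Rightarrow> 'm fock) \<Rightarrow> 'p fock \<Rightarrow> complex" where
  "dual_pairing p P \<Phi> = (\<Sum>n | fock_comp n \<Phi> \<noteq> 0. fock_pairing p (P n) (fock_comp n \<Phi>))"

definition continuous_polynomials ::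
  "('m::{real_inner, complete_space} \<Rightarrow> 'p::{real_inner, complete_space} \<Rightarrow> real) \<Rightarrow> nat \<Rightarrow> ('m \<Rightarrow> complex) set" where
  "continuous_polynomials p n =
     {q. \<exists>c. (\<forall>j\<le>n. c j \<in> fock_level j) \<and>
         q = (\<lambda>\<omega>. \<Sum>j\<le>n. fock_pairing p (sym_tensor (replicate j \<omega>)) (c j))}"


section \<open>Jacobi fields\<close>

text \<open>
  For an operator \<open>A\<close> in \<open>\<F>(H)\<close> whose values at the arguments considered lie in \<open>\<F>(H\<^sub>+)\<close>,
  \<^term>\<open>plus_app \<iota> A\<close> is \<open>A\<close> as a map on \<open>\<F>(H\<^sub>+)\<close>, where \<open>\<iota>\<close> embeds \<open>H\<^sub>+\<close> into \<open>H\<close>.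
\<close>

definition plus_app ::
  "('p::{real_inner, complete_space} \<Rightarrow> 'h::{real_inner, complete_space}) \<Rightarrow> 'h fock_op \<Rightarrow> 'p fock \<Rightarrow> 'p fock" where
  "plus_app \<iota> A \<Phi> = (THE \<Psi>. (fock_map \<iota> \<Phi>, fock_map \<iota> \<Psi>) \<in> A)"

definition acts_continuously ::
  "('p::{real_inner, complete_space} \<Rightarrow> 'h::{real_inner, complete_space}) \<Rightarrow> nat \<Rightarrow> nat \<Rightarrow> 'h fock_op \<Rightarrow> bool" where
  "acts_continuously \<iota> m n A \<longleftrightarrow>
     (\<forall>\<Phi>\<in>fock_level m. \<exists>\<Psi>\<in>fock_level n. (fock_map \<iota> \<Phi>, fock_map \<iota> \<Psi>) \<in> A) \<and>
     continuous_on (fock_level m) (plus_app \<iota> A)"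

abbreviation annihilation ::
  "(nat \<Rightarrow> 'p \<Rightarrow> 'h::{real_inner, complete_space} fock_op) \<Rightarrow> nat \<Rightarrow> 'p \<Rightarrow> 'h fock_op" where
  "annihilation a n \<phi> \<equiv> op_adjoint (fock_level n) (fock_level (Suc n)) (a n \<phi>)"

definition jacobi_op ::
  "('p::{real_inner, complete_space} \<Rightarrow> 'h::{real_inner, complete_space}) \<Rightarrow>
   (nat \<Rightarrow> 'p \<Rightarrow> 'h fock_op) \<Rightarrow> (nat \<Rightarrow> 'p \<Rightarrow> 'h fock_op) \<Rightarrow> 'p \<Rightarrow> 'h fock_op" where
  "jacobi_op \<iota> a b \<phi> =
     {(\<Phi>, \<Psi>). \<Phi> \<in> fock_map \<iota> ` fock_fin \<and>
        (\<forall>n. fock_comp n \<Psi> =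
           (if n = 0 then 0 else op_app (a (n - 1) \<phi>) (fock_comp (n - 1) \<Phi>)) +
           op_app (b n \<phi>) (fock_comp n \<Phi>) +
           op_app (annihilation a n \<phi>) (fock_comp (Suc n) \<Phi>))}"

text \<open>
  \<^term>\<open>V n\<close> is defined on \<^term>\<open>fock_level n\<close>; its diagonal part is continuous, so that its inverse
  is automatically continuous as well.
\<close>

definition jacobi_field ::
  "('p::{real_inner, complete_space} \<Rightarrow> 'h::{real_inner, complete_space}) \<Rightarrow>
   (nat \<Rightarrow> 'p \<Rightarrow> 'h fock_op) \<Rightarrow> (nat \<Rightarrow> 'p \<Rightarrow> 'h fock_op) \<Rightarrow> bool" where
  "jacobi_field \<iota> a b \<longleftrightarrow>
     (\<forall>n \<phi>. is_operator (fock_level n) (fock_level (Suc n)) (a n \<phi>) \<and>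
            is_operator (fock_level n) (fock_level n) (b n \<phi>) \<and>
            op_adjoint (fock_level n) (fock_level n) (b n \<phi>) = b n \<phi> \<and>
            fock_map \<iota> ` fock_level n \<subseteq> Domain (a n \<phi>) \<and>
            fock_map \<iota> ` fock_level n \<subseteq> Domain (b n \<phi>) \<and>
            fock_map \<iota> ` fock_level (Suc n) \<subseteq> Domain (annihilation a n \<phi>)) \<and>
     (\<forall>n \<phi>. \<forall>(\<Phi>, \<Psi>) \<in> a n \<phi> \<union> b n \<phi>. fock_real \<Phi> \<longrightarrow> fock_real \<Psi>) \<and>
     (\<forall>n \<phi>. acts_continuously \<iota> n (Suc n) (a n \<phi>) \<and>
            acts_continuously \<iota> n n (b n \<phi>) \<and>
            acts_continuously \<iota> (Suc n) n (annihilation a n \<phi>)) \<and>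
     (\<forall>\<phi>. selfadjoint (closure (jacobi_op \<iota> a b \<phi>))) \<and>
     (\<forall>\<phi> \<psi>. strongly_commute (closure (jacobi_op \<iota> a b \<phi>)) (closure (jacobi_op \<iota> a b \<psi>))) \<and>
     (\<forall>n. \<forall>\<Phi>\<in>fock_level n. bounded_linear (\<lambda>\<phi>. plus_app \<iota> (a n \<phi>) \<Phi>) \<and>
                         bounded_linear (\<lambda>\<phi>. plus_app \<iota> (b n \<phi>) \<Phi>)) \<and>
     (\<forall>n. \<forall>\<Phi>\<in>fock_level (Suc n). bounded_linear (\<lambda>\<phi>. plus_app \<iota> (annihilation a n \<phi>) \<Phi>)) \<and>
     (\<exists>V :: nat \<Rightarrow> 'p fock \<Rightarrow> 'p fock.
        (\<forall>n. clinear_on (fock_level n) (V n) \<and> continuous_on (fock_level n) (V n) \<and>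
             V n ` fock_level n \<subseteq> fock_upto n \<and>
             (\<forall>\<Phi>\<in>fock_level n. fock_real \<Phi> \<longrightarrow> fock_real (V n \<Phi>))) \<and>
        (\<forall>\<Phi>\<in>fock_level 0. V 0 \<Phi> = \<Phi>) \<and>
        (\<forall>\<phi>s. \<phi>s \<noteq> [] \<longrightarrow> V (length \<phi>s) (sym_tensor \<phi>s)
             = foldr (\<lambda>\<phi>. plus_app \<iota> (jacobi_op \<iota> a b \<phi>)) \<phi>s vacuum) \<and>
        (\<forall>n\<ge>1. bij_betw (\<lambda>\<Phi>. fock_comp n (V n \<Phi>)) (fock_level n) (fock_level n)))"


section \<open>Spaces \<open>L\<^sup>2\<close>\<close>

definition L2_functions :: "'a measure \<Rightarrow> ('a \<Rightarrow> complex) set" where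
  "L2_functions M = {f \<in> borel_measurable M. integrable M (\<lambda>x. (cmod (f x))\<^sup>2)}"

definition L2_class :: "'a measure \<Rightarrow> ('a \<Rightarrow> complex) \<Rightarrow> ('a \<Rightarrow> complex) set" where
  "L2_class M f = {g \<in> borel_measurable M. AE x in M. g x = f x}"

definition L2 :: "'a measure \<Rightarrow> ('a \<Rightarrow> complex) set set" where
  "L2 M = L2_class M ` L2_functions M"

definition L2_closure :: "'a measure \<Rightarrow> ('a \<Rightarrow> complex) set set \<Rightarrow> ('a \<Rightarrow> complex) set set" where
  "L2_closure M S = {u \<in> L2 M. \<forall>\<epsilon>>0. \<exists>v\<in>S \<inter> L2 M. \<exists>f\<in>u. \<exists>g\<in>v.
     sqrt (\<integral>x. (cmod (f x - g x))\<^sup>2 \<partial>M) < \<epsilon>}"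

definition unitary_onto_L2 ::
  "'a measure \<Rightarrow> ('x::{real_inner, complete_space} fock \<Rightarrow> ('a \<Rightarrow> complex) set) \<Rightarrow> bool" where
  "unitary_onto_L2 M I \<longleftrightarrow>
     range I = L2 M \<and>
     (\<forall>\<Phi> \<Psi>. \<forall>f\<in>I \<Phi>. \<forall>g\<in>I \<Psi>. (\<lambda>x. f x + g x) \<in> I (\<Phi> + \<Psi>)) \<and>
     (\<forall>c \<Phi>. \<forall>f\<in>I \<Phi>. (\<lambda>x. c * f x) \<in> I (cscale c \<Phi>)) \<and>
     (\<forall>\<Phi> \<Psi>. \<forall>f\<in>I \<Phi>. \<forall>g\<in>I \<Psi>. (\<integral>x. f x * cnj (g x) \<partial>M) = cinner \<Phi> \<Psi>)"

text \<open>
  \<open>\<rho>\<close> is the spectral measure of the Jacobi field, \<open>P \<xi>\<close> are the generalized joint eigenvectors and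
  \<open>I\<close> is the Fourier transform.
\<close>

definition fourier_transform ::
  "('p::{real_inner, complete_space} \<Rightarrow> 'h::{real_inner, complete_space}) \<Rightarrow>
   ('m::{real_inner, complete_space} \<Rightarrow> 'p \<Rightarrow> real) \<Rightarrow>
   (nat \<Rightarrow> 'p \<Rightarrow> 'h fock_op) \<Rightarrow> (nat \<Rightarrow> 'p \<Rightarrow> 'h fock_op) \<Rightarrow>
   'm measure \<Rightarrow> ('m \<Rightarrow> nat \<Rightarrow> 'm fock) \<Rightarrow> ('h fock \<Rightarrow> ('m \<Rightarrow> complex) set) \<Rightarrow> bool" where
  "fourier_transform \<iota> p a b \<rho> P I \<longleftrightarrow>
     prob_space \<rho> \<and> sets \<rho> = sets borel \<and> (\<forall>\<xi> n. P \<xi> n \<in> fock_level n) \<and>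
     (\<forall>\<xi> \<phi>. \<forall>\<Phi>\<in>fock_fin. \<forall>\<Psi>\<in>fock_fin.
        (fock_map \<iota> \<Phi>, fock_map \<iota> \<Psi>) \<in> closure (jacobi_op \<iota> a b \<phi>) \<longrightarrow>
        dual_pairing p (P \<xi>) \<Psi> = complex_of_real (p \<xi> \<phi>) * dual_pairing p (P \<xi>) \<Phi>) \<and>
     unitary_onto_L2 \<rho> I \<and>
     (\<forall>\<Phi>\<in>fock_fin. (\<lambda>\<xi>. cnj (dual_pairing p (P \<xi>) \<Phi>)) \<in> L2_functions \<rho> \<and>
        I (fock_map \<iota> \<Phi>) = L2_class \<rho> (\<lambda>\<xi>. cnj (dual_pairing p (P \<xi>) \<Phi>))) \<and>
     (\<forall>\<phi> \<Phi> \<Psi>. (\<Phi>, \<Psi>) \<in> closure (jacobi_op \<iota> a b \<phi>) \<longleftrightarrow>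
        (\<exists>f\<in>I \<Phi>. (\<lambda>\<xi>. complex_of_real (p \<xi> \<phi>) * f \<xi>) \<in> I \<Psi>)) \<and>
     I vacuum = L2_class \<rho> (\<lambda>\<xi>. 1)"


section \<open>The image measure and the unitary \<open>I\<^sub>K\<close>\<close>

definition dual_op :: "('m \<Rightarrow> 'p \<Rightarrow> real) \<Rightarrow> ('n \<Rightarrow> 'q \<Rightarrow> real) \<Rightarrow> ('q \<Rightarrow> 'p) \<Rightarrow> 'm \<Rightarrow> 'n" where
  "dual_op p q K \<xi> = (THE \<omega>. \<forall>f. q \<omega> f = p \<xi> (K f))"

text \<open>
  The image of a measure on the largest possible \<open>\<sigma>\<close>-algebra, which in general is strictly larger
  than the Borel \<open>\<sigma>\<close>-algebra.
\<close>

definition image_measure :: "'m measure \<Rightarrow> ('m \<Rightarrow> 'n) \<Rightarrow> 'n measure" where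
  "image_measure \<rho> k = distr \<rho> (sigma UNIV {\<Delta>. k -` \<Delta> \<in> sets \<rho>}) k"

text \<open>
  \<open>\<kappa>\<close> exhibits its codomain as the completion of \<open>T\<^sub>+\<close> in the scalar product \<open>(A f\<^sub>1, A f\<^sub>2)\<close>.
\<close>

definition is_completion ::
  "('q::real_vector \<Rightarrow> 'h::real_inner) \<Rightarrow> ('q \<Rightarrow> 't::{real_inner, complete_space}) \<Rightarrow> bool" where
  "is_completion A \<kappa> \<longleftrightarrow> linear \<kappa> \<and> closure (range \<kappa>) = UNIV \<and>
     (\<forall>f g. inner (\<kappa> f) (\<kappa> g) = inner (A f) (A g))"

definition extension_to_completion ::
  "('q \<Rightarrow> 'h::real_normed_vector) \<Rightarrow> ('q \<Rightarrow> 't::real_normed_vector) \<Rightarrow> 't \<Rightarrow> 'h" where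
  "extension_to_completion A \<kappa> = (THE B. bounded_linear B \<and> (\<forall>f. B (\<kappa> f) = A f))"

definition L2_pullback :: "'m measure \<Rightarrow> ('m \<Rightarrow> 'n) \<Rightarrow> ('n \<Rightarrow> complex) set \<Rightarrow> ('m \<Rightarrow> complex) set" where
  "L2_pullback \<rho> k u = (\<Union>G\<in>u. L2_class \<rho> (G \<circ> k))"

definition image_transform ::
  "'m measure \<Rightarrow> ('m \<Rightarrow> 'n) \<Rightarrow> ('t::{real_inner, complete_space} \<Rightarrow> 'h::{real_inner, complete_space}) \<Rightarrow>
   ('h fock \<Rightarrow> ('m \<Rightarrow> complex) set) \<Rightarrow> 't fock \<Rightarrow> ('n \<Rightarrow> complex) set" where
  "image_transform \<rho> k Kbar I = inv_into (L2 (image_measure \<rho> k)) (L2_pullback \<rho> k) \<circ> I \<circ> fock_map Kbar"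

end

theory Submission
  imports Defs
begin

text \<open>
  The Fourier transform \<open>I\<close> turns \<open>J(\<phi>)\<close> into multiplication by \<open>\<langle>\<cdot>, \<phi>\<rangle>\<close> and \<open>\<Omega>\<close> into \<open>1\<close>, so
  \<open>V\<^sub>n(\<phi>\<^sub>1 \<otimes> \<dots> \<otimes> \<phi>\<^sub>n) = J(\<phi>\<^sub>1) \<cdots> J(\<phi>\<^sub>n)\<Omega>\<close> is mapped to \<open>\<langle>\<cdot>, \<phi>\<^sub>1\<rangle> \<cdots> \<langle>\<cdot>, \<phi>\<^sub>n\<rangle>\<close>; by continuity
  \<open>V\<^sub>n F\<close> is mapped to the monomial with coefficient \<open>F\<close>, for every \<open>F \<in> \<F>\<^sub>n(H\<^sub>+)\<close>. As the diagonal parts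
  \<open>V\<^sub>n\<^sub>,\<^sub>n\<close> are invertible, \<open>\<Oplus>\<^sub>j\<^sub>\<le>\<^sub>n \<F>\<^sub>j(H\<^sub>+)\<close> is the sum of the ranges of \<open>V\<^sub>0, \<dots>, V\<^sub>n\<close>. A polynomial on
  \<open>T\<^sub>-\<close> with coefficients \<open>c\<^sub>j\<close>, composed with \<open>K\<^sup>+\<close>, is the polynomial on \<open>H\<^sub>-\<close> with coefficients
  \<open>K\<^sup>\<otimes>\<^sup>j c\<^sub>j\<close>, and these are dense in \<open>\<F>\<^sub>j(H\<^sub>+)\<close> because the range of \<open>K\<close> is. Hence the preimages under \<open>I\<close>
  of the pulled back polynomials of degree \<open>\<le> n\<close> form a dense subspace of \<open>\<Oplus>\<^sub>j\<^sub>\<le>\<^sub>n \<F>\<^sub>j(H)\<close>, and unitarity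
  carries closures to closures.
\<close>

section \<open>Symmetric tensors\<close>

lemma fock_eqI: "(\<And>xs. form_of \<Phi> xs = form_of \<Psi> xs) \<Longrightarrow> \<Phi> = \<Psi>"
  unfolding form_of_inject[symmetric] by (rule ext)

text \<open>The arguments are freed from \<open>D\<close> one at a time: symmetry brings the
  argument in question to the front, where linearity extends the vanishing to the span and
  continuity to its closure. The total set is left open because the lemma is applied both to an
  orthonormal basis and to the range of an adjoint.\<close>

lemma symmetric_multilinear_vanish:
  fixes F :: "'a::real_normed_vector list \<Rightarrow> 'b::real_normed_vector"
  assumes sym: "\<And>xs ys. mset xs = mset ys \<Longrightarrow> F xs = F ys"
    and lin: "\<And>xs. bounded_linear (\<lambda>x. F (x # xs))"
    and D: "closure (span D) = UNIV"
    and z: "\<And>xs. xs \<in> lists D \<Longrightarrow> F xs = 0"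
  shows "F xs = 0"
proof -
  have "F (xs @ bs) = 0" if "bs \<in> lists D" for bs using that
  proof (induction xs arbitrary: bs)
    case (Cons x xs)
    have "F (b # xs @ bs) = 0" if "b \<in> D" for b
    proof -
      have "F (b # xs @ bs) = F (xs @ b # bs)" by (rule sym) simp
      then show ?thesis using Cons that by simp
    qed
    then have "F (y # xs @ bs) = 0" if "y \<in> span D" for y
      using linear_eq_on_span[OF bounded_linear.linear[OF lin] linear_zero _ that] by blast
    moreover have "closed {y. F (y # xs @ bs) = 0}"
      by (intro closed_Collect_eq continuous_intros linear_continuous_on lin)
    ultimately have "closure (span D) \<subseteq> {y. F (y # xs @ bs) = 0}"
      by (intro closure_minimal) auto
    then show ?case using D by auto
  qed (simp add: z)
  from this[of "[]"] show ?thesis by simp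
qed

section \<open>Norm and complex scalar product of the Fock space\<close>

lemma norm_fock_sq: "(norm \<Phi>)\<^sup>2 = (\<Sum>\<^sub>\<infinity>xs\<in>lists onb. (cmod (form_of \<Phi> xs))\<^sup>2)"
  by (simp add: norm_fock_def inner_fock_def cinner_self infsum_nonneg)

lemma ennreal_norm_fock_sq: "ennreal ((norm \<Phi>)\<^sup>2) = (\<Sum>n. sq_sum n (form_of \<Phi>))"
  unfolding norm_fock_sq nn_integral_lists_onb[symmetric]
  by (rule nn_integral_count_space_has_sum[symmetric, OF has_sum_infsum[OF form_of_summable]]) simp

lemma cinner_self_norm: "cinner \<Phi> \<Phi> = complex_of_real ((norm \<Phi>)\<^sup>2)"
  by (simp add: cinner_self norm_fock_sq)

lemma cinner_add_right: "cinner \<Phi> (\<Psi> + \<Psi>') = cinner \<Phi> \<Psi> + cinner \<Phi> \<Psi>'"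
  by (metis cinner_add_left cinner_commute complex_cnj_add)

lemma norm_cscale: "norm (cscale c \<Phi>) = cmod c * norm \<Phi>"
proof -
  have "(norm (cscale c \<Phi>))\<^sup>2 = (cmod c * norm \<Phi>)\<^sup>2"
    unfolding norm_fock_sq power_mult_distrib cscale.rep_eq norm_mult by (simp add: infsum_cmult_right')
  then show ?thesis by (simp add: power2_eq_imp_eq)
qed

lemma bounded_linear_cscale: "bounded_linear (cscale c)"
  by (rule bounded_linear_intro[where K = "cmod c"])
    (auto intro!: fock_eqI simp: plus_fock.rep_eq cscale.rep_eq scaleR_fock.rep_eq norm_cscale algebra_simps)

text \<open>The real Cauchy-Schwarz inequality sees only the real part, so \<open>\<Phi>\<close> is
  first multiplied by the phase \<open>c\<close> that makes the scalar product a positive real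
  number.\<close>

lemma cmod_cinner_le: "cmod (cinner \<Phi> \<Psi>) \<le> norm \<Phi> * norm \<Psi>"
proof (cases "cinner \<Phi> \<Psi> = 0")
  case False
  define c where "c = cnj (cinner \<Phi> \<Psi>) / cmod (cinner \<Phi> \<Psi>)"
  have "cinner (cscale c \<Phi>) \<Psi> = cinner \<Phi> \<Psi> * cnj (cinner \<Phi> \<Psi>) / cmod (cinner \<Phi> \<Psi>)"
    by (simp add: cinner_cscale_left c_def)
  also have "\<dots> = complex_of_real (cmod (cinner \<Phi> \<Psi>))"
    unfolding complex_norm_square[symmetric] using False by (simp add: power2_eq_square)
  finally have "cmod (cinner \<Phi> \<Psi>) = Re (cinner (cscale c \<Phi>) \<Psi>)" by simp
  also have "\<dots> \<le> norm (cscale c \<Phi>) * norm \<Psi>"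
    using norm_cauchy_schwarz[of "cscale c \<Phi>" \<Psi>] by (simp add: inner_fock_def)
  also have "\<dots> = norm \<Phi> * norm \<Psi>" using False by (simp add: norm_cscale c_def norm_divide)
  finally show ?thesis .
qed simp

lemma bounded_linear_cinner_left: "bounded_linear (\<lambda>\<Phi>. cinner \<Phi> \<Psi>)"
  by (rule bounded_linear_intro[where K = "norm \<Psi>"])
    (simp_all add: cinner_add_left scaleR_fock_eq cinner_cscale_left cmod_cinner_le scaleR_conv_of_real)

text \<open>On the diagonal every permutation gives the same product, so the average over
  permutations disappears. This is where products of pairings with a single \<xi> come from.\<close>

lemma tensor_form_replicate:
  "tensor_form xs (replicate (length xs) y) = (\<Prod>x\<leftarrow>xs. complex_of_real (inner x y))"
proof -
  have "(\<Prod>i<length xs. complex_of_real (inner (xs ! \<sigma> i) y)) = (\<Prod>x\<leftarrow>xs. complex_of_real (inner x y))"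
    if "\<sigma> permutes {..<length xs}" for \<sigma>
  proof -
    have "(\<Prod>i<length xs. complex_of_real (inner (xs ! \<sigma> i) y)) = (\<Prod>i<length xs. complex_of_real (inner (xs ! i) y))"
      using prod.permute[OF that, of "\<lambda>i. complex_of_real (inner (xs ! i) y)"] by (simp add: o_def)
    also have "\<dots> = (\<Prod>x\<leftarrow>xs. complex_of_real (inner x y))"
      by (simp add: prod.list_conv_set_nth atLeast0LessThan)
    finally show ?thesis .
  qed
  then show ?thesis by (simp add: tensor_form_def card_permutations)
qed

text \<open>Reindexing by \<sigma> and passing to inverse permutations interchanges the two lists.
  What is known about the second list thus becomes available for the first.\<close>

lemma tensor_form_commute: "tensor_form xs ys = tensor_form ys xs"
proof (cases "length ys = length xs")
  case True
  let ?n = "length xs" and ?P = "{\<sigma>. \<sigma> permutes {..<length xs}}"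
  have "(\<Prod>i<?n. complex_of_real (inner (xs ! inv \<sigma> i) (ys ! i))) = (\<Prod>i<?n. complex_of_real (inner (ys ! \<sigma> i) (xs ! i)))"
    if "\<sigma> permutes {..<?n}" for \<sigma>
    using prod.permute[OF that, of "\<lambda>i. complex_of_real (inner (xs ! inv \<sigma> i) (ys ! i))"]
    by (simp add: o_def inner_commute permutes_inverses(2)[OF that])
  then have "(\<Sum>\<sigma>\<in>?P. \<Prod>i<?n. complex_of_real (inner (xs ! \<sigma> i) (ys ! i)))
     = (\<Sum>\<sigma>\<in>?P. \<Prod>i<?n. complex_of_real (inner (ys ! \<sigma> i) (xs ! i)))"
    by (subst sum_permutations_inverse) (auto intro: sum.cong)
  then show ?thesis using True by (simp add: tensor_form_def)
qed (simp add: tensor_form_def)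

lemma tensor_form_mset: "mset xs = mset xs' \<Longrightarrow> tensor_form xs ys = tensor_form xs' ys"
  by (metis tensor_form_commute fock_formsD(1)[OF tensor_form_fock])

lemma cnj_tensor_form: "cnj (tensor_form xs ys) = tensor_form xs ys"
  by (simp add: tensor_form_def)

lemma sym_tensor_mset: "mset xs = mset ys \<Longrightarrow> sym_tensor xs = sym_tensor ys"
  by (rule fock_eqI) (simp only: sym_tensor.rep_eq, rule tensor_form_mset)

text \<open>Cauchy-Schwarz over the n! permutations costs a factor n! against the square of the
  prefactor 1/n!. What remains is an average, to which every permutation contributes the same
  product of norms. The bound makes \<open>sym_tensor\<close> continuous in each factor.\<close>

lemma norm_sym_tensor_le: "norm (sym_tensor xs) \<le> (\<Prod>i<length xs. norm (xs ! i))"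
proof -
  let ?n = "length xs" and ?P = "{\<sigma>. \<sigma> permutes {..<length xs}}" and ?c = "1 / fact (length xs) :: real"
  let ?g = "\<lambda>\<sigma> ys. \<Prod>i<?n. complex_of_real (inner (xs ! \<sigma> i) (ys ! i))"
  let ?I = "\<lambda>ys. indicator {ys \<in> lists (onb :: 'a set). length ys = ?n} ys :: ennreal"
  have finP: "finite ?P" by (simp add: finite_permutations)
  have cP: "real (card ?P) = fact ?n" by (simp add: card_permutations)
  have bound: "ennreal ((cmod (tensor_form xs ys))\<^sup>2) * ?I ys
      \<le> (\<Sum>\<sigma>\<in>?P. ennreal ?c * (ennreal ((cmod (?g \<sigma> ys))\<^sup>2) * ?I ys))" for ys
  proof (cases "length ys = ?n")
    case True
    have "cmod (tensor_form xs ys) = ?c * cmod (\<Sum>\<sigma>\<in>?P. ?g \<sigma> ys)"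
      using True by (simp add: tensor_form_def norm_divide)
    also have "\<dots> \<le> ?c * (\<Sum>\<sigma>\<in>?P. cmod (?g \<sigma> ys))" by (intro mult_left_mono norm_sum) simp
    finally have "(cmod (tensor_form xs ys))\<^sup>2 \<le> (?c * (\<Sum>\<sigma>\<in>?P. cmod (?g \<sigma> ys)))\<^sup>2" by (rule power_mono) simp
    also have "\<dots> \<le> ?c\<^sup>2 * (fact ?n * (\<Sum>\<sigma>\<in>?P. (cmod (?g \<sigma> ys))\<^sup>2))"
      using sum_squared_le_sum_of_squares[of "\<lambda>\<sigma>. cmod (?g \<sigma> ys)" ?P]
      unfolding power_mult_distrib cP by (intro mult_left_mono) (simp_all add: mult.commute)
    also have "\<dots> = (\<Sum>\<sigma>\<in>?P. ?c * (cmod (?g \<sigma> ys))\<^sup>2)"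
      by (simp add: power2_eq_square sum_distrib_left sum_divide_distrib)
    finally have "ennreal ((cmod (tensor_form xs ys))\<^sup>2) \<le> ennreal (\<Sum>\<sigma>\<in>?P. ?c * (cmod (?g \<sigma> ys))\<^sup>2)"
      by (rule ennreal_leI)
    also have "\<dots> = (\<Sum>\<sigma>\<in>?P. ennreal ?c * ennreal ((cmod (?g \<sigma> ys))\<^sup>2))"
      by (subst sum_ennreal[symmetric]) (simp_all add: ennreal_mult[symmetric])
    finally show ?thesis by (auto split: split_indicator)
  qed simp
  have "sq_sum ?n (tensor_form xs) \<le> (\<Sum>\<sigma>\<in>?P. ennreal ?c * sq_sum ?n (?g \<sigma>))"
  proof -
    have "sq_sum ?n (tensor_form xs) \<le> (\<integral>\<^sup>+ys. (\<Sum>\<sigma>\<in>?P. ennreal ?c * (ennreal ((cmod (?g \<sigma> ys))\<^sup>2) * ?I ys)) \<partial>count_space UNIV)"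
      unfolding sq_sum_def by (rule nn_integral_mono) (rule bound)
    also have "\<dots> = (\<Sum>\<sigma>\<in>?P. ennreal ?c * sq_sum ?n (?g \<sigma>))"
      unfolding sq_sum_def by (subst nn_integral_sum) (simp_all add: nn_integral_cmult)
    finally show ?thesis .
  qed
  also have "\<dots> = (\<Sum>\<sigma>\<in>?P. ennreal ?c * ennreal ((\<Prod>i<?n. norm (xs ! i))\<^sup>2))"
  proof (intro sum.cong refl)
    fix \<sigma> assume "\<sigma> \<in> ?P"
    then have "(\<Prod>i<?n. norm (xs ! \<sigma> i)) = (\<Prod>i<?n. norm (xs ! i))"
      using prod.permute[of \<sigma> "{..<?n}" "\<lambda>i. norm (xs ! i)"] by (simp add: o_def)
    then show "ennreal ?c * sq_sum ?n (?g \<sigma>) = ennreal ?c * ennreal ((\<Prod>i<?n. norm (xs ! i))\<^sup>2)"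
      by (simp only: prod_inner_nn_integral)
  qed
  also have "\<dots> = ennreal ((\<Prod>i<?n. norm (xs ! i))\<^sup>2)"
  proof -
    have "of_nat (card ?P) * ennreal ?c = ennreal (fact ?n * ?c)"
      unfolding ennreal_of_nat_eq_real_of_nat cP by (rule ennreal_mult[symmetric]) simp_all
    then have "of_nat (card ?P) * ennreal ?c = 1" by simp
    then show ?thesis by (simp only: sum_constant mult.assoc[symmetric] mult_1_left)
  qed
  finally have le: "sq_sum ?n (tensor_form xs) \<le> ennreal ((\<Prod>i<?n. norm (xs ! i))\<^sup>2)" .
  have "sq_sum n (tensor_form xs) = 0" if "n \<noteq> ?n" for n
  proof -
    have "sq_sum n (tensor_form xs) = (\<integral>\<^sup>+ys. 0 \<partial>count_space (UNIV :: 'a list set))"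
      unfolding sq_sum_def by (rule nn_integral_cong)
        (use that in \<open>auto simp: tensor_form_def split: split_indicator\<close>)
    then show ?thesis by simp
  qed
  then have "ennreal ((norm (sym_tensor xs))\<^sup>2) = (\<Sum>n\<in>{?n}. sq_sum n (tensor_form xs))"
    unfolding ennreal_norm_fock_sq sym_tensor.rep_eq by (intro suminf_finite) auto
  with le have "ennreal ((norm (sym_tensor xs))\<^sup>2) \<le> ennreal ((\<Prod>i<?n. norm (xs ! i))\<^sup>2)" by simp
  then have "(norm (sym_tensor xs))\<^sup>2 \<le> (\<Prod>i<?n. norm (xs ! i))\<^sup>2" by (simp only: ennreal_le_iff zero_le_power2)
  then show ?thesis by (rule power2_le_imp_le) (simp add: prod_nonneg)
qed

lemma bounded_linear_sym_tensor: "bounded_linear (\<lambda>x. sym_tensor (x # xs))"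
proof (rule bounded_linear_intro)
  \<comment> \<open>With the two lists exchanged, linearity in \<open>x\<close> is linearity of the
    form \<open>tensor_form ys\<close> in its first argument.\<close>
  have t: "tensor_form (x # xs) ys = tensor_form ys (x # xs)" for x and ys :: "'a list"
    by (rule tensor_form_commute)
  note bl = fock_formsD(2)[OF tensor_form_fock, THEN bounded_linear.linear]
  show "sym_tensor ((x + y) # xs) = sym_tensor (x # xs) + sym_tensor (y # xs)" for x y
    by (rule fock_eqI) (simp add: sym_tensor.rep_eq plus_fock.rep_eq t linear_add[OF bl])
  show "sym_tensor ((r *\<^sub>R x) # xs) = r *\<^sub>R sym_tensor (x # xs)" for r x
    by (rule fock_eqI) (simp add: sym_tensor.rep_eq scaleR_fock.rep_eq t linear_scale[OF bl] scaleR_conv_of_real)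
  show "norm (sym_tensor (x # xs)) \<le> norm x * (\<Prod>i<length xs. norm (xs ! i))" for x
    using norm_sym_tensor_le[of "x # xs"] by (simp add: prod.lessThan_Suc_shift del: prod.lessThan_Suc)
qed

section \<open>Tensors of orthonormal basis vectors\<close>

lemma onb_inner:
  fixes b b' :: "'a::{real_inner, complete_space}"
  shows "b \<in> onb \<Longrightarrow> b' \<in> onb \<Longrightarrow> inner b b' = (if b = b' then 1 else 0)"
  using orthonormal_basis_onb[where 'a='a] by (auto simp: orthonormal_basis_def pairwise_def orthogonal_def norm_eq_1)

lemma total_onb: "closure (span (onb :: 'a::{real_inner, complete_space} set)) = UNIV"
  using orthonormal_basis_onb[where 'a='a] by (simp add: orthonormal_basis_def)

text \<open>
  On lists of basis vectors \<^term>\<open>tensor_form xs\<close> is the average of the indicators of the rearrangements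
  of \<open>xs\<close>.
\<close>

lemma sum_form_tensor_form:
  assumes B: "finite B" "B \<subseteq> onb" and ys: "ys \<in> lists onb"
  shows "(\<Sum>xs | set xs \<subseteq> B \<and> length xs = n. form_of \<Phi> xs * tensor_form xs ys)
     = (if set ys \<subseteq> B \<and> length ys = n then form_of \<Phi> ys else 0)"
proof (cases "length ys = n")
  case True
  let ?A = "{xs. set xs \<subseteq> B \<and> length xs = n}" and ?P = "{\<sigma>. \<sigma> permutes {..<n}}"
  have finA: "finite ?A" by (rule finite_lists_length_eq[OF B(1)])
  \<comment> \<open>By orthonormality each factor is a Kronecker delta, so the product tests whether
    the permuted word equals \<open>ys\<close>.\<close>
  have g: "(\<Prod>i<n. complex_of_real (inner (xs ! \<sigma> i) (ys ! i))) = (if permute_list \<sigma> xs = ys then 1 else 0)"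
    if xs: "xs \<in> ?A" and \<sigma>: "\<sigma> \<in> ?P" for xs \<sigma>
  proof -
    have "xs ! \<sigma> i \<in> onb" "ys ! i \<in> onb" if "i < n" for i
      using xs \<sigma> B ys True that permutes_in_image[of \<sigma> "{..<n}" i]
      by (auto simp: in_lists_conv_set intro!: subsetD[OF B(2)] subsetD[of "set xs" B])
    then have "complex_of_real (inner (xs ! \<sigma> i) (ys ! i)) = (if xs ! \<sigma> i = ys ! i then 1 else 0)" if "i < n" for i
      using that by (simp add: onb_inner)
    then have "(\<Prod>i<n. complex_of_real (inner (xs ! \<sigma> i) (ys ! i))) = (\<Prod>i<n. if xs ! \<sigma> i = ys ! i then 1 else 0)"
      by simp
    also have "\<dots> = (if \<forall>i<n. xs ! \<sigma> i = ys ! i then 1 else 0)"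
      by (auto simp: prod_zero_iff)
    also have "(\<forall>i<n. xs ! \<sigma> i = ys ! i) \<longleftrightarrow> permute_list \<sigma> xs = ys"
      using xs \<sigma> True by (auto simp: list_eq_iff_nth_eq permute_list_nth)
    finally show ?thesis .
  qed
  \<comment> \<open>For fixed \<sigma> at most one word contributes, the rearrangement of
    \<open>ys\<close> by \<open>inv \<sigma>\<close>, and there the symmetric form has the same
    value as at \<open>ys\<close>.\<close>
  have inner_sum: "(\<Sum>xs\<in>?A. form_of \<Phi> xs * (if permute_list \<sigma> xs = ys then 1 else 0))
     = (if set ys \<subseteq> B then form_of \<Phi> ys else 0)" if \<sigma>: "\<sigma> \<in> ?P" for \<sigma>
  proof -
    have "permute_list \<sigma> xs = ys \<longleftrightarrow> xs = permute_list (inv \<sigma>) ys" if "length xs = n" for xs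
    proof -
      have "\<sigma> permutes {..<n}" "inv \<sigma> permutes {..<n}" using \<sigma> by (auto intro: permutes_inv)
      then have "permute_list (inv \<sigma>) (permute_list \<sigma> xs) = xs" "permute_list \<sigma> (permute_list (inv \<sigma>) ys) = ys"
        using permute_list_compose[of "inv \<sigma>" xs \<sigma>] permute_list_compose[of \<sigma> ys "inv \<sigma>"] that True
        by (simp_all add: permutes_inv_o)
      then show ?thesis by metis
    qed
    then have "(\<Sum>xs\<in>?A. form_of \<Phi> xs * (if permute_list \<sigma> xs = ys then 1 else 0))
      = (\<Sum>xs\<in>?A. if xs = permute_list (inv \<sigma>) ys then form_of \<Phi> xs else 0)"
      by (intro sum.cong) auto
    also have "\<dots> = (if permute_list (inv \<sigma>) ys \<in> ?A then form_of \<Phi> (permute_list (inv \<sigma>) ys) else 0)"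
      using finA by (simp add: sum.delta)
    also have "\<dots> = (if set ys \<subseteq> B then form_of \<Phi> ys else 0)"
    proof -
      have "mset (permute_list (inv \<sigma>) ys) = mset ys" using \<sigma> True by (intro mset_permute_list) (auto intro: permutes_inv)
      then show ?thesis
        using fock_formsD(1)[OF form_of, of "permute_list (inv \<sigma>) ys" ys \<Phi>] True
        by (auto dest: mset_eq_setD)
    qed
    finally show ?thesis .
  qed
  have "(\<Sum>xs\<in>?A. form_of \<Phi> xs * tensor_form xs ys)
     = (\<Sum>xs\<in>?A. \<Sum>\<sigma>\<in>?P. form_of \<Phi> xs * (if permute_list \<sigma> xs = ys then 1 else 0) / fact n)"
    using True g by (intro sum.cong refl)
      (simp add: tensor_form_def sum_distrib_left sum_divide_distrib)
  also have "\<dots> = (\<Sum>\<sigma>\<in>?P. (\<Sum>xs\<in>?A. form_of \<Phi> xs * (if permute_list \<sigma> xs = ys then 1 else 0)) / fact n)"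
    by (subst sum.swap) (simp add: sum_divide_distrib)
  also have "\<dots> = (\<Sum>\<sigma>\<in>?P. (if set ys \<subseteq> B then form_of \<Phi> ys else 0) / fact n)"
    by (intro sum.cong refl) (simp only: inner_sum)
  also have "\<dots> = (if set ys \<subseteq> B then form_of \<Phi> ys else 0)" by (simp add: card_permutations)
  finally show ?thesis using True by simp
qed (auto intro!: sum.neutral simp: tensor_form_def)

text \<open>Both sides are symmetric and real multilinear in \<open>xs\<close>, so lists of basis
  vectors suffice; there only finitely many terms of \<open>cinner\<close> survive and
  \<open>sum_form_tensor_form\<close> evaluates them. This reproducing property makes the
  evaluations of a form continuous in the Fock vector.\<close>

lemma cinner_sym_tensor: "cinner \<Phi> (sym_tensor xs) = form_of \<Phi> xs"
proof -
  \<comment> \<open>The difference is conjugated so that the tensor stands in the left argument, for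
    which \<open>bounded_linear_cinner_left\<close> applies.\<close>
  define G where "G = (\<lambda>xs. cinner (sym_tensor xs) \<Phi> - cnj (form_of \<Phi> xs))"
  have "G xs = 0"
  proof (rule symmetric_multilinear_vanish[OF _ _ total_onb])
    show "G xs = G ys" if "mset xs = mset ys" for xs ys
      using sym_tensor_mset[OF that] fock_formsD(1)[OF form_of that, of \<Phi>] by (simp add: G_def)
    show "bounded_linear (\<lambda>x. G (x # xs))" for xs
      unfolding G_def
      by (intro bounded_linear_sub bounded_linear_compose[OF bounded_linear_cinner_left bounded_linear_sym_tensor]
          bounded_linear_compose[OF bounded_linear_cnj fock_formsD(2)[OF form_of]])
    fix xs :: "'a list" assume xs: "xs \<in> lists onb"
    then have sx: "set xs \<subseteq> onb" by auto
    let ?A = "{ys. set ys \<subseteq> set xs \<and> length ys = length xs}"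
    \<comment> \<open>A word of the right length with a letter \<open>y\<close> outside
      \<open>xs\<close> is orthogonal to every rearrangement of \<open>xs\<close>: the factor at the
      position of \<open>y\<close> vanishes.\<close>
    have "tensor_form xs ys = 0" if ysA: "ys \<in> lists onb - ?A" for ys
    proof (cases "length ys = length xs")
      case True
      with ysA have "\<not> set ys \<subseteq> set xs" by simp
      then obtain y where y: "y \<in> set ys" "y \<notin> set xs" by blast
      then obtain i where i: "i < length xs" "ys ! i = y" using True by (metis in_set_conv_nth)
      have "(\<Prod>i<length xs. complex_of_real (inner (xs ! \<sigma> i) (ys ! i))) = 0" if \<sigma>: "\<sigma> permutes {..<length xs}" for \<sigma>
      proof (rule prod_zero)
        have "\<sigma> i < length xs" using permutes_in_image[OF \<sigma>, of i] i by simp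
        then have "xs ! \<sigma> i \<in> set xs" by simp
        moreover from this have "xs ! \<sigma> i \<in> onb" using sx by blast
        moreover have "y \<in> onb" using ysA y(1) by auto
        ultimately have "inner (xs ! \<sigma> i) y = 0" using onb_inner y(2) by metis
        then show "\<exists>i\<in>{..<length xs}. complex_of_real (inner (xs ! \<sigma> i) (ys ! i)) = 0" using i by (intro bexI[of _ i]) auto
      qed simp
      then have "(\<Sum>\<sigma> | \<sigma> permutes {..<length xs}. \<Prod>i<length xs. complex_of_real (inner (xs ! \<sigma> i) (ys ! i))) = 0"
        by (intro sum.neutral) blast
      then show ?thesis by (simp add: tensor_form_def)
    qed (simp add: tensor_form_def)
    then have z: "tensor_form ys xs = 0" if "ys \<in> lists onb - ?A" for ys
      using that by (subst tensor_form_commute)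
    have "cinner \<Phi> (sym_tensor xs) = (\<Sum>\<^sub>\<infinity>ys\<in>lists onb. form_of \<Phi> ys * tensor_form ys xs)"
      unfolding cinner_def sym_tensor.rep_eq cnj_tensor_form by (subst tensor_form_commute) (rule refl)
    also have "\<dots> = (\<Sum>\<^sub>\<infinity>ys\<in>?A. form_of \<Phi> ys * tensor_form ys xs)"
      using sx z by (intro infsum_cong_neutral) (auto simp: in_lists_conv_set)
    also have "\<dots> = (\<Sum>ys\<in>?A. form_of \<Phi> ys * tensor_form ys xs)"
      by (intro infsum_finite finite_lists_length_eq) simp
    also have "\<dots> = form_of \<Phi> xs"
      using sum_form_tensor_form[OF _ sx xs, of \<Phi> "length xs"] by simp
    finally show "G xs = 0" unfolding G_def by (subst cinner_commute) simp
  qed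
  then show ?thesis unfolding G_def by (subst cinner_commute) simp
qed

lemma continuous_on_form_of: "continuous_on S (\<lambda>\<Phi>. form_of \<Phi> xs)"
  unfolding cinner_sym_tensor[symmetric] by (rule linear_continuous_on[OF bounded_linear_cinner_left])

lemma tendsto_form_of: "f \<longlonglongrightarrow> \<Phi> \<Longrightarrow> (\<lambda>k. form_of (f k) xs) \<longlonglongrightarrow> form_of \<Phi> xs"
  unfolding cinner_sym_tensor[symmetric] by (rule bounded_linear.tendsto[OF bounded_linear_cinner_left])

section \<open>Levels of the Fock space\<close>

text \<open>\<open>A\<close> carries the squared norm of \<open>\<Phi>\<close> up to less than
  \<open>e\<^sup>2\<close>, so deleting values outside \<open>A\<close> moves the vector by less
  than \<open>e\<close>. Which of them are deleted is left open, so that the lemma serves truncation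
  by length as well as truncation to finitely many basis vectors.\<close>

lemma norm_diff_fock_lt:
  assumes "e > 0"
  obtains A where "finite A" "A \<subseteq> lists onb"
    "\<And>\<Psi>. (\<And>xs. form_of \<Psi> xs = form_of \<Phi> xs \<or> xs \<notin> A \<and> (xs \<in> lists onb \<longrightarrow> form_of \<Psi> xs = 0)) \<Longrightarrow> dist \<Psi> \<Phi> < e"
proof -
  let ?F = "\<lambda>xs. (cmod (form_of \<Phi> xs))\<^sup>2"
  have summ: "?F summable_on lists onb" by (rule form_of_summable)
  have "\<forall>\<^sub>F A in finite_subsets_at_top (lists onb). dist (sum ?F A) (infsum ?F (lists onb)) < e\<^sup>2"
    using tendstoD[OF infsum_tendsto[OF summ], of "e\<^sup>2"] assms by simp
  then obtain A where A: "finite A" "A \<subseteq> lists onb" "dist (sum ?F A) (infsum ?F (lists onb)) < e\<^sup>2"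
    unfolding eventually_finite_subsets_at_top by blast
  show ?thesis
  proof (rule that[OF A(1,2)])
    fix \<Psi> assume \<Psi>: "form_of \<Psi> xs = form_of \<Phi> xs \<or> xs \<notin> A \<and> (xs \<in> lists onb \<longrightarrow> form_of \<Psi> xs = 0)" for xs
    have "(norm (\<Psi> - \<Phi>))\<^sup>2 = (\<Sum>\<^sub>\<infinity>xs\<in>lists onb. (cmod (form_of (\<Psi> - \<Phi>) xs))\<^sup>2)" by (rule norm_fock_sq)
    also have "\<dots> = (\<Sum>\<^sub>\<infinity>xs\<in>lists onb - A. (cmod (form_of (\<Psi> - \<Phi>) xs))\<^sup>2)"
    proof (rule infsum_cong_neutral)
      fix xs assume "xs \<in> lists onb - (lists onb - A)"
      then show "(cmod (form_of (\<Psi> - \<Phi>) xs))\<^sup>2 = 0" using \<Psi>[of xs] by (simp add: minus_fock.rep_eq)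
    qed auto
    also have "\<dots> \<le> (\<Sum>\<^sub>\<infinity>xs\<in>lists onb - A. ?F xs)"
    proof (rule infsum_mono)
      show "(\<lambda>xs. (cmod (form_of (\<Psi> - \<Phi>) xs))\<^sup>2) summable_on lists onb - A"
        by (rule summable_on_subset_banach[OF form_of_summable]) simp
      show "?F summable_on lists onb - A" by (rule summable_on_subset_banach[OF form_of_summable]) simp
      show "(cmod (form_of (\<Psi> - \<Phi>) xs))\<^sup>2 \<le> ?F xs" if "xs \<in> lists onb - A" for xs
        using \<Psi>[of xs] that by (auto simp: minus_fock.rep_eq)
    qed
    also have "\<dots> = infsum ?F (lists onb) - infsum ?F A"
      using A by (intro infsum_Diff summ) auto
    also have "\<dots> < e\<^sup>2" using A by (simp add: dist_real_def)
    finally show "dist \<Psi> \<Phi> < e" using assms unfolding dist_fock_def by (intro power2_less_imp_less[of _ e]) auto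
  qed
qed

lemma fock_level_add: "\<Phi> \<in> fock_level n \<Longrightarrow> \<Psi> \<in> fock_level n \<Longrightarrow> \<Phi> + \<Psi> \<in> fock_level n"
  and fock_level_cscale: "\<Phi> \<in> fock_level n \<Longrightarrow> cscale c \<Phi> \<in> fock_level n"
  and fock_level_zero: "0 \<in> fock_level n"
  by (simp_all add: fock_level_def plus_fock.rep_eq cscale.rep_eq zero_fock.rep_eq)

lemma subspace_fock_level: "subspace (fock_level n)"
  unfolding subspace_def by (simp add: scaleR_fock_eq fock_level_add fock_level_cscale fock_level_zero)

lemma fock_level_sym_tensor: "length xs = n \<Longrightarrow> sym_tensor xs \<in> fock_level n"
  by (simp add: fock_level_def sym_tensor.rep_eq tensor_form_def)

lemma fock_level_comp: "fock_comp n \<Phi> \<in> fock_level n"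
  by (simp add: fock_level_def fock_comp.rep_eq)

lemma subspace_fock_upto: "subspace (fock_upto n)"
  by (simp add: subspace_def fock_upto_def plus_fock.rep_eq scaleR_fock.rep_eq zero_fock.rep_eq)

lemma fock_upto_mono: "m \<le> n \<Longrightarrow> fock_upto m \<subseteq> fock_upto n"
  by (auto simp: fock_upto_def)

lemma fock_level_upto: "j \<le> n \<Longrightarrow> fock_level j \<subseteq> fock_upto n"
  by (auto simp: fock_level_def fock_upto_def)

lemma closed_fock_upto: "closed (fock_upto n)"
proof -
  have "fock_upto n = (\<Inter>xs\<in>{xs. n < length xs}. {\<Phi> :: 'a fock. form_of \<Phi> xs = 0})" by (auto simp: fock_upto_def)
  then show ?thesis
    by (simp only:) (intro closed_INT ballI closed_Collect_eq continuous_on_form_of continuous_on_const)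
qed

lemma fock_comp_upto: "\<Phi> \<in> fock_upto m \<Longrightarrow> m < n \<Longrightarrow> fock_comp n \<Phi> = 0"
  by (auto intro!: fock_eqI simp: fock_comp.rep_eq zero_fock.rep_eq fock_upto_def)

lemma form_of_sum: "form_of (sum f A) xs = (\<Sum>a\<in>A. form_of (f a) xs)"
  by (induction A rule: infinite_finite_induct) (simp_all add: zero_fock.rep_eq plus_fock.rep_eq)

lemma form_of_sum_comp: "form_of (\<Sum>j\<le>n. fock_comp j \<Phi>) xs = (if length xs \<le> n then form_of \<Phi> xs else 0)"
  by (simp add: form_of_sum fock_comp.rep_eq)

lemma fock_upto_sum_comp: "\<Phi> \<in> fock_upto n \<Longrightarrow> (\<Sum>j\<le>n. fock_comp j \<Phi>) = \<Phi>"
  by (rule fock_eqI) (auto simp: form_of_sum_comp fock_upto_def)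

lemma dense_fock_fin: "closure fock_fin = UNIV"
proof -
  have "\<exists>\<Psi>\<in>fock_fin. dist \<Psi> \<Phi> < e" if e: "e > 0" for \<Phi> :: "'a fock" and e
  proof -
    obtain A where A: "finite A" "A \<subseteq> lists onb"
      "\<And>\<Psi>. (\<And>xs. form_of \<Psi> xs = form_of \<Phi> xs \<or> xs \<notin> A \<and> (xs \<in> lists onb \<longrightarrow> form_of \<Psi> xs = 0)) \<Longrightarrow> dist \<Psi> \<Phi> < e"
      using norm_diff_fock_lt[OF e, of \<Phi>] by blast
    \<comment> \<open>The inserted 0 gives \<open>Max\<close> a value when \<open>A\<close> is
      empty.\<close>
    define n where "n = Max (insert 0 (length ` A))"
    have n: "length xs \<le> n" if "xs \<in> A" for xs using that A(1) by (simp add: n_def)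
    have "dist (\<Sum>j\<le>n. fock_comp j \<Phi>) \<Phi> < e"
      by (rule A(3)) (use n in \<open>auto simp: form_of_sum_comp\<close>)
    moreover have "(\<Sum>j\<le>n. fock_comp j \<Phi>) \<in> fock_fin"
      by (auto simp: fock_fin_def fock_upto_def form_of_sum_comp intro!: exI[of _ n])
    ultimately show ?thesis by blast
  qed
  then show ?thesis by (auto simp: closure_approachable)
qed

text \<open>Density of the span of product tensors, cast as an induction rule: the values of
  \<open>\<Phi>\<close> on the words over finitely many basis vectors, taken as coefficients, give a
  finite combination of tensors that truncates \<open>\<Phi>\<close>.\<close>

lemma fock_level_induct [consumes 1, case_names tensor add cscale lim]:
  fixes \<Phi> :: "'x::{real_inner, complete_space} fock"
  assumes \<Phi>: "\<Phi> \<in> fock_level n"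
    and t: "\<And>xs. length xs = n \<Longrightarrow> P (sym_tensor xs)"
    and a: "\<And>\<Phi> \<Psi>. \<Phi> \<in> fock_level n \<Longrightarrow> \<Psi> \<in> fock_level n \<Longrightarrow> P \<Phi> \<Longrightarrow> P \<Psi> \<Longrightarrow> P (\<Phi> + \<Psi>)"
    and s: "\<And>c \<Phi>. \<Phi> \<in> fock_level n \<Longrightarrow> P \<Phi> \<Longrightarrow> P (cscale c \<Phi>)"
    and l: "\<And>f \<Phi>. (\<And>k. f k \<in> fock_level n) \<Longrightarrow> (\<And>k. P (f k)) \<Longrightarrow> f \<longlonglongrightarrow> \<Phi> \<Longrightarrow> \<Phi> \<in> fock_level n \<Longrightarrow> P \<Phi>"
  shows "P \<Phi>"
proof -
  \<comment> \<open>There is no case for zero; it arises as the zero multiple of a tensor.\<close>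
  have z: "P 0"
  proof -
    have "P (cscale 0 (sym_tensor (replicate n 0)))" by (intro s t fock_level_sym_tensor) simp_all
    moreover have "cscale 0 (sym_tensor (replicate n (0::'x))) = 0"
      by (rule fock_eqI) (simp add: cscale.rep_eq zero_fock.rep_eq)
    ultimately show ?thesis by simp
  qed
  have *: "P (\<Sum>xs\<in>A. cscale (c xs) (sym_tensor xs)) \<and> (\<Sum>xs\<in>A. cscale (c xs) (sym_tensor xs)) \<in> fock_level n"
    if "finite A" "\<And>xs. xs \<in> A \<Longrightarrow> length xs = n" for A c
    using that
  proof (induction A rule: finite_induct)
    case (insert x A)
    then show ?case
      by (simp add: a s t fock_level_add fock_level_cscale fock_level_sym_tensor)
  qed (simp add: z fock_level_zero)
  have "\<exists>\<Psi>. \<Psi> \<in> fock_level n \<and> P \<Psi> \<and> dist \<Psi> \<Phi> < e" if e: "e > 0" for e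
  proof -
    obtain A where A: "finite A" "A \<subseteq> lists onb"
      "\<And>\<Psi>. (\<And>xs. form_of \<Psi> xs = form_of \<Phi> xs \<or> xs \<notin> A \<and> (xs \<in> lists onb \<longrightarrow> form_of \<Psi> xs = 0)) \<Longrightarrow> dist \<Psi> \<Phi> < e"
      using norm_diff_fock_lt[OF e, of \<Phi>] by blast
    \<comment> \<open>\<open>B\<close> collects the letters of the words in \<open>A\<close>. All
      words of length \<open>n\<close> over \<open>B\<close> are used instead of \<open>A\<close>,
      because a symmetric truncation needs a set of words closed under rearrangement.\<close>
    define B where "B = (\<Union>xs\<in>A. set xs)"
    have B: "finite B" "B \<subseteq> onb" using A(1,2) by (auto simp: B_def in_lists_conv_set)
    let ?A = "{xs. set xs \<subseteq> B \<and> length xs = n}"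
    define \<Psi>0 where "\<Psi>0 = (\<Sum>xs\<in>?A. cscale (form_of \<Phi> xs) (sym_tensor xs))"
    have \<Psi>0: "P \<Psi>0" "\<Psi>0 \<in> fock_level n"
      unfolding \<Psi>0_def using *[OF finite_lists_length_eq[OF B(1), of n], of "form_of \<Phi>"] by simp_all
    have f: "form_of \<Psi>0 ys = (if set ys \<subseteq> B \<and> length ys = n then form_of \<Phi> ys else 0)" if "ys \<in> lists onb" for ys
      unfolding \<Psi>0_def using sum_form_tensor_form[OF B that, of \<Phi> n]
      by (simp add: form_of_sum cscale.rep_eq sym_tensor.rep_eq)
    have "dist \<Psi>0 \<Phi> < e"
    proof -
      show ?thesis
      proof (rule A(3))
        fix ys
        show "form_of \<Psi>0 ys = form_of \<Phi> ys \<or> ys \<notin> A \<and> (ys \<in> lists onb \<longrightarrow> form_of \<Psi>0 ys = 0)"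
        proof (cases "ys \<in> A")
          case True
          then have "set ys \<subseteq> B" "ys \<in> lists onb" using A(2) by (auto simp: B_def)
          then show ?thesis using f[of ys] \<Phi> by (auto simp: fock_level_def)
        qed (use f in auto)
      qed
    qed
    then show ?thesis using \<Psi>0 by blast
  qed
  then have "\<forall>k. \<exists>\<Psi>. \<Psi> \<in> fock_level n \<and> P \<Psi> \<and> dist \<Psi> \<Phi> < 1 / Suc k" by simp
  then obtain f where f: "\<And>k. f k \<in> fock_level n" "\<And>k. P (f k)" "\<And>k. dist (f k) \<Phi> < 1 / Suc k"
    by metis
  have "f \<longlonglongrightarrow> \<Phi>"
  proof (rule metric_LIMSEQ_I)
    fix e :: real assume "e > 0"
    then obtain N where N: "1 / Suc N < e" by (meson nat_approx_posE)
    have "dist (f k) \<Phi> < e" if "k \<ge> N" for k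
    proof -
      have "1 / real (Suc k) \<le> 1 / Suc N" using that by (simp add: frac_le)
      then show ?thesis using f(3)[of k] N by linarith
    qed
    then show "\<exists>N. \<forall>k\<ge>N. dist (f k) \<Phi> < e" by blast
  qed
  then show ?thesis using l f \<Phi> by blast
qed

section \<open>The functor \<open>\<F>\<close> on contractions\<close>

text \<open>The condition under which \<open>fock_map A\<close> is precomposition with the adjoint
  and not the default value zero.\<close>

locale contraction =
  fixes A :: "'x::{real_inner, complete_space} \<Rightarrow> 'y::{real_inner, complete_space}"
  assumes bounded_linear: "bounded_linear A"
    and norm_le: "norm (A x) \<le> norm x"
begin

lemma form_of_fock_map: "form_of (fock_map A \<Phi>) ys = form_of \<Phi> (map (adjoint A) ys)"
  by (simp add: fock_map.rep_eq bounded_linear norm_le)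

lemma fock_map_add: "fock_map A (\<Phi> + \<Psi>) = fock_map A \<Phi> + fock_map A \<Psi>"
  by (rule fock_eqI) (simp add: form_of_fock_map plus_fock.rep_eq)

lemma fock_map_cscale: "fock_map A (cscale c \<Phi>) = cscale c (fock_map A \<Phi>)"
  by (rule fock_eqI) (simp add: form_of_fock_map cscale.rep_eq)

lemma fock_map_zero: "fock_map A 0 = 0"
  by (rule fock_eqI) (simp add: form_of_fock_map zero_fock.rep_eq)

lemma fock_map_sum: "fock_map A (sum f S) = (\<Sum>s\<in>S. fock_map A (f s))"
  by (induction S rule: infinite_finite_induct) (simp_all add: fock_map_zero fock_map_add)

lemma fock_map_comp: "fock_map A (fock_comp n \<Phi>) = fock_comp n (fock_map A \<Phi>)"
  by (rule fock_eqI) (simp add: form_of_fock_map fock_comp.rep_eq)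

lemma fock_map_level: "\<Phi> \<in> fock_level n \<Longrightarrow> fock_map A \<Phi> \<in> fock_level n"
  by (simp add: fock_level_def form_of_fock_map)

lemma fock_map_upto: "\<Phi> \<in> fock_upto n \<Longrightarrow> fock_map A \<Phi> \<in> fock_upto n"
  by (simp add: fock_upto_def form_of_fock_map)

lemma fock_map_sym_tensor: "fock_map A (sym_tensor xs) = sym_tensor (map A xs)"
proof (rule fock_eqI)
  fix ys
  have "(\<Prod>i<length xs. complex_of_real (inner (xs ! \<sigma> i) (map (adjoint A) ys ! i)))
     = (\<Prod>i<length xs. complex_of_real (inner (map A xs ! \<sigma> i) (ys ! i)))"
    if "\<sigma> permutes {..<length xs}" "length ys = length xs" for \<sigma>
    using that permutes_in_image[OF that(1)]
    by (intro prod.cong refl) (simp add: inner_adjoint[OF bounded_linear])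
  then show "form_of (fock_map A (sym_tensor xs)) ys = form_of (sym_tensor (map A xs)) ys"
    by (simp add: form_of_fock_map sym_tensor.rep_eq tensor_form_def)
qed

lemma norm_fock_map_le: "norm (fock_map A \<Phi>) \<le> norm \<Phi>"
proof -
  have "bounded_linear (\<lambda>x. form_of \<Phi> (xs @ x # ys))" for xs ys
  proof -
    have "form_of \<Phi> (xs @ x # ys) = form_of \<Phi> (x # xs @ ys)" for x by (rule fock_formsD(1)[OF form_of]) simp
    then show ?thesis using fock_formsD(2)[OF form_of, of \<Phi> "xs @ ys"] by presburger
  qed
  then have "sq_sum n (\<lambda>ys. form_of \<Phi> (map (adjoint A) ys)) \<le> sq_sum n (form_of \<Phi>)" for n
    by (intro sq_sum_map_adjoint bounded_linear norm_le)
  then have "ennreal ((norm (fock_map A \<Phi>))\<^sup>2) \<le> ennreal ((norm \<Phi>)\<^sup>2)"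
    unfolding ennreal_norm_fock_sq form_of_fock_map by (intro suminf_le) auto
  then have "(norm (fock_map A \<Phi>))\<^sup>2 \<le> (norm \<Phi>)\<^sup>2" by (simp only: ennreal_le_iff zero_le_power2)
  then show ?thesis by (rule power2_le_imp_le) simp
qed

lemma bounded_linear_fock_map: "bounded_linear (fock_map A)"
  by (rule bounded_linear_intro[where K = 1])
    (simp_all add: fock_map_add scaleR_fock_eq fock_map_cscale norm_fock_map_le)

text \<open>Dense range passes to tensor powers: \<open>fock_level_induct\<close> reduces to product
  tensors, whose factors are then approximated from \<open>range A\<close> one at a time.\<close>

lemma closure_fock_map_level:
  assumes dense: "closure (range A) = UNIV" and \<Phi>: "\<Phi> \<in> fock_level n"
  shows "\<Phi> \<in> closure (fock_map A ` fock_level n)" (is "_ \<in> closure ?S")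
  using \<Phi>
proof (induction rule: fock_level_induct)
  have S: "subspace (closure ?S)"
    by (intro subspace_closure linear_subspace_image subspace_fock_level
        bounded_linear.linear[OF bounded_linear_fock_map])
  {
    case (tensor xs)
    \<comment> \<open>The factors in \<open>xs\<close> are still arbitrary, while the remaining ones
      are already images under \<open>A\<close>.\<close>
    have "sym_tensor (xs @ map A ys) \<in> closure ?S" if "length xs + length ys = n" for ys
      using that
    proof (induction xs arbitrary: ys)
      case Nil
      then have "sym_tensor (map A ys) \<in> ?S"
        by (intro image_eqI[of _ _ "sym_tensor ys"]) (simp_all add: fock_map_sym_tensor fock_level_sym_tensor)
      then show ?case by (simp add: subsetD[OF closure_subset])
    next
      case (Cons x xs)
      have "closed {x. sym_tensor (x # xs @ map A ys) \<in> closure ?S}"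
        using continuous_closed_vimage[OF closed_closure linear_continuous_at[OF bounded_linear_sym_tensor]]
        unfolding vimage_def .
      moreover have "range A \<subseteq> {x. sym_tensor (x # xs @ map A ys) \<in> closure ?S}"
      proof clarify
        fix y
        have "sym_tensor (xs @ map A (y # ys)) \<in> closure ?S" using Cons by (intro Cons.IH) simp
        moreover have "sym_tensor (xs @ map A (y # ys)) = sym_tensor (A y # xs @ map A ys)"
          by (rule sym_tensor_mset) simp
        ultimately show "sym_tensor (A y # xs @ map A ys) \<in> closure ?S" by simp
      qed
      ultimately have "closure (range A) \<subseteq> {x. sym_tensor (x # xs @ map A ys) \<in> closure ?S}"
        by (rule closure_minimal[rotated])
      then show ?case using dense by auto
    qed
    from this[of "[]"] tensor show ?case by simp
  next
    case (add \<Phi> \<Psi>)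
    then show ?case using S by (simp add: subspace_add)
  next
    case (cscale c \<Phi>)
    \<comment> \<open>Real subspaces say nothing about complex multiples, so these are obtained from
      an approximating sequence.\<close>
    then obtain f where f: "\<And>k. f k \<in> ?S" "f \<longlonglongrightarrow> \<Phi>" by (auto simp: closure_sequential)
    have "cscale c (f k) \<in> ?S" for k
      using f(1)[of k] by (auto simp: fock_level_cscale simp flip: fock_map_cscale)
    moreover have "(\<lambda>k. cscale c (f k)) \<longlonglongrightarrow> cscale c \<Phi>" by (rule bounded_linear.tendsto[OF bounded_linear_cscale f(2)])
    ultimately show ?case unfolding closure_sequential by (intro exI[of _ "\<lambda>k. cscale c (f k)"]) simp
  next
    case (lim f \<Phi>)
    then show ?case using closed_sequentially[OF closed_closure, of f ?S \<Phi>] by simp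
  }
qed

text \<open>A vector orthogonal to the range of the adjoint is killed by \<open>A\<close>, so
  injectivity makes that range dense. A form in the kernel of \<open>fock_map A\<close> vanishes on
  all lists from it, hence everywhere.\<close>

lemma inj_fock_map:
  assumes inj: "inj A"
  shows "inj (fock_map A)"
proof -
  have inj0: "A x = 0 \<Longrightarrow> x = 0" for x
    using inj linear_0[OF bounded_linear.linear[OF bounded_linear]] by (metis injD)
  have lin: "linear (adjoint A)" by (rule bounded_linear.linear[OF bounded_linear_adjoint[OF bounded_linear]])
  have sub: "subspace (range (adjoint A))" by (rule linear_subspace_image[OF lin subspace_UNIV])
  have "closure (range (adjoint A)) = UNIV"
  proof (rule ccontr)
    assume "closure (range (adjoint A)) \<noteq> UNIV"
    then obtain z where z: "z \<noteq> 0" "\<And>c. c \<in> closure (range (adjoint A)) \<Longrightarrow> orthogonal z c"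
      using closed_subspace_orthogonal_exists[OF subspace_closure[OF sub] closed_closure] by blast
    have "inner (A z) y = 0" for y
      using z(2)[of "adjoint A y"] closure_subset[of "range (adjoint A)"]
      by (auto simp: inner_adjoint[OF bounded_linear] orthogonal_def)
    then have "A z = 0" by (metis inner_eq_zero_iff)
    then show False using inj0 z(1) by blast
  qed
  then have total: "closure (span (range (adjoint A))) = UNIV" by (simp only: span_eq_iff[THEN iffD2, OF sub])
  have "\<Phi> = 0" if "fock_map A \<Phi> = 0" for \<Phi>
  proof (rule fock_eqI)
    fix xs
    have "form_of \<Phi> xs = 0"
    proof (rule symmetric_multilinear_vanish[OF _ _ total])
      show "form_of \<Phi> xs = form_of \<Phi> ys" if "mset xs = mset ys" for xs ys by (rule fock_formsD(1)[OF form_of that])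
      show "bounded_linear (\<lambda>x. form_of \<Phi> (x # xs))" for xs by (rule fock_formsD(2)[OF form_of])
      fix xs assume "xs \<in> lists (range (adjoint A))"
      then obtain ys where ys: "xs = map (adjoint A) ys" unfolding lists_image by auto
      show "form_of \<Phi> xs = 0" unfolding ys form_of_fock_map[symmetric] that by (simp add: zero_fock.rep_eq)
    qed
    then show "form_of \<Phi> xs = form_of 0 xs" by (simp add: zero_fock.rep_eq)
  qed
  then show ?thesis
    unfolding linear_injective_0[OF bounded_linear.linear[OF bounded_linear_fock_map]] by blast
qed

end

text \<open>The adjoint of a surjective isometry is its inverse, and \<open>fock_map\<close> of the
  adjoint supplies preimages without raising the degree.\<close>

lemma fock_map_upto_isometry:
  fixes A :: "'x::{real_inner, complete_space} \<Rightarrow> 'y::{real_inner, complete_space}"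
  assumes "bounded_linear A" "\<And>x y. inner (A x) (A y) = inner x y" "surj A"
  shows "fock_map A ` fock_upto n = fock_upto n"
proof -
  have adj: "adjoint A (A x) = x" for x
  proof -
    have "inner y (adjoint A (A x)) = inner y x" for y by (simp add: assms(2) flip: inner_adjoint[OF assms(1)])
    then show ?thesis by (metis vector_eq_ldot)
  qed
  have adj2: "A (adjoint A y) = y" for y using assms(3) adj by (metis surjD)
  have n: "norm (A x) = norm x" for x using assms(2) by (simp add: norm_eq_sqrt_inner)
  have bl: "bounded_linear (adjoint A)" by (rule bounded_linear_adjoint[OF assms(1)])
  interpret A: contraction A by (rule contraction.intro) (simp_all add: assms n)
  have n': "norm (adjoint A y) = norm y" for y by (metis adj2 n)
  interpret A': contraction "adjoint A" by (rule contraction.intro) (simp_all add: bl n')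
  have adj3: "adjoint (adjoint A) = A"
  proof
    fix x
    have "inner y (adjoint (adjoint A) x) = inner y (A x)" for y
      by (metis inner_adjoint[OF bl] inner_adjoint[OF assms(1)] inner_commute)
    then show "adjoint (adjoint A) x = A x" by (metis vector_eq_ldot)
  qed
  have "fock_map A (fock_map (adjoint A) \<Psi>) = \<Psi>" for \<Psi>
    by (rule fock_eqI) (simp add: A.form_of_fock_map A'.form_of_fock_map adj3 adj2 o_def)
  then show ?thesis using A.fock_map_upto A'.fock_map_upto by (auto simp: image_iff) metis
qed

text \<open>The coefficient of a polynomial enters \<open>fock_pairing\<close> antilinearly, whereas
  the operators \<open>V n\<close> are complex linear; this conjugation links the two.\<close>

lift_definition fock_cnj :: "'x::{real_inner, complete_space} fock \<Rightarrow> 'x fock" is "\<lambda>F xs. cnj (F xs)"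
proof (rule fock_formsI)
  fix F :: "'x list \<Rightarrow> complex" assume F: "F \<in> fock_forms"
  show "cnj (F xs) = cnj (F ys)" if "mset xs = mset ys" for xs ys using fock_formsD(1)[OF F that] by simp
  show "bounded_linear (\<lambda>x. cnj (F (x # xs)))" for xs
    by (rule bounded_linear_compose[OF bounded_linear_cnj fock_formsD(2)[OF F]])
  show "(\<lambda>xs. (cmod (cnj (F xs)))\<^sup>2) summable_on lists onb" using fock_formsD(3)[OF F] by simp
qed

lemma fock_cnj_fock_cnj: "fock_cnj (fock_cnj \<Phi>) = \<Phi>"
  by (rule fock_eqI) (simp add: fock_cnj.rep_eq)

lemma fock_cnj_level: "\<Phi> \<in> fock_level n \<Longrightarrow> fock_cnj \<Phi> \<in> fock_level n"
  by (simp add: fock_level_def fock_cnj.rep_eq)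

section \<open>Unitary operators onto \<open>L\<^sup>2\<close>\<close>

lemma L2_class_self: "f \<in> borel_measurable M \<Longrightarrow> f \<in> L2_class M f"
  by (simp add: L2_class_def)

lemma L2_class_eq:
  assumes "g \<in> L2_class M f"
  shows "L2_class M g = L2_class M f"
proof -
  have "AE x in M. g x = f x" using assms by (simp add: L2_class_def)
  then have "AE x in M. (h x = g x) = (h x = f x)" for h by eventually_elim simp
  then have "(AE x in M. h x = g x) \<longleftrightarrow> (AE x in M. h x = f x)" for h by (rule eventually_subst)
  then show ?thesis by (simp add: L2_class_def)
qed

lemma L2_class_functions:
  assumes "g \<in> L2_class M f" "f \<in> L2_functions M"
  shows "g \<in> L2_functions M"
proof -
  have g: "g \<in> borel_measurable M" "AE x in M. g x = f x" using assms by (auto simp: L2_class_def)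
  have f: "f \<in> borel_measurable M" "integrable M (\<lambda>x. (cmod (f x))\<^sup>2)" using assms by (auto simp: L2_functions_def)
  have "integrable M (\<lambda>x. (cmod (g x))\<^sup>2)"
    by (rule integrable_cong_AE_imp[OF f(2)]) (use g f in auto)
  then show ?thesis using g by (simp add: L2_functions_def)
qed

locale L2_unitary =
  fixes M :: "'a measure" and I :: "'x::{real_inner, complete_space} fock \<Rightarrow> ('a \<Rightarrow> complex) set"
  assumes unitary: "unitary_onto_L2 M I"
begin

lemma range_I: "range I = L2 M"
  using unitary by (simp add: unitary_onto_L2_def)

text \<open>A class is determined by any of its members, so \<open>f \<in> I \<Phi>\<close> can be
  read as: \<open>f\<close> represents \<open>I \<Phi>\<close>.\<close>

lemma I_eq: "f \<in> I \<Phi> \<Longrightarrow> f \<in> L2_functions M \<and> I \<Phi> = L2_class M f"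
  using range_I L2_class_eq L2_class_functions unfolding L2_def by (metis imageE rangeI)

lemma I_obtain: obtains f where "f \<in> I \<Phi>"
proof -
  obtain f where "f \<in> L2_functions M" "I \<Phi> = L2_class M f" using range_I unfolding L2_def by (metis imageE rangeI)
  then show ?thesis using that L2_class_self by (auto simp: L2_functions_def)
qed

lemma I_measurable: "f \<in> I \<Phi> \<Longrightarrow> f \<in> borel_measurable M"
  using I_eq by (auto simp: L2_functions_def)

lemma I_AE: "f \<in> I \<Phi> \<Longrightarrow> g \<in> borel_measurable M \<Longrightarrow> AE x in M. g x = f x \<Longrightarrow> g \<in> I \<Phi>"
  using I_eq by (auto simp: L2_class_def)

lemma I_add: "f \<in> I \<Phi> \<Longrightarrow> g \<in> I \<Psi> \<Longrightarrow> (\<lambda>x. f x + g x) \<in> I (\<Phi> + \<Psi>)"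
  and I_cscale: "f \<in> I \<Phi> \<Longrightarrow> (\<lambda>x. c * f x) \<in> I (cscale c \<Phi>)"
  and I_cinner: "f \<in> I \<Phi> \<Longrightarrow> g \<in> I \<Psi> \<Longrightarrow> (\<integral>x. f x * cnj (g x) \<partial>M) = cinner \<Phi> \<Psi>"
  using unitary by (simp_all add: unitary_onto_L2_def)

lemma I_diff: "f \<in> I \<Phi> \<Longrightarrow> g \<in> I \<Psi> \<Longrightarrow> (\<lambda>x. f x - g x) \<in> I (\<Phi> - \<Psi>)"
proof -
  assume "f \<in> I \<Phi>" "g \<in> I \<Psi>"
  then have "(\<lambda>x. f x + -1 * g x) \<in> I (\<Phi> + cscale (-1) \<Psi>)" by (intro I_add I_cscale)
  moreover have "\<Phi> + cscale (-1) \<Psi> = \<Phi> - \<Psi>" using scaleR_fock_eq[of "-1" \<Psi>] by simp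
  ultimately show ?thesis by simp
qed

lemma I_zero: "(\<lambda>x. 0) \<in> I 0"
proof -
  obtain f where "f \<in> I 0" by (rule I_obtain)
  from I_diff[OF this this] show ?thesis by simp
qed

lemma I_sum: "(\<And>s. s \<in> S \<Longrightarrow> f s \<in> I (\<Phi> s)) \<Longrightarrow> (\<lambda>x. \<Sum>s\<in>S. f s x) \<in> I (\<Sum>s\<in>S. \<Phi> s)"
  by (induction S rule: infinite_finite_induct) (simp_all add: I_zero I_add)

lemma integral_norm_sq:
  assumes "f \<in> I \<Phi>"
  shows "integrable M (\<lambda>x. (cmod (f x))\<^sup>2)" "(\<integral>x. (cmod (f x))\<^sup>2 \<partial>M) = (norm \<Phi>)\<^sup>2"
proof -
  show "integrable M (\<lambda>x. (cmod (f x))\<^sup>2)" using I_eq[OF assms] by (simp add: L2_functions_def)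
  have "complex_of_real (\<integral>x. (cmod (f x))\<^sup>2 \<partial>M) = (\<integral>x. f x * cnj (f x) \<partial>M)"
    unfolding complex_norm_square[symmetric] by (rule integral_complex_of_real[symmetric])
  also have "\<dots> = complex_of_real ((norm \<Phi>)\<^sup>2)" unfolding I_cinner[OF assms assms] by (rule cinner_self_norm)
  finally show "(\<integral>x. (cmod (f x))\<^sup>2 \<partial>M) = (norm \<Phi>)\<^sup>2" using of_real_eq_iff by blast
qed

lemma sqrt_integral_diff:
  assumes "f \<in> I \<Phi>" "g \<in> I \<Psi>"
  shows "sqrt (\<integral>x. (cmod (f x - g x))\<^sup>2 \<partial>M) = dist \<Phi> \<Psi>"
  using integral_norm_sq(2)[OF I_diff[OF assms]] by (simp add: dist_fock_def)

text \<open>By Fatou, for a representative \<open>g\<close> of \<open>I \<Psi>\<close> the integral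
  of the squared modulus of \<open>h - g\<close> is at most the limit of the squared distances of
  \<open>\<Phi> k\<close> and \<open>\<Psi>\<close>, which is 0. This carries the formula for
  monomials from product tensors to arbitrary coefficients.\<close>

lemma I_lim:
  assumes f: "\<And>k. f k \<in> I (\<Phi> k)" and \<Phi>: "\<Phi> \<longlonglongrightarrow> \<Psi>"
    and lim: "\<And>x. x \<in> space M \<Longrightarrow> (\<lambda>k. f k x) \<longlonglongrightarrow> h x"
  shows "h \<in> I \<Psi>"
proof -
  obtain g where g: "g \<in> I \<Psi>" by (rule I_obtain)
  have fm: "f k \<in> borel_measurable M" for k by (rule I_measurable[OF f])
  have hm: "h \<in> borel_measurable M" by (rule borel_measurable_LIMSEQ_metric[OF fm lim])
  have gm: "g \<in> borel_measurable M" by (rule I_measurable[OF g])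
  have d: "(\<integral>\<^sup>+x. ennreal ((cmod (f k x - g x))\<^sup>2) \<partial>M) = ennreal ((dist (\<Phi> k) \<Psi>)\<^sup>2)" for k
    using integral_norm_sq[OF I_diff[OF f g], of k] by (subst nn_integral_eq_integral) (auto simp: dist_fock_def)
  have "(\<integral>\<^sup>+x. ennreal ((cmod (h x - g x))\<^sup>2) \<partial>M)
      = (\<integral>\<^sup>+x. liminf (\<lambda>k. ennreal ((cmod (f k x - g x))\<^sup>2)) \<partial>M)"
  proof (rule nn_integral_cong)
    fix x assume "x \<in> space M"
    then have "(\<lambda>k. ennreal ((cmod (f k x - g x))\<^sup>2)) \<longlonglongrightarrow> ennreal ((cmod (h x - g x))\<^sup>2)"
      by (intro tendsto_intros lim)
    then show "ennreal ((cmod (h x - g x))\<^sup>2) = liminf (\<lambda>k. ennreal ((cmod (f k x - g x))\<^sup>2))"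
      by (rule lim_imp_Liminf[OF sequentially_bot, symmetric])
  qed
  also have "\<dots> \<le> liminf (\<lambda>k. \<integral>\<^sup>+x. ennreal ((cmod (f k x - g x))\<^sup>2) \<partial>M)"
    by (rule nn_integral_liminf) (use fm gm in measurable)
  also have "\<dots> = 0"
  proof -
    have "(\<lambda>k. ennreal ((dist (\<Phi> k) \<Psi>)\<^sup>2)) \<longlonglongrightarrow> ennreal ((dist \<Psi> \<Psi>)\<^sup>2)" by (intro tendsto_intros \<Phi>)
    from lim_imp_Liminf[OF sequentially_bot this] show ?thesis by (simp add: d)
  qed
  finally have "(\<integral>\<^sup>+x. ennreal ((cmod (h x - g x))\<^sup>2) \<partial>M) = 0" by simp
  then have "AE x in M. ennreal ((cmod (h x - g x))\<^sup>2) = 0"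
    by (subst (asm) nn_integral_0_iff_AE) (use hm gm in measurable)
  then have "AE x in M. h x = g x" by eventually_elim simp
  then show ?thesis by (rule I_AE[OF g hm])
qed

text \<open>\<open>sqrt_integral_diff\<close> turns distances of representatives into distances in
  the Fock space, and surjectivity of \<open>I\<close> onto \<open>L2 M\<close> provides a preimage
  of each limit class.\<close>

lemma L2_closure_image: "L2_closure M (I ` D) = I ` closure D"
proof (intro equalityI subsetI)
  fix u assume u: "u \<in> L2_closure M (I ` D)"
  then have "u \<in> range I" unfolding range_I by (simp add: L2_closure_def)
  then obtain \<Phi> where \<Phi>: "u = I \<Phi>" by blast
  have "\<exists>\<Psi>\<in>D. dist \<Psi> \<Phi> < e" if "e > 0" for e
  proof -
    obtain \<Psi> f g where "\<Psi> \<in> D" "f \<in> u" "g \<in> I \<Psi>" "sqrt (\<integral>x. (cmod (f x - g x))\<^sup>2 \<partial>M) < e"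
      using u \<open>e > 0\<close> unfolding L2_closure_def by blast
    then show ?thesis using sqrt_integral_diff[of f \<Phi> g \<Psi>] by (auto simp: \<Phi> dist_commute)
  qed
  then have "\<Phi> \<in> closure D" by (simp add: closure_approachable)
  then show "u \<in> I ` closure D" using \<Phi> by simp
next
  fix u assume "u \<in> I ` closure D"
  then obtain \<Phi> where \<Phi>: "u = I \<Phi>" "\<Phi> \<in> closure D" by blast
  have "\<exists>v\<in>I ` D \<inter> L2 M. \<exists>f\<in>u. \<exists>g\<in>v. sqrt (\<integral>x. (cmod (f x - g x))\<^sup>2 \<partial>M) < e" if "e > 0" for e
  proof -
    obtain \<Psi> where \<Psi>: "\<Psi> \<in> D" "dist \<Psi> \<Phi> < e" using \<Phi>(2) \<open>e > 0\<close> by (auto simp: closure_approachable)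
    obtain f where f: "f \<in> I \<Phi>" by (rule I_obtain)
    obtain g where g: "g \<in> I \<Psi>" by (rule I_obtain)
    have "sqrt (\<integral>x. (cmod (f x - g x))\<^sup>2 \<partial>M) < e" using sqrt_integral_diff[OF f g] \<Psi>(2) by (simp add: dist_commute)
    then show ?thesis using \<Psi>(1) f g \<Phi>(1) range_I by (intro bexI[of _ "I \<Psi>"]) auto
  qed
  then show "u \<in> L2_closure M (I ` D)" using range_I \<Phi>(1) by (auto simp: L2_closure_def)
qed

end

text \<open>
  The image \<open>\<sigma>\<close>-algebra is the largest possible one, so for injective \<open>k\<close> every measurable function \<open>h\<close>
  factors through \<open>k\<close>, as \<open>h = (h \<circ> k\<^sup>-\<^sup>1) \<circ> k\<close> with \<open>h \<circ> k\<^sup>-\<^sup>1\<close> measurable.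
\<close>

lemma sets_image_measure:
  assumes "space \<rho> = UNIV"
  shows "sets (image_measure \<rho> k) = {\<Delta>. k -` \<Delta> \<in> sets \<rho>}"
proof -
  have "sigma_algebra UNIV {\<Delta>. k -` \<Delta> \<in> sets \<rho>}"
    unfolding sigma_algebra_iff2 using assms sets.compl_sets[of _ \<rho>]
    by (auto simp: vimage_UN vimage_Diff Compl_eq_Diff_UNIV intro!: sets.countable_UN)
  then show ?thesis by (simp add: image_measure_def sigma_algebra.sigma_sets_eq)
qed

lemma measurable_image_measure:
  assumes "space \<rho> = UNIV"
  shows "k \<in> measurable \<rho> (sigma UNIV {\<Delta>. k -` \<Delta> \<in> sets \<rho>})"
    and "G \<in> borel_measurable (image_measure \<rho> k) \<longleftrightarrow> G \<circ> k \<in> borel_measurable \<rho>"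
proof -
  show "k \<in> measurable \<rho> (sigma UNIV {\<Delta>. k -` \<Delta> \<in> sets \<rho>})"
    by (rule measurable_measure_of) (auto simp: assms)
  show "G \<in> borel_measurable (image_measure \<rho> k) \<longleftrightarrow> G \<circ> k \<in> borel_measurable \<rho>"
    by (simp add: measurable_def sets_image_measure[OF assms] assms)
      (simp add: image_measure_def vimage_comp)
qed

lemma AE_image_measure:
  assumes "space \<rho> = UNIV" "G \<circ> k \<in> borel_measurable \<rho>" "G' \<circ> k \<in> borel_measurable \<rho>"
  shows "(AE x in image_measure \<rho> k. G x = (G' x :: complex)) \<longleftrightarrow> (AE x in \<rho>. G (k x) = G' (k x))"
  unfolding image_measure_def
proof (rule AE_distr_iff[OF measurable_image_measure(1)[OF assms(1)]])
  have "{x \<in> space \<rho>. (G \<circ> k) x = (G' \<circ> k) x} \<in> sets \<rho>" using assms(2,3) by measurable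
  then show "{x \<in> space (sigma UNIV {\<Delta>. k -` \<Delta> \<in> sets \<rho>}). G x = G' x} \<in> sets (sigma UNIV {\<Delta>. k -` \<Delta> \<in> sets \<rho>})"
    using sets_image_measure[OF assms(1), of k] by (simp add: image_measure_def assms(1) vimage_def)
qed

lemma integral_image_measure:
  fixes G :: "'b \<Rightarrow> 'c::{banach, second_countable_topology}"
  assumes "space \<rho> = UNIV" "G \<circ> k \<in> borel_measurable \<rho>"
  shows "(\<integral>x. G x \<partial>image_measure \<rho> k) = (\<integral>x. G (k x) \<partial>\<rho>)"
    and "integrable (image_measure \<rho> k) G \<longleftrightarrow> integrable \<rho> (\<lambda>x. G (k x))"
proof -
  have "G \<in> borel_measurable (sigma UNIV {\<Delta>. k -` \<Delta> \<in> sets \<rho>})"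
    using measurable_image_measure(2)[OF assms(1), of G k] assms(2) by (simp add: image_measure_def)
  then show "(\<integral>x. G x \<partial>image_measure \<rho> k) = (\<integral>x. G (k x) \<partial>\<rho>)"
    "integrable (image_measure \<rho> k) G \<longleftrightarrow> integrable \<rho> (\<lambda>x. G (k x))"
    unfolding image_measure_def using measurable_image_measure(1)[OF assms(1), of k]
    by (simp_all add: integral_distr integrable_distr_eq)
qed

lemma L2_functions_image_measure:
  assumes "space \<rho> = UNIV"
  shows "G \<in> L2_functions (image_measure \<rho> k) \<longleftrightarrow> G \<circ> k \<in> L2_functions \<rho>"
proof (cases "G \<circ> k \<in> borel_measurable \<rho>")
  case True
  then have "(\<lambda>x. (cmod ((G \<circ> k) x))\<^sup>2) \<in> borel_measurable \<rho>" by measurable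
  then have "(\<lambda>x. (cmod (G x))\<^sup>2) \<circ> k \<in> borel_measurable \<rho>" by (simp add: o_def)
  then show ?thesis
    using integral_image_measure(2)[OF assms, of "\<lambda>x. (cmod (G x))\<^sup>2" k] True
    by (simp add: L2_functions_def measurable_image_measure(2)[OF assms])
qed (simp add: L2_functions_def measurable_image_measure(2)[OF assms])

lemma L2_class_image_measure:
  assumes "space \<rho> = UNIV" "G \<circ> k \<in> borel_measurable \<rho>"
  shows "G' \<in> L2_class (image_measure \<rho> k) G \<longleftrightarrow> G' \<circ> k \<in> L2_class \<rho> (G \<circ> k)"
  using AE_image_measure[OF assms(1) _ assms(2), of G']
  by (auto simp: L2_class_def measurable_image_measure(2)[OF assms(1)])

lemma L2_pullback_class:
  assumes "space \<rho> = UNIV" "G \<circ> k \<in> borel_measurable \<rho>"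
  shows "L2_pullback \<rho> k (L2_class (image_measure \<rho> k) G) = L2_class \<rho> (G \<circ> k)"
proof -
  have "G \<in> L2_class (image_measure \<rho> k) G"
    by (rule L2_class_self) (simp add: measurable_image_measure(2) assms)
  moreover have "L2_class \<rho> (G' \<circ> k) = L2_class \<rho> (G \<circ> k)" if "G' \<in> L2_class (image_measure \<rho> k) G" for G'
    using L2_class_eq that L2_class_image_measure[OF assms] by blast
  ultimately show ?thesis unfolding L2_pullback_def by blast
qed

text \<open>Almost everywhere equality can be tested after composition with \<open>k\<close>, so the
  pullback is injective on classes; with the explicit preimage \<open>G0\<close> this makes
  \<open>inv_into\<close> a true inverse at the class of \<open>h\<close>.\<close>

lemma mem_inv_L2_pullback:
  assumes sp: "space \<rho> = UNIV" and k: "inj k" and h: "h \<in> L2_functions \<rho>"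
  shows "G \<in> inv_into (L2 (image_measure \<rho> k)) (L2_pullback \<rho> k) (L2_class \<rho> h) \<longleftrightarrow> G \<circ> k \<in> L2_class \<rho> h"
proof -
  let ?M = "image_measure \<rho> k"
  \<comment> \<open>Off the range of \<open>k\<close> the values of \<open>inv k\<close> are
    arbitrary, which is harmless: measurability and classes for the image measure depend on the
    composition with \<open>k\<close> only.\<close>
  define G0 where "G0 = h \<circ> inv k"
  have G0: "G0 \<circ> k = h" using k by (simp add: G0_def o_assoc[symmetric])
  have hm: "h \<in> borel_measurable \<rho>" using h by (simp add: L2_functions_def)
  have u: "L2_class ?M G0 \<in> L2 ?M" "L2_pullback \<rho> k (L2_class ?M G0) = L2_class \<rho> h"
    using h hm L2_functions_image_measure[OF sp, of G0 k] L2_pullback_class[OF sp, of G0 k] G0 by (auto simp: L2_def)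
  have "inv_into (L2 ?M) (L2_pullback \<rho> k) (L2_class \<rho> h) = L2_class ?M G0"
  proof -
    have "inj_on (L2_pullback \<rho> k) (L2 ?M)"
    proof (rule inj_onI)
      fix u v assume "u \<in> L2 ?M" "v \<in> L2 ?M" and eq: "L2_pullback \<rho> k u = L2_pullback \<rho> k v"
      then obtain F G where F: "F \<in> L2_functions ?M" "u = L2_class ?M F" and G: "G \<in> L2_functions ?M" "v = L2_class ?M G"
        by (auto simp: L2_def)
      have m: "F \<circ> k \<in> borel_measurable \<rho>" "G \<circ> k \<in> borel_measurable \<rho>"
        using F G measurable_image_measure(2)[OF sp] by (auto simp: L2_functions_def)
      then have "L2_class \<rho> (F \<circ> k) = L2_class \<rho> (G \<circ> k)" using eq F G by (simp add: L2_pullback_class[OF sp])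
      then show "u = v" unfolding F(2) G(2) using L2_class_image_measure[OF sp] m by blast
    qed
    then show ?thesis using u by (metis inv_into_f_f)
  qed
  then show ?thesis using L2_class_image_measure[OF sp, of G0 k G] hm G0 by simp
qed

text \<open>The membership criterion reduces each clause of unitarity to the corresponding clause
  for \<open>I\<close>, by composing representatives with \<open>k\<close> and changing variables in
  the integral.\<close>

lemma (in L2_unitary) image_unitary:
  assumes sp: "space M = UNIV" and k: "inj k"
  defines "I' \<equiv> inv_into (L2 (image_measure M k)) (L2_pullback M k) \<circ> I"
  shows "G \<in> I' \<Phi> \<longleftrightarrow> G \<circ> k \<in> I \<Phi>" and "L2_unitary (image_measure M k) I'"
proof -
  let ?M = "image_measure M k"
  have mem: "G \<in> I' \<Phi> \<longleftrightarrow> G \<circ> k \<in> I \<Phi>" for G \<Phi>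
  proof -
    obtain h where "h \<in> I \<Phi>" by (rule I_obtain)
    then show ?thesis using mem_inv_L2_pullback[OF sp k, of h G] I_eq[of h \<Phi>] by (simp add: I'_def)
  qed
  then show "G \<in> I' \<Phi> \<longleftrightarrow> G \<circ> k \<in> I \<Phi>" .
  have cl: "I' \<Phi> = L2_class ?M G" if "G \<circ> k \<in> I \<Phi>" for G \<Phi>
    using L2_class_image_measure[OF sp I_measurable[OF that]] I_eq[OF that] mem by blast
  have "range I' = L2 ?M"
  proof (intro equalityI subsetI)
    fix u assume "u \<in> range I'"
    then obtain \<Phi> where u: "u = I' \<Phi>" by blast
    obtain h where h: "h \<in> I \<Phi>" by (rule I_obtain)
    have "(h \<circ> inv k) \<circ> k = h" using k by (simp add: o_assoc[symmetric])
    then show "u \<in> L2 ?M"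
      using cl[of "h \<circ> inv k" \<Phi>] h u I_eq[OF h] L2_functions_image_measure[OF sp, of "h \<circ> inv k" k] by (auto simp: L2_def)
  next
    fix u assume "u \<in> L2 ?M"
    then obtain G where G: "G \<in> L2_functions ?M" "u = L2_class ?M G" by (auto simp: L2_def)
    have "G \<circ> k \<in> L2_functions M" using G L2_functions_image_measure[OF sp] by blast
    then have "L2_class M (G \<circ> k) \<in> range I" "G \<circ> k \<in> L2_class M (G \<circ> k)"
      unfolding range_I by (auto simp: L2_def L2_functions_def intro!: L2_class_self)
    then obtain \<Phi> where "G \<circ> k \<in> I \<Phi>" by blast
    then show "u \<in> range I'" using cl G(2) by blast
  qed
  moreover have "(\<lambda>x. f x + g x) \<in> I' (\<Phi> + \<Psi>)" if "f \<in> I' \<Phi>" "g \<in> I' \<Psi>" for f g \<Phi> \<Psi>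
    using I_add[of "f \<circ> k" \<Phi> "g \<circ> k" \<Psi>] that unfolding mem by (simp add: o_def)
  moreover have "(\<lambda>x. c * f x) \<in> I' (cscale c \<Phi>)" if "f \<in> I' \<Phi>" for f c \<Phi>
    using I_cscale[of "f \<circ> k" \<Phi> c] that unfolding mem by (simp add: o_def)
  moreover have "(\<integral>x. f x * cnj (g x) \<partial>?M) = cinner \<Phi> \<Psi>" if "f \<in> I' \<Phi>" "g \<in> I' \<Psi>" for f g \<Phi> \<Psi>
  proof -
    have fg: "f \<circ> k \<in> I \<Phi>" "g \<circ> k \<in> I \<Psi>" using that by (simp_all add: mem)
    have "(\<lambda>x. cnj ((g \<circ> k) x)) \<in> borel_measurable M"
      by (rule measurable_compose[OF I_measurable[OF fg(2)] borel_measurable_continuous_onI]) (intro continuous_intros)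
    then have "(\<lambda>x. (f \<circ> k) x * cnj ((g \<circ> k) x)) \<in> borel_measurable M"
      by (rule borel_measurable_times[OF I_measurable[OF fg(1)]])
    then have "(\<integral>x. f x * cnj (g x) \<partial>?M) = (\<integral>x. f (k x) * cnj (g (k x)) \<partial>M)"
      by (intro integral_image_measure(1) sp) (simp add: o_def)
    then show ?thesis using I_cinner[OF fg] by simp
  qed
  ultimately show "L2_unitary ?M I'" by (simp add: L2_unitary_def unitary_onto_L2_def)
qed

section \<open>Riggings\<close>

lemma rigging_riesz:
  assumes "rigging \<iota> j p"
  shows "inner (riesz p \<xi>) x = p \<xi> x"
proof -
  have "bounded_linear (p \<xi>)" using assms by (simp add: rigging_def)
  then obtain v where v: "\<And>x. p \<xi> x = inner v x" using riesz_representation by blast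
  have "riesz p \<xi> = v" unfolding riesz_def by (rule the_equality) (auto simp: v, metis vector_eq_rdot)
  then show ?thesis by (simp add: v)
qed

lemma rigging_bound:
  assumes "rigging \<iota> j p"
  shows "\<bar>p \<xi> x\<bar> \<le> norm \<xi> * norm x"
  using onorm[of "p \<xi>" x] assms by (simp add: rigging_def)

lemma rigging_linear: "rigging \<iota> j p \<Longrightarrow> linear (\<lambda>\<xi>. p \<xi> x)"
  by (simp add: rigging_def)

lemma rigging_eqI:
  assumes "rigging \<iota> j p" "\<And>x. p \<xi> x = p \<xi>' x"
  shows "\<xi> = \<xi>'"
proof -
  have "p (\<xi> - \<xi>') x = 0" for x using linear_diff[OF rigging_linear[OF assms(1)]] assms(2) by simp
  then have "onorm (p (\<xi> - \<xi>')) = 0" by (simp add: onorm_eq_0 onorm_def)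
  then show ?thesis using assms(1) by (simp add: rigging_def)
qed

text \<open>Testing \<open>p \<xi>\<close> on its own Riesz vector gives the norm bound. Being a
  contraction, \<open>riesz p\<close> makes the \<open>fock_map\<close> inside
  \<open>fock_pairing\<close> the genuine functor.\<close>

lemma contraction_riesz:
  assumes r: "rigging \<iota> j p"
  shows "contraction (riesz p)"
proof -
  note i = rigging_riesz[OF r] and l = rigging_linear[OF r]
  have n: "norm (riesz p \<xi>) \<le> norm \<xi>" for \<xi>
  proof -
    have "norm (riesz p \<xi>) * norm (riesz p \<xi>) = p \<xi> (riesz p \<xi>)"
      by (simp add: i[symmetric] power2_norm_eq_inner[symmetric] power2_eq_square)
    also have "\<dots> \<le> norm \<xi> * norm (riesz p \<xi>)" using rigging_bound[OF r, of \<xi> "riesz p \<xi>"] by simp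
    finally show ?thesis by (cases "riesz p \<xi> = 0") simp_all
  qed
  have "bounded_linear (riesz p)"
  proof (rule bounded_linear_intro[where K = 1])
    show "riesz p (\<xi> + \<eta>) = riesz p \<xi> + riesz p \<eta>" for \<xi> \<eta>
      by (rule vector_eq_rdot[THEN iffD1]) (simp add: inner_add_left i linear_add[OF l])
    show "riesz p (c *\<^sub>R \<xi>) = c *\<^sub>R riesz p \<xi>" for c \<xi>
      by (rule vector_eq_rdot[THEN iffD1]) (simp add: i linear_scale[OF l])
  qed (simp add: n)
  then show ?thesis using n by (rule contraction.intro)
qed

text \<open>The reproducing property, applied after the Riesz isometry, turns pairings into
  evaluations of forms, and so monomials into evaluations on constant lists.\<close>

lemma fock_pairing_sym_tensor:
  assumes "rigging \<iota> j p"
  shows "fock_pairing p (sym_tensor \<xi>s) \<Phi> = form_of (fock_cnj \<Phi>) (map (riesz p) \<xi>s)"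
proof -
  interpret contraction "riesz p" by (rule contraction_riesz[OF assms])
  show ?thesis unfolding fock_pairing_def fock_map_sym_tensor
    by (subst cinner_commute) (simp add: cinner_sym_tensor fock_cnj.rep_eq)
qed

section \<open>Jacobi fields\<close>

lemma op_app_eq: "single_valued A \<Longrightarrow> (\<Phi>, \<Psi>) \<in> A \<Longrightarrow> op_app A \<Phi> = \<Psi>"
  unfolding op_app_def by (rule the_equality) (auto dest: single_valuedD)

text \<open>Two values at the same vector differ by an element of level \<open>n\<close> that is
  orthogonal to the domain, hence to its closure, hence to itself.\<close>

lemma single_valued_op_adjoint:
  assumes dense: "fock_level n \<subseteq> closure (Domain A)"
  shows "single_valued (op_adjoint (fock_level n) Y A)"
proof (rule single_valuedI)
  fix \<Psi> \<Phi>1 \<Phi>2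
  assume 1: "(\<Psi>, \<Phi>1) \<in> op_adjoint (fock_level n) Y A" and 2: "(\<Psi>, \<Phi>2) \<in> op_adjoint (fock_level n) Y A"
  have lev: "\<Phi>1 - \<Phi>2 \<in> fock_level n"
    using 1 2 by (auto simp: op_adjoint_def intro: subspace_diff[OF subspace_fock_level])
  have d: "cinner \<Phi> (\<Phi>1 - \<Phi>2) = cinner \<Phi> \<Phi>1 - cinner \<Phi> \<Phi>2" for \<Phi>
    using cinner_add_right[of \<Phi> "\<Phi>1 - \<Phi>2" \<Phi>2] by simp
  have "Domain A \<subseteq> {\<Phi>. cinner \<Phi> (\<Phi>1 - \<Phi>2) = 0}"
    using 1 2 by (fastforce simp: op_adjoint_def d)
  moreover have "closed {\<Phi>. cinner \<Phi> (\<Phi>1 - \<Phi>2) = 0}"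
    by (intro closed_Collect_eq linear_continuous_on bounded_linear_cinner_left continuous_on_const)
  ultimately have "closure (Domain A) \<subseteq> {\<Phi>. cinner \<Phi> (\<Phi>1 - \<Phi>2) = 0}" by (rule closure_minimal)
  then have "cinner (\<Phi>1 - \<Phi>2) (\<Phi>1 - \<Phi>2) = 0" using dense lev by blast
  then show "\<Phi>1 = \<Phi>2" by (simp add: cinner_self_eq_0)
qed

locale jacobi = contraction \<iota> for \<iota> :: "'p::{real_inner, complete_space} \<Rightarrow> 'h::{real_inner, complete_space}" +
  fixes a b :: "nat \<Rightarrow> 'p \<Rightarrow> 'h fock_op"
  assumes dense_range: "closure (range \<iota>) = UNIV" and inj: "inj \<iota>"
    and jacobi_field: "jacobi_field \<iota> a b"
begin

lemmas field = jacobi_field[unfolded jacobi_field_def]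

lemma single_valued_ops:
  "single_valued (a n \<phi>)" "single_valued (b n \<phi>)" "single_valued (annihilation a n \<phi>)"
proof -
  have *: "is_operator (fock_level n) (fock_level (Suc n)) (a n \<phi>)"
    "is_operator (fock_level n) (fock_level n) (b n \<phi>)" "fock_map \<iota> ` fock_level n \<subseteq> Domain (a n \<phi>)"
    using field[THEN conjunct1] by auto
  then show "single_valued (a n \<phi>)" "single_valued (b n \<phi>)" by (auto simp: is_operator_def)
  show "single_valued (annihilation a n \<phi>)"
    using closure_fock_map_level[OF dense_range] closure_mono[OF *(3)] by (intro single_valued_op_adjoint) blast
qed

text \<open>Needed to see that applying a Jacobi operator to a finite vector leaves the high
  components zero.\<close>

lemma op_app_ops_zero: "op_app (a n \<phi>) 0 = 0" "op_app (b n \<phi>) 0 = 0" "op_app (annihilation a n \<phi>) 0 = 0"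
proof -
  have "is_operator (fock_level n) (fock_level (Suc n)) (a n \<phi>)" "is_operator (fock_level n) (fock_level n) (b n \<phi>)"
    using field[THEN conjunct1] by auto
  then show "op_app (a n \<phi>) 0 = 0" "op_app (b n \<phi>) 0 = 0"
    using single_valued_ops by (auto simp: is_operator_def intro!: op_app_eq)
  have "cinner \<Phi> 0 = 0" for \<Phi> :: "'h fock" by (simp add: cinner_def zero_fock.rep_eq)
  then have "(0, 0) \<in> annihilation a n \<phi>" by (simp add: op_adjoint_def fock_level_zero)
  then show "op_app (annihilation a n \<phi>) 0 = 0" by (rule op_app_eq[OF single_valued_ops(3)])
qed

lemma op_app_range:
  assumes "acts_continuously \<iota> m n A" "single_valued A" "\<Phi> \<in> fock_level m"
  shows "\<exists>\<Psi>\<in>fock_level n. op_app A (fock_map \<iota> \<Phi>) = fock_map \<iota> \<Psi>"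
  using assms op_app_eq unfolding acts_continuously_def by blast

text \<open>Each term of the three-term formula stays in the image of \<open>\<F>(H\<^sub>+)\<close>
  because the operators act within it, and for an argument of degree at most \<open>N\<close> only
  the components up to \<open>Suc N\<close> can be nonzero.\<close>

lemma jacobi_op_fin:
  assumes "\<Phi> \<in> fock_fin"
  shows "\<exists>\<Psi>\<in>fock_fin. (fock_map \<iota> \<Phi>, fock_map \<iota> \<Psi>) \<in> jacobi_op \<iota> a b \<phi>"
proof -
  obtain N where N: "\<Phi> \<in> fock_upto N" using assms by (auto simp: fock_fin_def)
  \<comment> \<open>The \<open>n\<close>-th component that the value of the Jacobi operator must
    have.\<close>
  define R where "R = (\<lambda>n. (if n = 0 then 0 else op_app (a (n - 1) \<phi>) (fock_comp (n - 1) (fock_map \<iota> \<Phi>))) +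
           op_app (b n \<phi>) (fock_comp n (fock_map \<iota> \<Phi>)) +
           op_app (annihilation a n \<phi>) (fock_comp (Suc n) (fock_map \<iota> \<Phi>)))"
  have acts: "acts_continuously \<iota> n (Suc n) (a n \<phi>)" "acts_continuously \<iota> n n (b n \<phi>)"
    "acts_continuously \<iota> (Suc n) n (annihilation a n \<phi>)" for n
    using field[THEN conjunct2, THEN conjunct2, THEN conjunct1] by blast+
  have "\<exists>\<Psi>\<in>fock_level n. R n = fock_map \<iota> \<Psi>" for n
  proof -
    have "\<exists>\<Psi>\<in>fock_level n. (if n = 0 then 0 else op_app (a (n - 1) \<phi>) (fock_comp (n - 1) (fock_map \<iota> \<Phi>))) = fock_map \<iota> \<Psi>"
    proof (cases n)
      case 0
      then show ?thesis using fock_level_zero by (intro bexI[of _ 0]) (auto simp: fock_map_zero)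
    next
      case (Suc m)
      then show ?thesis
        using op_app_range[OF acts(1) single_valued_ops(1) fock_level_comp, of m \<Phi>] by (simp add: fock_map_comp)
    qed
    moreover have "\<exists>\<Psi>\<in>fock_level n. op_app (b n \<phi>) (fock_comp n (fock_map \<iota> \<Phi>)) = fock_map \<iota> \<Psi>"
      using op_app_range[OF acts(2) single_valued_ops(2) fock_level_comp, of n \<Phi>] by (simp add: fock_map_comp)
    moreover have "\<exists>\<Psi>\<in>fock_level n. op_app (annihilation a n \<phi>) (fock_comp (Suc n) (fock_map \<iota> \<Phi>)) = fock_map \<iota> \<Psi>"
      using op_app_range[OF acts(3) single_valued_ops(3) fock_level_comp, of n \<Phi>] by (simp add: fock_map_comp)
    ultimately obtain \<Psi>1 \<Psi>2 \<Psi>3 where \<Psi>: "\<Psi>1 \<in> fock_level n" "\<Psi>2 \<in> fock_level n" "\<Psi>3 \<in> fock_level n"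
      and "R n = fock_map \<iota> \<Psi>1 + fock_map \<iota> \<Psi>2 + fock_map \<iota> \<Psi>3" unfolding R_def by force
    then have "R n = fock_map \<iota> (\<Psi>1 + \<Psi>2 + \<Psi>3)" by (simp add: fock_map_add)
    then show ?thesis using \<Psi> by (blast intro: fock_level_add)
  qed
  then have "\<forall>n. \<exists>\<Psi>. \<Psi> \<in> fock_level n \<and> R n = fock_map \<iota> \<Psi>" by blast
  from choice[OF this] obtain t where t: "\<And>n. t n \<in> fock_level n" "\<And>n. R n = fock_map \<iota> (t n)" by blast
  \<comment> \<open>The bound is \<open>Suc N\<close> because creation raises the degree by
    one.\<close>
  define \<Psi> where "\<Psi> = (\<Sum>m\<le>Suc N. t m)"
  have "R n = 0" if "Suc N < n" for n
    using that fock_comp_upto[OF fock_map_upto[OF N]] by (simp add: R_def op_app_ops_zero)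
  moreover have "fock_comp n \<Psi> = (if n \<le> Suc N then t n else 0)" for n
  proof (rule fock_eqI)
    fix xs
    have "form_of (fock_comp n \<Psi>) xs = (if length xs = n then \<Sum>m\<le>Suc N. form_of (t m) xs else 0)"
      by (simp add: fock_comp.rep_eq \<Psi>_def form_of_sum del: sum.atMost_Suc)
    also have "(\<Sum>m\<le>Suc N. form_of (t m) xs) = (\<Sum>m\<le>Suc N. if m = length xs then form_of (t m) xs else 0)"
      using t(1) by (intro sum.cong) (auto simp: fock_level_def)
    also have "\<dots> = (if length xs \<le> Suc N then form_of (t (length xs)) xs else 0)" by (simp del: sum.atMost_Suc)
    finally show "form_of (fock_comp n \<Psi>) xs = form_of (if n \<le> Suc N then t n else 0) xs"
      using t(1)[of n] by (auto simp: zero_fock.rep_eq fock_level_def)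
  qed
  ultimately have "fock_comp n (fock_map \<iota> \<Psi>) = R n" for n
    by (simp add: t(2) fock_map_zero flip: fock_map_comp)
  then have "(fock_map \<iota> \<Phi>, fock_map \<iota> \<Psi>) \<in> jacobi_op \<iota> a b \<phi>"
    using assms by (auto simp: jacobi_op_def R_def)
  moreover have "\<Psi> \<in> fock_upto (Suc N)"
    unfolding \<Psi>_def using t(1) fock_level_upto by (intro subspace_sum[OF subspace_fock_upto]) auto
  ultimately show ?thesis unfolding fock_fin_def by blast
qed

text \<open>The components determine the value in \<open>\<F>(H)\<close>, and
  \<open>fock_map \<iota>\<close> is injective, so the description in \<open>plus_app\<close> picks
  out a unique vector.\<close>

lemma plus_app_jacobi_op:
  assumes "\<Phi> \<in> fock_fin"
  shows "plus_app \<iota> (jacobi_op \<iota> a b \<phi>) \<Phi> \<in> fock_fin"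
    and "(fock_map \<iota> \<Phi>, fock_map \<iota> (plus_app \<iota> (jacobi_op \<iota> a b \<phi>) \<Phi>)) \<in> jacobi_op \<iota> a b \<phi>"
proof -
  obtain \<Psi> where \<Psi>: "\<Psi> \<in> fock_fin" "(fock_map \<iota> \<Phi>, fock_map \<iota> \<Psi>) \<in> jacobi_op \<iota> a b \<phi>"
    using jacobi_op_fin[OF assms] by blast
  have "\<Psi>' = \<Psi>" if "(fock_map \<iota> \<Phi>, fock_map \<iota> \<Psi>') \<in> jacobi_op \<iota> a b \<phi>" for \<Psi>'
  proof -
    have c: "fock_comp n (fock_map \<iota> \<Psi>') = fock_comp n (fock_map \<iota> \<Psi>)" for n
      using that \<Psi>(2) by (simp add: jacobi_op_def)
    have "fock_map \<iota> \<Psi>' = fock_map \<iota> \<Psi>"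
    proof (rule fock_eqI)
      fix xs
      have "form_of (fock_comp (length xs) (fock_map \<iota> \<Psi>')) xs = form_of (fock_comp (length xs) (fock_map \<iota> \<Psi>)) xs"
        by (simp only: c)
      then show "form_of (fock_map \<iota> \<Psi>') xs = form_of (fock_map \<iota> \<Psi>) xs" by (simp add: fock_comp.rep_eq)
    qed
    then show ?thesis by (rule injD[OF inj_fock_map[OF inj]])
  qed
  then have "plus_app \<iota> (jacobi_op \<iota> a b \<phi>) \<Phi> = \<Psi>" unfolding plus_app_def using \<Psi>(2) by blast
  with \<Psi> show "plus_app \<iota> (jacobi_op \<iota> a b \<phi>) \<Phi> \<in> fock_fin"
    "(fock_map \<iota> \<Phi>, fock_map \<iota> (plus_app \<iota> (jacobi_op \<iota> a b \<phi>) \<Phi>)) \<in> jacobi_op \<iota> a b \<phi>" by simp_all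
qed

end

section \<open>The Fourier transform of a Jacobi field\<close>

locale jacobi_fourier =
  fixes \<iota> :: "'p::{real_inner, complete_space} \<Rightarrow> 'h::{real_inner, complete_space}"
    and j :: "'h \<Rightarrow> 'm::{real_inner, complete_space}" and p a b \<rho> P I
  assumes rigging: "rigging \<iota> j p" and norm_le: "\<And>\<phi>. norm (\<iota> \<phi>) \<le> norm \<phi>"
    and jacobi_field: "jacobi_field \<iota> a b"
    and fourier_transform: "fourier_transform \<iota> p a b \<rho> P I"
begin

sublocale jacobi \<iota> a b
  using rigging norm_le jacobi_field by (auto simp: rigging_def jacobi_def jacobi_axioms_def contraction_def)

sublocale L2_unitary \<rho> I
  using fourier_transform by (simp add: fourier_transform_def L2_unitary_def)

lemma sets_eq: "sets \<rho> = sets borel"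
  using fourier_transform by (simp add: fourier_transform_def)

lemma space_eq: "space \<rho> = UNIV"
  using sets_eq_imp_space_eq[OF sets_eq] by simp

lemma measurable_pairing: "(\<lambda>\<xi>. complex_of_real (p \<xi> \<phi>)) \<in> borel_measurable \<rho>"
proof -
  note l = rigging_linear[OF rigging]
  have "bounded_linear (\<lambda>\<xi>. p \<xi> \<phi>)"
    using rigging_bound[OF rigging, of _ \<phi>]
    by (intro bounded_linear_intro[where K = "norm \<phi>"]) (simp_all add: linear_add[OF l] linear_scale[OF l])
  then have "continuous_on UNIV (\<lambda>\<xi>. complex_of_real (p \<xi> \<phi>))"
    by (intro continuous_on_of_real linear_continuous_on)
  then have "(\<lambda>\<xi>. complex_of_real (p \<xi> \<phi>)) \<in> borel_measurable borel" by (rule borel_measurable_continuous_onI)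
  then show ?thesis using measurable_cong_sets[OF sets_eq refl] by blast
qed

lemma fourier_jacobi_op:
  assumes "(\<Phi>, \<Psi>) \<in> jacobi_op \<iota> a b \<phi>" and f: "f \<in> I \<Phi>"
  shows "(\<lambda>\<xi>. complex_of_real (p \<xi> \<phi>) * f \<xi>) \<in> I \<Psi>"
proof -
  have "(\<Phi>, \<Psi>) \<in> closure (jacobi_op \<iota> a b \<phi>)" using assms(1) closure_subset by blast
  \<comment> \<open>The spectral property provides only some representative \<open>g\<close>;
    multiplication by the pairing respects almost everywhere equality, so \<open>f\<close> may take
    its place.\<close>
  then obtain g where g: "g \<in> I \<Phi>" "(\<lambda>\<xi>. complex_of_real (p \<xi> \<phi>) * g \<xi>) \<in> I \<Psi>"
    using fourier_transform by (auto simp: fourier_transform_def)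
  have "g \<in> L2_class \<rho> f" using g(1) I_eq[OF f] by simp
  then have "AE \<xi> in \<rho>. g \<xi> = f \<xi>" by (simp add: L2_class_def)
  then have "AE \<xi> in \<rho>. complex_of_real (p \<xi> \<phi>) * f \<xi> = complex_of_real (p \<xi> \<phi>) * g \<xi>" by eventually_elim simp
  then show ?thesis by (intro I_AE[OF g(2)] borel_measurable_times measurable_pairing I_measurable[OF f])
qed

text \<open>Induction from the normalization of the vacuum, each operator contributing one factor.
  Membership in \<open>fock_fin\<close> is carried along because the next operator is applied
  there.\<close>

lemma fourier_jacobi_ops_vacuum:
  "foldr (\<lambda>\<phi>. plus_app \<iota> (jacobi_op \<iota> a b \<phi>)) \<phi>s vacuum \<in> fock_fin \<and>
   (\<lambda>\<xi>. \<Prod>\<phi>\<leftarrow>\<phi>s. complex_of_real (p \<xi> \<phi>)) \<in> I (fock_map \<iota> (foldr (\<lambda>\<phi>. plus_app \<iota> (jacobi_op \<iota> a b \<phi>)) \<phi>s vacuum))"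
proof (induction \<phi>s)
  case Nil
  have "vacuum \<in> fock_fin" by (auto simp: fock_fin_def fock_upto_def form_of_vacuum)
  moreover have "I (fock_map \<iota> vacuum) = L2_class \<rho> (\<lambda>\<xi>. 1)"
    using fourier_transform by (simp add: fourier_transform_def fock_map_sym_tensor)
  ultimately show ?case using L2_class_self[of "\<lambda>\<xi>. 1 :: complex" \<rho>] by simp
next
  case (Cons \<phi> \<phi>s)
  then show ?case
    using plus_app_jacobi_op[of _ \<phi>] fourier_jacobi_op[OF plus_app_jacobi_op(2)[of _ \<phi>]] by simp
qed

text \<open>
  \<^term>\<open>V n F\<close> is the preimage under the Fourier transform of the monomial \<open>\<xi> \<mapsto> \<langle>F, \<xi>\<^sup>\<otimes>\<^sup>n\<rangle>\<close>, and the
  invertibility of the diagonal of \<open>V\<close> is what makes all of \<open>\<Oplus>\<^sub>j\<^sub>\<le>\<^sub>n \<F>\<^sub>j(H\<^sub>+)\<close> a preimage of polynomials.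
\<close>

lemma polynomial_preimages:
  obtains V :: "nat \<Rightarrow> 'p fock \<Rightarrow> 'p fock" where
    "\<And>n. clinear_on (fock_level n) (V n)" "\<And>n. continuous_on (fock_level n) (V n)"
    "\<And>n. V n ` fock_level n \<subseteq> fock_upto n"
    "\<And>n F. F \<in> fock_level n \<Longrightarrow> (\<lambda>\<xi>. form_of F (replicate n (riesz p \<xi>))) \<in> I (fock_map \<iota> (V n F))"
    "\<And>n \<Psi>. \<Psi> \<in> fock_upto n \<Longrightarrow> \<exists>F. (\<forall>j\<le>n. F j \<in> fock_level j) \<and> \<Psi> = (\<Sum>j\<le>n. V j (F j))"
proof -
  obtain V :: "nat \<Rightarrow> 'p fock \<Rightarrow> 'p fock" where
    V: "\<forall>n. clinear_on (fock_level n) (V n) \<and> continuous_on (fock_level n) (V n) \<and>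
             V n ` fock_level n \<subseteq> fock_upto n \<and>
             (\<forall>\<Phi>\<in>fock_level n. fock_real \<Phi> \<longrightarrow> fock_real (V n \<Phi>))"
    and V0: "\<forall>\<Phi>\<in>fock_level 0. V 0 \<Phi> = \<Phi>"
    and Vt: "\<forall>\<phi>s. \<phi>s \<noteq> [] \<longrightarrow> V (length \<phi>s) (sym_tensor \<phi>s)
             = foldr (\<lambda>\<phi>. plus_app \<iota> (jacobi_op \<iota> a b \<phi>)) \<phi>s vacuum"
    and Vb: "\<forall>n\<ge>1. bij_betw (\<lambda>\<Phi>. fock_comp n (V n \<Phi>)) (fock_level n) (fock_level n)"
    using field by (elim conjE exE) blast
  have lin: "clinear_on (fock_level n) (V n)" and cont: "continuous_on (fock_level n) (V n)"
    and upto: "V n ` fock_level n \<subseteq> fock_upto n" for n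
    using V by auto
  \<comment> \<open>The empty list is covered by the separate condition on
    \<open>V 0\<close>.\<close>
  have Vt': "V (length \<phi>s) (sym_tensor \<phi>s) = foldr (\<lambda>\<phi>. plus_app \<iota> (jacobi_op \<iota> a b \<phi>)) \<phi>s vacuum" for \<phi>s
    using Vt V0 by (cases "\<phi>s = []") (auto simp: fock_level_sym_tensor)
  \<comment> \<open>Product tensors give products of pairings; linearity of \<open>V n\<close>
    extends this to combinations, and its continuity together with \<open>I_lim\<close> to all of
    the level.\<close>
  have mono: "(\<lambda>\<xi>. form_of F (replicate n (riesz p \<xi>))) \<in> I (fock_map \<iota> (V n F))" if "F \<in> fock_level n" for n F
    using that
  proof (induction rule: fock_level_induct)
    case (tensor \<phi>s)
    then have "form_of (sym_tensor \<phi>s) (replicate n (riesz p \<xi>)) = (\<Prod>\<phi>\<leftarrow>\<phi>s. complex_of_real (p \<xi> \<phi>))" for \<xi>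
      using tensor_form_replicate[of \<phi>s "riesz p \<xi>"]
      unfolding inner_commute[of _ "riesz p \<xi>"] rigging_riesz[OF rigging] by (simp add: sym_tensor.rep_eq)
    then show ?case using fourier_jacobi_ops_vacuum[of \<phi>s] Vt'[of \<phi>s] tensor by simp
  next
    case (add \<Phi> \<Psi>)
    then show ?case
      using I_add[OF add.IH] add.hyps lin[of n] by (simp add: clinear_on_def fock_map_add plus_fock.rep_eq)
  next
    case (cscale c \<Phi>)
    then show ?case
      using I_cscale[OF cscale.IH] cscale.hyps lin[of n] by (simp add: clinear_on_def fock_map_cscale cscale.rep_eq)
  next
    case (lim f \<Phi>)
    have "(\<lambda>k. V n (f k)) \<longlonglongrightarrow> V n \<Phi>"
      using cont[of n] lim.hyps unfolding continuous_on_sequentially by (auto simp: o_def)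
    then have "(\<lambda>k. fock_map \<iota> (V n (f k))) \<longlonglongrightarrow> fock_map \<iota> (V n \<Phi>)"
      by (rule bounded_linear.tendsto[OF bounded_linear_fock_map])
    then show ?case using I_lim[OF lim.IH _ tendsto_form_of[OF lim.hyps(2)]] by blast
  qed
  have surj: "\<exists>F. (\<forall>j\<le>n. F j \<in> fock_level j) \<and> \<Psi> = (\<Sum>j\<le>n. V j (F j))" if "\<Psi> \<in> fock_upto n" for n \<Psi>
    using that
  proof (induction n arbitrary: \<Psi>)
    case 0
    then have "\<Psi> \<in> fock_level 0" by (simp add: fock_upto_def fock_level_def)
    then show ?case using V0 by (intro exI[of _ "\<lambda>_. \<Psi>"]) simp
  next
    case (Suc n)
    \<comment> \<open>Invertibility of the diagonal part yields \<open>G\<close> for which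
      \<open>V (Suc n) G\<close> has the same top component as \<open>\<Psi>\<close>; the difference
      has degree at most \<open>n\<close>, and the induction hypothesis applies to it.\<close>
    have "fock_comp (Suc n) \<Psi> \<in> (\<lambda>\<Phi>. fock_comp (Suc n) (V (Suc n) \<Phi>)) ` fock_level (Suc n)"
      using Vb fock_level_comp by (auto simp: bij_betw_def)
    then obtain G where G: "G \<in> fock_level (Suc n)" "fock_comp (Suc n) (V (Suc n) G) = fock_comp (Suc n) \<Psi>" by auto
    have "\<Psi> - V (Suc n) G \<in> fock_upto (Suc n)"
      using upto[of "Suc n"] G(1) Suc.prems by (intro subspace_diff[OF subspace_fock_upto]) auto
    moreover have "form_of (\<Psi> - V (Suc n) G) xs = 0" if "length xs = Suc n" for xs
    proof -
      have "form_of (fock_comp (Suc n) (V (Suc n) G)) xs = form_of (fock_comp (Suc n) \<Psi>) xs" by (simp only: G(2))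
      then show ?thesis using that by (simp add: fock_comp.rep_eq minus_fock.rep_eq)
    qed
    ultimately have "\<Psi> - V (Suc n) G \<in> fock_upto n"
      unfolding fock_upto_def mem_Collect_eq using Suc_lessI[of n "length _"] by metis
    from Suc.IH[OF this] obtain F where F: "\<forall>j\<le>n. F j \<in> fock_level j" "\<Psi> - V (Suc n) G = (\<Sum>j\<le>n. V j (F j))" by blast
    define F' where "F' = F(Suc n := G)"
    have "(\<Sum>j\<le>n. V j (F' j)) = (\<Sum>j\<le>n. V j (F j))" by (intro sum.cong) (auto simp: F'_def)
    then have "\<Psi> = (\<Sum>j\<le>Suc n. V j (F' j))" using F(2) by (simp add: F'_def algebra_simps)
    moreover have "\<forall>j\<le>Suc n. F' j \<in> fock_level j" using F(1) G(1) by (auto simp: F'_def le_Suc_eq)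
    ultimately show ?case by blast
  qed
  show ?thesis by (rule that[OF lin cont upto mono surj])
qed

end

section \<open>The image transform\<close>

text \<open>Multilinearity in the front argument suffices, since symmetry moves each treated
  argument behind the others; the tail \<open>ys\<close> is there to receive them.\<close>

lemma form_of_scale: "form_of \<Phi> (map ((*\<^sub>R) r) xs @ ys) = complex_of_real r ^ length xs * form_of \<Phi> (xs @ ys)"
proof (induction xs arbitrary: ys)
  case (Cons x xs)
  have lin: "linear (\<lambda>x. form_of \<Phi> (x # map ((*\<^sub>R) r) xs @ ys))"
    by (rule bounded_linear.linear[OF fock_formsD(2)[OF form_of]])
  have "form_of \<Phi> (x # map ((*\<^sub>R) r) xs @ ys) = form_of \<Phi> (map ((*\<^sub>R) r) xs @ x # ys)"
    "form_of \<Phi> (xs @ x # ys) = form_of \<Phi> (x # xs @ ys)"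
    by (rule fock_formsD(1)[OF form_of], simp)+
  then show ?case using Cons.IH[of "x # ys"] linear_scale[OF lin, of r x] by (simp add: scaleR_conv_of_real)
qed simp

lemma adjoint_eqI:
  fixes A :: "'a::{real_inner, complete_space} \<Rightarrow> 'b::real_inner"
  assumes "bounded_linear A" "\<And>x. inner (A x) y = inner x z"
  shows "adjoint A y = z"
proof -
  have "inner x (adjoint A y) = inner x z" for x by (simp only: inner_adjoint[OF assms(1), symmetric] assms(2))
  then show ?thesis using vector_eq_ldot by blast
qed

text \<open>The functional on the right is bounded, so the rigging represents it, uniquely. In terms
  of Riesz vectors \<open>K\<^sup>+\<close> is the Hilbert space adjoint of \<open>K\<close>, which
  is why composing a polynomial with it applies powers of \<open>K\<close> to the
  coefficients.\<close>

lemma rigging_dual_op: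
  assumes p: "rigging \<iota> j p" and q: "rigging \<iota>' j' q" and K: "bounded_linear K"
  shows "q (dual_op p q K \<xi>) f = p \<xi> (K f)"
    and "riesz q (dual_op p q K \<xi>) = adjoint K (riesz p \<xi>)"
proof -
  have "bounded_linear (\<lambda>f. p \<xi> (K f))"
    using p by (intro bounded_linear_compose[OF _ K]) (simp add: rigging_def)
  then obtain \<omega> where "q \<omega> = (\<lambda>f. p \<xi> (K f))" using q unfolding rigging_def by blast
  then have \<omega>: "q \<omega> f = p \<xi> (K f)" for f by simp
  then have "dual_op p q K \<xi> = \<omega>"
    unfolding dual_op_def by (intro the_equality allI) (auto intro: rigging_eqI[OF q])
  then show *: "q (dual_op p q K \<xi>) f = p \<xi> (K f)" for f using \<omega> by simp
  show "riesz q (dual_op p q K \<xi>) = adjoint K (riesz p \<xi>)"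
    by (rule adjoint_eqI[OF K, symmetric])
      (simp add: rigging_riesz[OF p] rigging_riesz[OF q] * inner_commute[of "K _"] inner_commute[of _ "riesz q _"])
qed

text \<open>Two functionals with the same image agree on the range of \<open>K\<close>, hence by
  density and continuity everywhere. Injectivity is what allows every function on
  \<open>H\<^sub>-\<close> to factor through \<open>K\<^sup>+\<close>.\<close>

lemma inj_dual_op:
  assumes p: "rigging \<iota> j p" and q: "rigging \<iota>' j' q" and K: "bounded_linear K"
    and dense: "closure (range K) = UNIV"
  shows "inj (dual_op p q K)"
proof (rule injI)
  fix \<xi> \<eta> assume eq: "dual_op p q K \<xi> = dual_op p q K \<eta>"
  have "range K \<subseteq> {x. inner (riesz p \<xi>) x = inner (riesz p \<eta>) x}"
  proof clarify
    fix f
    show "inner (riesz p \<xi>) (K f) = inner (riesz p \<eta>) (K f)"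
      unfolding rigging_riesz[OF p] rigging_dual_op(1)[OF assms(1-3), symmetric] eq ..
  qed
  moreover have "closed {x. inner (riesz p \<xi>) x = inner (riesz p \<eta>) x}"
    by (intro closed_Collect_eq continuous_intros)
  ultimately have "closure (range K) \<subseteq> {x. inner (riesz p \<xi>) x = inner (riesz p \<eta>) x}" by (rule closure_minimal)
  then show "\<xi> = \<eta>" unfolding dense by (intro rigging_eqI[OF p]) (auto simp: rigging_riesz[OF p])
qed

section \<open>Isometric extension to the completion \<open>T\<close>\<close>

lemma dense_range_sequence:
  assumes "closure (range f) = UNIV"
  obtains g :: "nat \<Rightarrow> 'a" where "(\<lambda>n. f (g n)) \<longlonglongrightarrow> (y :: 'b::metric_space)"
proof -
  have "y \<in> closure (range f)" using assms by simp
  then obtain h where h: "\<And>n. h n \<in> range f" "h \<longlonglongrightarrow> y" unfolding closure_sequential by blast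
  then have "\<forall>n. \<exists>x. h n = f x" by blast
  from choice[OF this] obtain g where "\<And>n. h n = f (g n)" by blast
  then have "h = (\<lambda>n. f (g n))" by (rule ext)
  then show ?thesis using that h(2) by simp
qed

text \<open>\<open>A\<close> and \<open>\<kappa>\<close> induce the same scalar product, so
  \<open>A\<close> factors through \<open>\<kappa>\<close> as an isometry on a dense set. It extends
  by uniform continuity, and algebraic identities pass to the extension along sequences.\<close>

lemma extension_to_completion_isometry:
  fixes A :: "'q::real_normed_vector \<Rightarrow> 'h::{real_inner, complete_space}"
    and \<kappa> :: "'q \<Rightarrow> 't::{real_inner, complete_space}"
  assumes A: "linear A" "closure (range A) = UNIV" and \<kappa>: "is_completion A \<kappa>"
  defines "B \<equiv> extension_to_completion A \<kappa>"
  shows "bounded_linear B" and "inner (B x) (B y) = inner x y" and "surj B"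
proof -
  have lin: "linear \<kappa>" and dense: "closure (range \<kappa>) = UNIV" and iso: "\<And>f g. inner (\<kappa> f) (\<kappa> g) = inner (A f) (A g)"
    using \<kappa> by (auto simp: is_completion_def)
  have d: "dist (\<kappa> f) (\<kappa> g) = dist (A f) (A g)" for f g
    using iso[of "f - g" "f - g"] by (simp add: dist_norm norm_eq_sqrt_inner linear_diff[OF lin] linear_diff[OF A(1)])
  \<comment> \<open>The choice of preimage does not matter: elements with equal image under
    \<open>\<kappa>\<close> have distance 0 after \<open>A\<close> as well.\<close>
  define B0 where "B0 = (\<lambda>x. A (inv \<kappa> x))"
  have B0: "B0 (\<kappa> f) = A f" for f
    using d[of "inv \<kappa> (\<kappa> f)" f] by (simp add: B0_def f_inv_into_f)
  have "uniformly_continuous_on (range \<kappa>) B0"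
    unfolding uniformly_continuous_on_def by (force simp: B0 d)
  then obtain C where C: "uniformly_continuous_on UNIV C" "\<And>f. C (\<kappa> f) = A f"
    using uniformly_continuous_on_extension_on_closure[of "range \<kappa>" B0] unfolding dense by (metis B0 rangeI)
  have cont: "h \<longlonglongrightarrow> x \<Longrightarrow> (\<lambda>n. C (h n)) \<longlonglongrightarrow> C x" for h :: "nat \<Rightarrow> 't" and x
    using uniformly_continuous_imp_continuous[OF C(1)] by (simp add: continuous_on_sequentially o_def)
  have inner_C: "inner (C x) (C y) = inner x y" for x y
  proof -
    obtain f where f: "(\<lambda>n. \<kappa> (f n)) \<longlonglongrightarrow> x" using dense_range_sequence[OF dense] by blast
    obtain g where g: "(\<lambda>n. \<kappa> (g n)) \<longlonglongrightarrow> y" using dense_range_sequence[OF dense] by blast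
    have "(\<lambda>n. inner (\<kappa> (f n)) (\<kappa> (g n))) \<longlonglongrightarrow> inner (C x) (C y)"
      using tendsto_inner[OF cont[OF f] cont[OF g]] by (simp add: C(2) iso)
    then show ?thesis using tendsto_inner[OF f g] LIMSEQ_unique by blast
  qed
  have "bounded_linear C"
  proof (rule bounded_linear_intro[where K = 1])
    show "norm (C x) \<le> norm x * 1" for x by (simp add: norm_eq_sqrt_inner inner_C)
  next
    fix x y
    obtain f where f: "(\<lambda>n. \<kappa> (f n)) \<longlonglongrightarrow> x" using dense_range_sequence[OF dense] by blast
    obtain g where g: "(\<lambda>n. \<kappa> (g n)) \<longlonglongrightarrow> y" using dense_range_sequence[OF dense] by blast
    have "(\<lambda>n. C (\<kappa> (f n) + \<kappa> (g n))) \<longlonglongrightarrow> C (x + y)" by (intro cont tendsto_add f g)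
    moreover have "C (\<kappa> (f n) + \<kappa> (g n)) = C (\<kappa> (f n)) + C (\<kappa> (g n))" for n
      using C(2)[of "f n + g n"] by (simp add: linear_add[OF lin] linear_add[OF A(1)] C(2))
    ultimately show "C (x + y) = C x + C y"
      using tendsto_add[OF cont[OF f] cont[OF g]] LIMSEQ_unique by (simp only:) blast
  next
    fix r x
    obtain f where f: "(\<lambda>n. \<kappa> (f n)) \<longlonglongrightarrow> x" using dense_range_sequence[OF dense] by blast
    have "(\<lambda>n. C (r *\<^sub>R \<kappa> (f n))) \<longlonglongrightarrow> C (r *\<^sub>R x)" by (intro cont tendsto_scaleR tendsto_const f)
    moreover have "C (r *\<^sub>R \<kappa> (f n)) = r *\<^sub>R C (\<kappa> (f n))" for n
      using C(2)[of "r *\<^sub>R f n"] by (simp add: linear_scale[OF lin] linear_scale[OF A(1)] C(2))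
    ultimately show "C (r *\<^sub>R x) = r *\<^sub>R C x"
      using tendsto_scaleR[OF tendsto_const[of r] cont[OF f]] LIMSEQ_unique by (simp only:) blast
  qed
  have "B = C"
    unfolding B_def extension_to_completion_def
  proof (rule the_equality)
    show "bounded_linear C \<and> (\<forall>f. C (\<kappa> f) = A f)" using \<open>bounded_linear C\<close> C(2) by blast
    fix D assume D: "bounded_linear D \<and> (\<forall>f. D (\<kappa> f) = A f)"
    show "D = C"
    proof
      fix x
      obtain f where f: "(\<lambda>n. \<kappa> (f n)) \<longlonglongrightarrow> x" using dense_range_sequence[OF dense] by blast
      have "(\<lambda>n. D (\<kappa> (f n))) \<longlonglongrightarrow> D x" using D bounded_linear.tendsto[OF _ f] by blast
      then show "D x = C x" using cont[OF f] D C(2) LIMSEQ_unique by simp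
    qed
  qed
  then show "bounded_linear B" "inner (B x) (B y) = inner x y" using \<open>bounded_linear C\<close> inner_C by simp_all
  \<comment> \<open>A sequence of values of \<open>A\<close> tending to \<open>y\<close> is Cauchy,
    hence so are the corresponding values of \<open>\<kappa>\<close>, and completeness of the domain
    gives a preimage.\<close>
  have "y \<in> range C" for y
  proof -
    obtain f where f: "(\<lambda>n. A (f n)) \<longlonglongrightarrow> y" using dense_range_sequence[OF A(2)] by blast
    then have "Cauchy (\<lambda>n. A (f n))" by (rule LIMSEQ_imp_Cauchy)
    then have "Cauchy (\<lambda>n. \<kappa> (f n))" by (simp add: Cauchy_def d)
    then obtain x where "(\<lambda>n. \<kappa> (f n)) \<longlonglongrightarrow> x" by (auto simp: Cauchy_convergent_iff convergent_def)
    from cont[OF this] have "(\<lambda>n. A (f n)) \<longlonglongrightarrow> C x" by (simp add: C(2))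
    then show ?thesis using f LIMSEQ_unique by blast
  qed
  then show "surj B" using \<open>B = C\<close> by auto
qed

lemma closure_range_compose:
  fixes g :: "'b::metric_space \<Rightarrow> 'c::metric_space" and f :: "'a \<Rightarrow> 'b"
  assumes f: "closure (range f) = UNIV" and g: "closure (range g) = UNIV" "continuous_on UNIV g"
  shows "closure (range (g \<circ> f)) = UNIV"
proof -
  have "g ` closure (range f) \<subseteq> closure (g ` range f)"
    by (rule continuous_image_closure_subset[OF g(2)]) simp
  then have "range g \<subseteq> closure (range (g \<circ> f))" by (simp add: f image_comp)
  then have "closure (range g) \<subseteq> closure (range (g \<circ> f))" by (rule closure_minimal) simp
  then show ?thesis using g(1) by auto
qed

section \<open>Pullback of polynomials along \<open>K\<^sup>+\<close>\<close>

context jacobi_fourier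
begin

text \<open>
  Since \<^const>\<open>fock_map\<close> is only meaningful for contractions, \<open>K\<close> is rescaled to \<open>K / r\<close>; on the
  level \<open>j\<close> this changes \<open>K\<^sup>\<otimes>\<^sup>j\<close> by the factor \<open>r\<^sup>j\<close>, absorbed into the coefficients.
\<close>

lemma pullback_polynomials:
  fixes K :: "'q::{real_inner, complete_space} \<Rightarrow> 'p" and q :: "'n::{real_inner, complete_space} \<Rightarrow> 'q \<Rightarrow> real"
  assumes q: "rigging \<iota>' j' q" and K: "bounded_linear K" "closure (range K) = UNIV"
  obtains D where "\<And>n. closure (D n) = fock_upto n"
    "\<And>n Q. Q \<in> continuous_polynomials q n \<Longrightarrow> \<exists>\<Phi>\<in>D n. Q \<circ> dual_op p q K \<in> I \<Phi>"
    "\<And>n \<Phi>. \<Phi> \<in> D n \<Longrightarrow> \<exists>Q\<in>continuous_polynomials q n. Q \<circ> dual_op p q K \<in> I \<Phi>"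
proof -
  \<comment> \<open>The added 1 keeps \<open>r\<close> positive even when the operator norm is
    0.\<close>
  define r where "r = onorm K + 1"
  have r: "r > 0" using onorm_pos_le[OF K(1)] by (simp add: r_def)
  define S where "S = (\<lambda>f. K f /\<^sub>R r)"
  have S_bl: "bounded_linear S" unfolding S_def by (rule bounded_linear_compose[OF bounded_linear_scaleR_right K(1)])
  have S_le: "norm (S f) \<le> norm f" for f
  proof -
    have "norm (K f) \<le> r * norm f" using onorm[OF K(1), of f] by (simp add: r_def distrib_right add_increasing2)
    then show ?thesis using r by (simp add: S_def field_simps)
  qed
  interpret S: contraction S by (rule contraction.intro[OF S_bl S_le])
  have S_dense: "closure (range S) = UNIV"
  proof -
    have "S = (\<lambda>x. x /\<^sub>R r) \<circ> K" by (simp add: S_def o_def)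
    moreover have "surj (\<lambda>x :: 'p. x /\<^sub>R r)"
      by (rule surjI[of _ "\<lambda>x. r *\<^sub>R x"]) (use r in simp)
    ultimately show ?thesis using closure_range_compose[OF K(2), of "\<lambda>x. x /\<^sub>R r"] by (simp add: continuous_intros)
  qed
  have adj: "adjoint K v = r *\<^sub>R adjoint S v" for v
    using r by (intro adjoint_eqI[OF K(1)]) (simp add: inner_adjoint[OF S_bl, symmetric], simp add: S_def)
  obtain V :: "nat \<Rightarrow> 'p fock \<Rightarrow> 'p fock" where
    V_lin: "\<And>n. clinear_on (fock_level n) (V n)" and V_cont: "\<And>n. continuous_on (fock_level n) (V n)" and
    V_upto: "\<And>n. V n ` fock_level n \<subseteq> fock_upto n" and
    V_mono: "\<And>n F. F \<in> fock_level n \<Longrightarrow> (\<lambda>\<xi>. form_of F (replicate n (riesz p \<xi>))) \<in> I (fock_map \<iota> (V n F))" and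
    V_surj: "\<And>n \<Psi>. \<Psi> \<in> fock_upto n \<Longrightarrow> \<exists>F. (\<forall>j\<le>n. F j \<in> fock_level j) \<and> \<Psi> = (\<Sum>j\<le>n. V j (F j))"
    using polynomial_preimages by blast
  \<comment> \<open>By \<open>V_mono\<close>, \<open>T j d\<close> is the Fourier preimage of the
    monomial with coefficient \<open>fock_map S d\<close>. The sums of these up to degree
    \<open>n\<close> form \<open>D n\<close>.\<close>
  define T where "T = (\<lambda>j d. fock_map \<iota> (V j (fock_map S d)))"
  define D where "D = (\<lambda>n. {\<Sum>j\<le>n. T j (d j) | d. \<forall>j\<le>n. d j \<in> fock_level j})"
  have D_I: "(\<Sum>j\<le>n. T j (d j)) \<in> D n" if "\<forall>j\<le>n. d j \<in> fock_level j" for n d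
    unfolding D_def by (rule CollectI, rule exI[of _ d]) (simp add: that)
  have D_E: "\<exists>d. (\<forall>j\<le>n. d j \<in> fock_level j) \<and> x = (\<Sum>j\<le>n. T j (d j))" if "x \<in> D n" for n x
    using that unfolding D_def by blast
  have T_add: "T j (d + d') = T j d + T j d'" if "d \<in> fock_level j" "d' \<in> fock_level j" for j d d'
    using that V_lin[of j] S.fock_map_level by (simp add: T_def clinear_on_def S.fock_map_add fock_map_add)
  have T_cscale: "T j (cscale c d) = cscale c (T j d)" if "d \<in> fock_level j" for j d c
    using that V_lin[of j] S.fock_map_level by (simp add: T_def clinear_on_def S.fock_map_cscale fock_map_cscale)
  have T_zero: "T j 0 = 0" for j
  proof -
    have "cscale 0 \<Phi> = 0" for \<Phi> :: "'z::{real_inner, complete_space} fock"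
      by (rule fock_eqI) (simp add: cscale.rep_eq zero_fock.rep_eq)
    then show ?thesis using T_cscale[OF fock_level_zero, of j 0] by metis
  qed
  have T_upto: "T j d \<in> fock_upto n" if "d \<in> fock_level j" "j \<le> n" for j d n
  proof -
    have "V j (fock_map S d) \<in> fock_upto j"
      by (rule subsetD[OF V_upto imageI[OF S.fock_map_level[OF that(1)]]])
    then show ?thesis unfolding T_def by (intro fock_map_upto subsetD[OF fock_upto_mono[OF that(2)]])
  qed
  have D_sub: "subspace (D n)" for n
    unfolding subspace_def
  proof (intro conjI ballI allI)
    have "(\<Sum>j\<le>n. T j 0) \<in> D n" by (rule D_I) (simp add: fock_level_zero)
    then show "0 \<in> D n" by (simp add: T_zero)
  next
    fix x y assume "x \<in> D n" "y \<in> D n"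
    then obtain d e where d: "\<forall>j\<le>n. d j \<in> fock_level j" "x = (\<Sum>j\<le>n. T j (d j))"
      and e: "\<forall>j\<le>n. e j \<in> fock_level j" "y = (\<Sum>j\<le>n. T j (e j))" using D_E by blast
    have "x + y = (\<Sum>j\<le>n. T j (d j + e j))" unfolding d(2) e(2) sum.distrib[symmetric]
      using d(1) e(1) by (intro sum.cong refl) (simp add: T_add)
    then show "x + y \<in> D n" using D_I[of n "\<lambda>j. d j + e j"] d(1) e(1) by (simp add: fock_level_add)
  next
    fix c x assume "x \<in> D n"
    then obtain d where d: "\<forall>j\<le>n. d j \<in> fock_level j" "x = (\<Sum>j\<le>n. T j (d j))" using D_E by blast
    have "c *\<^sub>R x = (\<Sum>j\<le>n. T j (c *\<^sub>R d j))"
      unfolding d(2) scaleR_sum_right using d(1) by (intro sum.cong refl) (simp add: T_cscale scaleR_fock_eq)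
    then show "c *\<^sub>R x \<in> D n"
      using D_I[of n "\<lambda>j. c *\<^sub>R d j"] d(1) by (simp add: subspace_scale[OF subspace_fock_level])
  qed
  have T_in_D: "T j d \<in> D n" if "d \<in> fock_level j" "j \<le> n" for j d n
  proof -
    have "T j d = (\<Sum>i\<le>n. if i = j then T j d else 0)" using that by simp
    also have "\<dots> = (\<Sum>i\<le>n. T i (if i = j then d else 0))" by (intro sum.cong) (auto simp: T_zero)
    finally show ?thesis using D_I[of n "\<lambda>i. if i = j then d else 0"] that by (simp add: fock_level_zero)
  qed
  \<comment> \<open>Coefficients of the form \<open>fock_map S d\<close> are dense in level
    \<open>j\<close>, and \<open>V j\<close> is continuous.\<close>
  have V_in_D: "fock_map \<iota> (V j F) \<in> closure (D n)" if F: "F \<in> fock_level j" and j: "j \<le> n" for j F n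
  proof -
    have "F \<in> closure (fock_map S ` fock_level j)" by (rule S.closure_fock_map_level[OF S_dense F])
    then obtain h where h: "\<And>k. h k \<in> fock_map S ` fock_level j" "h \<longlonglongrightarrow> F" by (auto simp: closure_sequential)
    have hl: "h k \<in> fock_level j" for k using h(1)[of k] S.fock_map_level by auto
    have "(\<lambda>k. V j (h k)) \<longlonglongrightarrow> V j F"
      using V_cont[of j] h(2) hl F unfolding continuous_on_sequentially by (auto simp: o_def)
    then have lim: "(\<lambda>k. fock_map \<iota> (V j (h k))) \<longlonglongrightarrow> fock_map \<iota> (V j F)"
      by (rule bounded_linear.tendsto[OF bounded_linear_fock_map])
    have "fock_map \<iota> (V j (h k)) \<in> D n" for k
      using h(1)[of k] T_in_D[OF _ j] by (auto simp: T_def)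
    then show ?thesis unfolding closure_sequential using lim by (intro exI[of _ "\<lambda>k. fock_map \<iota> (V j (h k))"]) simp
  qed
  have "closure (D n) = fock_upto n" for n
  proof (rule antisym)
    have "D n \<subseteq> fock_upto n"
      using T_upto by (auto dest!: D_E intro!: subspace_sum[OF subspace_fock_upto])
    then show "closure (D n) \<subseteq> fock_upto n" by (rule closure_minimal[OF _ closed_fock_upto])
    note cl = subspace_closure[OF D_sub, of n]
    \<comment> \<open>Invertibility of the diagonal of \<open>V\<close> reaches every vector of
      degree at most \<open>n\<close> over \<open>H\<^sub>+\<close>.\<close>
    have 1: "fock_map \<iota> \<Psi> \<in> closure (D n)" if \<Psi>: "\<Psi> \<in> fock_upto n" for \<Psi>
    proof -
      obtain F where F: "\<forall>j\<le>n. F j \<in> fock_level j" "\<Psi> = (\<Sum>j\<le>n. V j (F j))" using V_surj[OF \<Psi>] by blast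
      show ?thesis unfolding F(2) fock_map_sum using F(1) V_in_D by (intro subspace_sum[OF cl]) auto
    qed
    \<comment> \<open>Density of \<open>H\<^sub>+\<close> in \<open>H\<close> passes to each
      level.\<close>
    have 2: "fock_level j \<subseteq> closure (D n)" if "j \<le> n" for j
    proof
      fix \<Phi> :: "'h fock" assume "\<Phi> \<in> fock_level j"
      then have "\<Phi> \<in> closure (fock_map \<iota> ` fock_level j)" by (rule closure_fock_map_level[OF dense_range])
      moreover have "closure (fock_map \<iota> ` fock_level j) \<subseteq> closure (D n)"
        using 1 fock_level_upto[OF that] by (intro closure_minimal) auto
      ultimately show "\<Phi> \<in> closure (D n)" by blast
    qed
    show "fock_upto n \<subseteq> closure (D n)"
    proof
      fix \<Phi> :: "'h fock" assume "\<Phi> \<in> fock_upto n"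
      moreover have "(\<Sum>j\<le>n. fock_comp j \<Phi>) \<in> closure (D n)"
        using 2 fock_level_comp by (intro subspace_sum[OF cl]) blast
      ultimately show "\<Phi> \<in> closure (D n)" by (simp add: fock_upto_sum_comp)
    qed
  qed
  moreover
  \<comment> \<open>The power of \<open>r\<close> undoes the rescaling, since the adjoint of
    \<open>K\<close> is \<open>r\<close> times that of \<open>S\<close>; the conjugation comes from
    the antilinear pairing.\<close>
  have pull: "(\<lambda>\<omega>. \<Sum>j\<le>n. fock_pairing q (sym_tensor (replicate j \<omega>)) (c j)) \<circ> dual_op p q K
      \<in> I (\<Sum>j\<le>n. T j (cscale (complex_of_real r ^ j) (fock_cnj (c j))))"
    if c: "\<forall>j\<le>n. c j \<in> fock_level j" for n c
  proof -
    have "(\<lambda>\<xi>. fock_pairing q (sym_tensor (replicate j (dual_op p q K \<xi>))) (c j))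
       \<in> I (T j (cscale (complex_of_real r ^ j) (fock_cnj (c j))))" if "j \<le> n" for j
    proof -
      have "fock_pairing q (sym_tensor (replicate j (dual_op p q K \<xi>))) (c j)
        = form_of (fock_map S (cscale (complex_of_real r ^ j) (fock_cnj (c j)))) (replicate j (riesz p \<xi>))" for \<xi>
        using form_of_scale[of "fock_cnj (c j)" r "replicate j (adjoint S (riesz p \<xi>))" "[]"]
        by (simp add: fock_pairing_sym_tensor[OF q] rigging_dual_op(2)[OF rigging q K(1)] adj
            S.form_of_fock_map cscale.rep_eq)
      then show ?thesis
        using c that by (simp add: T_def V_mono S.fock_map_level fock_level_cscale fock_cnj_level)
    qed
    then show ?thesis unfolding o_def by (intro I_sum) simp
  qed
  have "\<exists>\<Phi>\<in>D n. Q \<circ> dual_op p q K \<in> I \<Phi>" if Q: "Q \<in> continuous_polynomials q n" for n Q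
  proof -
    obtain c where c: "\<forall>j\<le>n. c j \<in> fock_level j" "Q = (\<lambda>\<omega>. \<Sum>j\<le>n. fock_pairing q (sym_tensor (replicate j \<omega>)) (c j))"
      using Q unfolding continuous_polynomials_def by blast
    have "(\<Sum>j\<le>n. T j (cscale (complex_of_real r ^ j) (fock_cnj (c j)))) \<in> D n"
      using c(1) by (intro D_I) (simp add: fock_level_cscale fock_cnj_level)
    then show ?thesis using pull[OF c(1)] unfolding c(2) by blast
  qed
  moreover have "\<exists>Q\<in>continuous_polynomials q n. Q \<circ> dual_op p q K \<in> I \<Phi>" if \<Phi>: "\<Phi> \<in> D n" for n \<Phi>
  proof -
    obtain d where d: "\<forall>j\<le>n. d j \<in> fock_level j" "\<Phi> = (\<Sum>j\<le>n. T j (d j))"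
      using D_E[OF \<Phi>] by blast
    \<comment> \<open>Inverts the passage from coefficients to \<open>d\<close>: divide by the power
      of \<open>r\<close>, then conjugate.\<close>
    define c where "c = (\<lambda>j. fock_cnj (cscale (inverse (complex_of_real r ^ j)) (d j)))"
    have c: "\<forall>j\<le>n. c j \<in> fock_level j" using d(1) by (simp add: c_def fock_cnj_level fock_level_cscale)
    have "cscale (complex_of_real r ^ j) (fock_cnj (c j)) = d j" for j
      using r by (intro fock_eqI) (simp add: c_def fock_cnj_fock_cnj cscale.rep_eq)
    then have "\<Phi> = (\<Sum>j\<le>n. T j (cscale (complex_of_real r ^ j) (fock_cnj (c j))))" by (simp add: d(2))
    moreover have "(\<lambda>\<omega>. \<Sum>j\<le>n. fock_pairing q (sym_tensor (replicate j \<omega>)) (c j)) \<in> continuous_polynomials q n"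
      unfolding continuous_polynomials_def using c by blast
    ultimately show ?thesis using pull[OF c] by blast
  qed
  ultimately show ?thesis by (rule that)
qed

end

theorem theorem3p2:
  fixes iH :: "'hp::{real_inner, complete_space} \<Rightarrow> 'h::{real_inner, polish_space}"
    and jH :: "'h \<Rightarrow> 'hm::{real_inner, complete_space}"
    and pH :: "'hm \<Rightarrow> 'hp \<Rightarrow> real"
    and iT :: "'tp::{real_inner, polish_space} \<Rightarrow> 't0::{real_inner, complete_space}"
    and jT :: "'t0 \<Rightarrow> 'tm::{real_inner, complete_space}"
    and pT :: "'tm \<Rightarrow> 'tp \<Rightarrow> real"
    and a b :: "nat \<Rightarrow> 'hp \<Rightarrow> 'h fock_op"
    and \<rho> :: "'hm measure"
    and P :: "'hm \<Rightarrow> nat \<Rightarrow> 'hm fock"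
    and I :: "'h fock \<Rightarrow> ('hm \<Rightarrow> complex) set"
    and K :: "'tp \<Rightarrow> 'hp"
    and \<kappa> :: "'tp \<Rightarrow> 't::{real_inner, complete_space}"
  defines "Kplus \<equiv> dual_op pH pT K"
  defines "\<rho>K \<equiv> image_measure \<rho> Kplus"
  defines "Kbar \<equiv> extension_to_completion (iH \<circ> K) \<kappa>"
  defines "IK \<equiv> image_transform \<rho> Kplus Kbar I"
  assumes "rigging iH jH pH" and "\<And>\<phi>. norm (iH \<phi>) \<le> norm \<phi>" and "hilbert_schmidt iH"
    and "rigging iT jT pT"
    and "jacobi_field iH a b"
    and "fourier_transform iH pH a b \<rho> P I"
    and "bounded_linear K" and "{f. K f = 0} = {0}" and "closure (range K) = UNIV"
    and "is_completion (iH \<circ> K) \<kappa>"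
  shows "(\<forall>n. IK ` fock_upto n = L2_closure \<rho>K (L2_class \<rho>K ` continuous_polynomials pT n)) \<and>
         L2_closure \<rho>K (L2_class \<rho>K ` (\<Union>n. continuous_polynomials pT n)) = L2 \<rho>K"
proof -
  interpret jacobi_fourier iH jH pH a b \<rho> P I
    using assms(5,6,9,10) by (intro jacobi_fourier.intro) auto
  note rT = \<open>rigging iT jT pT\<close> and K = \<open>bounded_linear K\<close> \<open>closure (range K) = UNIV\<close>
  have inj: "inj Kplus" unfolding Kplus_def by (rule inj_dual_op[OF rigging rT K])
  define I' where "I' = inv_into (L2 \<rho>K) (L2_pullback \<rho> Kplus) \<circ> I"
  have mem: "G \<in> I' \<Phi> \<longleftrightarrow> G \<circ> Kplus \<in> I \<Phi>" for G \<Phi>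
    unfolding I'_def \<rho>K_def by (rule image_unitary(1)[OF space_eq inj])
  interpret I': L2_unitary \<rho>K I'
    unfolding I'_def \<rho>K_def by (rule image_unitary(2)[OF space_eq inj])
  obtain D where D: "\<And>n. closure (D n) = fock_upto n"
    and DQ: "\<And>n Q. Q \<in> continuous_polynomials pT n \<Longrightarrow> \<exists>\<Phi>\<in>D n. Q \<circ> Kplus \<in> I \<Phi>"
    and QD: "\<And>n \<Phi>. \<Phi> \<in> D n \<Longrightarrow> \<exists>Q\<in>continuous_polynomials pT n. Q \<circ> Kplus \<in> I \<Phi>"
    using pullback_polynomials[OF rT K] unfolding Kplus_def by blast
  have img: "L2_class \<rho>K ` continuous_polynomials pT n = I' ` D n" for n
  proof (intro equalityI subsetI)
    fix u assume "u \<in> L2_class \<rho>K ` continuous_polynomials pT n"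
    then obtain Q \<Phi> where "u = L2_class \<rho>K Q" "\<Phi> \<in> D n" "Q \<in> I' \<Phi>" using DQ mem by blast
    then show "u \<in> I' ` D n" using I'.I_eq by blast
  next
    fix u assume "u \<in> I' ` D n"
    then obtain \<Phi> Q where "u = I' \<Phi>" "Q \<in> continuous_polynomials pT n" "Q \<in> I' \<Phi>" using QD mem by blast
    then show "u \<in> L2_class \<rho>K ` continuous_polynomials pT n" using I'.I_eq by blast
  qed
  have lin: "linear (iH \<circ> K)"
    using bounded_linear.linear[OF K(1)] bounded_linear.linear[OF bounded_linear] by (rule linear_compose)
  have dense: "closure (range (iH \<circ> K)) = UNIV"
    by (intro closure_range_compose K(2) dense_range linear_continuous_on bounded_linear)
  \<comment> \<open>\<open>Kbar\<close> is a surjective isometry, so its functor carries the degree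
    filtration of \<open>\<F>(T)\<close> onto that of \<open>\<F>(H)\<close>; only images under
    \<open>I'\<close> remain to be computed.\<close>
  have "fock_map Kbar ` fock_upto n = fock_upto n" for n
    unfolding Kbar_def using extension_to_completion_isometry[OF lin dense assms(14)]
    by (intro fock_map_upto_isometry)
  moreover have "IK = I' \<circ> fock_map Kbar"
    by (simp add: IK_def I'_def image_transform_def \<rho>K_def o_assoc)
  ultimately have IK: "IK ` fock_upto n = I' ` fock_upto n" for n by (simp only: image_comp[symmetric])
  \<comment> \<open>Each \<open>fock_upto n\<close> lies in the closure of the union, and finite
    vectors are dense in the Fock space.\<close>
  have "closure (\<Union>n. D n) = UNIV"
  proof -
    have "fock_fin \<subseteq> closure (\<Union>n. D n)" unfolding fock_fin_def D[symmetric] by (auto intro: closure_mono[THEN subsetD])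
    then have "closure fock_fin \<subseteq> closure (\<Union>n. D n)" by (rule closure_minimal) simp
    then show ?thesis by (auto simp: dense_fock_fin)
  qed
  moreover have "L2_class \<rho>K ` (\<Union>n. continuous_polynomials pT n) = I' ` (\<Union>n. D n)"
    unfolding image_UN img ..
  ultimately have "L2_closure \<rho>K (L2_class \<rho>K ` (\<Union>n. continuous_polynomials pT n)) = L2 \<rho>K"
    by (simp add: I'.L2_closure_image I'.range_I)
  then show ?thesis by (simp add: img IK I'.L2_closure_image D)
qed

end
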